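(* Let $c$ be a positive integer, $\mu>0$ and $\nu\in\mathbb{R}$. Let $R\in\Xi^\infty$ be such that $P=\langle R,R\rangle_R^D$ is a projection and $\langle R,R\rangle_L^E=\mathrm{Id}_E$. Let $\nabla$ be a Yang-Mills connection on $\Xi^\infty$ with curvature \[ \Theta_\nabla(X,Y)=0,\qquad\Theta_\nabla(X,Z)=0,\qquad\Theta_\nabla(Y,Z)=\frac{\pi i}{\mu}\,\mathrm{Id}_E . \] Then \[ S(P)\ \ge\ \Big|\frac{c}{2\pi i}\,\tau_E\big(\langle R,\nabla_Z(R)\rangle_L^E\big)-1\Big|, \] where $S(P)=2\,\tau_D\big((\delta_XP)^2+(\delta_YP)^2+(\delta_ZP)^2\big)$.
   Context: Notation: $\mathbb{T}=\mathbb{R}/\mathbb{Z}$, $M=\mathbb{R}\times\mathbb{T}$, $e(t)=\exp(2\pi it)$. Algebras: consider bounded continuous functions on $M\times\mathbb{Z}$ with compact support in the $\mathbb{Z}$-variable. $D_0$ consists of those with $\overline{e}(ckp(y-p\nu))\Phi(x+k,y,p)=\Phi(x,y,p)$ for all $k\in\mathbb{Z}$, with product $(\Phi*\Psi)(x,y,p)=\sum_q\Phi(x,y,q)\Psi(x-2q\mu,y-2q\nu,p-q)$ and involution $\Phi^*(x,y,p)=\overline\Phi(x-2p\mu,y-2p\nu,-p)$; the quantum Heisenberg manifold $D^c_{\mu\nu}$ is its closure in the multiplier algebra of $C_b(M)\rtimes_\lambda\mathbb{Z}$, $\lambda_p(x,y)=(x+2p\mu,y+2p\nu)$. $E_0$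 consists of those with $e(cpk(y-k\nu))\Psi(x-2k\mu,y-2k\nu,p)=\Psi(x,y,p)$ for all $k\in\mathbb{Z}$, and $E^c_{\mu\nu}$ is its closure in the multiplier algebra of $C_b(M)\rtimes_\sigma\mathbb{Z}$, $\sigma_p(x,y)=(x-p,y)$. $\mathrm{Id}_E(x,y,p)=\delta_0(p)$ is the unit of $E^c_{\mu\nu}$. Bimodule (Abadie): $\Xi$ is the completion of $C_c(M)$, a left-$E^c_{\mu\nu}$, right-$D^c_{\mu\nu}$ Morita equivalence bimodule, with inner products \[ \langle f,g\rangle_R^D(x,y,p)=\sum_{k}\overline e(ckp(y-p\nu))f(x+k,y)\overline g(x-2p\mu+k,y-2p\nu), \] \[ \langle f,g\rangle_L^E(x,y,p)=\sum_k e(cpk(y-k\nu))\overline f(x-2k\mu,y-2k\nu)g(x-2k\mu+p,y-2k\nu), \] and actions \[ (\Psi\cdot f)(x,y)=\sum_q\overline\Psi(x,y,q)f(x+q,y),\qquad (g\cdot\Phi)(x,y)=\sum_q g(x+2q\mu,y+2q\nu)\overline\Phi(x+2q\mu,y+2q\nu,q), \] satisfying $\langle f_1,f_2\rangle_L^E\cdot f_3=f_1\cdot\langle f_2,f_3\rangle_R^D$. Note the complex conjugates: the element $\frac{\pi i}{\mu}\mathrm{Id}_E$ acts on $f\in\Xi$ as $f\mapsto-\frac{\pi i}{\mu}f$. Smooth structure: the Heisenberg group $H$ ($\mathbb{R}^3$ with product $(x,y,z)(x',y',z')=(x+x',y+y',z+z'+cyx')$) acts on $D^c_{\mu\nu}$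 by $(L_{(r,s,t)}\Phi)(x,y,p)=e(p(t+cs(x-r-p\mu)))\Phi(x-r,y-s,p)$; $(D^c_{\mu\nu})^\infty$ is the subalgebra of smooth vectors in norm. The Lie algebra $\mathfrak h$ has basis $X=(0,1,0),Y=(1,0,0),Z=(0,0,1)$ with $[X,Y]=cZ$, $Z$ central, acting by \[ \delta_X\Phi=2\pi icp(x-p\mu)\Phi-\partial_y\Phi,\quad\delta_Y\Phi=-\partial_x\Phi,\quad\delta_Z\Phi=2\pi ip\Phi, \] extended linearly in $V\in\mathfrak h$. By a lemma of Connes there is a dense left-$(E^c_{\mu\nu})^\infty$, right-$(D^c_{\mu\nu})^\infty$ sub-bimodule $\Xi^\infty\subset\Xi$, on which the inner products take values in the smooth algebras, where $(E^c_{\mu\nu})^\infty$ is the corresponding dense smooth subalgebra. Connections: a (linear) connection is a linear assignment $V\in\mathfrak h\mapsto\nabla_V:\Xi^\infty\to\Xi^\infty$ of linear maps with $\nabla_V(\xi\cdot\Phi)=(\nabla_V\xi)\cdot\Phi+\xi\cdot\delta_V(\Phi)$. It is compatible if \[ \delta_V(\langle\xi,\eta\rangle_R^D)=\langle\nabla_V\xi,\eta\rangle_R^D+\langle\xi,\nabla_V\eta\rangle_R^D \quad\text{and}\quad \delta_V(\langle\xi,\eta\rangle_L^E)=\langle\nabla_V\xi,\eta\rangle_L^E+\langle\xi,\nabla_V\eta\rangle_L^E \] for all $\xi,\eta\in\Xi^\infty$, where on elements $T$ of $(E^c_{\mu\nu})^\infty$, viewed as operators on $\Xi^\infty$ by the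 left action, $\delta_V(T)=[\nabla_V,T]$. The curvature is $\Theta_\nabla(V,W)=\nabla_V\nabla_W-\nabla_W\nabla_V-\nabla_{[V,W]}$; its values are identified with elements of $E^c_{\mu\nu}$ via the left action. Traces: $\tau_D(\Phi)=\int_{\mathbb{T}^2}\Phi(x,y,0)\,dx\,dy$, and $\tau_E$ is the trace on $E^c_{\mu\nu}$ with $\tau_E(\langle\xi,\eta\rangle_L^E)=\tau_D(\langle\eta,\xi\rangle_R^D)$; explicitly $\tau_E(\Psi)=\int_{y=0}^{1}\int_{x=0}^{2\mu}\Psi(x,y,0)\,dx\,dy$. Yang-Mills connections: on the set of compatible connections put $\mathrm{YM}(\nabla)=-\tau_E\big(\Theta_\nabla(X,Y)^2+\Theta_\nabla(X,Z)^2+\Theta_\nabla(Y,Z)^2\big)$. A compatible $\nabla$ is a critical point of $\mathrm{YM}$ exactly when $[\nabla_Y,\Theta_\nabla(X,Y)]+[\nabla_Z,\Theta_\nabla(X,Z)]=0$, $[\nabla_X,\Theta_\nabla(Y,X)]+[\nabla_Z,\Theta_\nabla(Y,Z)]=0$, and $[\nabla_X,\Theta_\nabla(Z,X)]+[\nabla_Y,\Theta_\nabla(Z,Y)]-c\,\Theta_\nabla(X,Y)=0$. A Yang-Mills connection is a compatible connection that is both a critical point and a minimizer of $\mathrm{YM}$ (either a global minimizer, or a minimizer among compatible connections whose curvature values are constant multiples of $\mathrm{Id}_E$). *)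

theory Defs
  imports "HOL-Analysis.Analysis"
begin

text \<open>
  Functions on \<open>M = \<real> \<times> \<real>/\<int>\<close> are functions on \<open>\<real> \<times> \<real>\<close> that are 1-periodic in the second
  variable. An element of a crossed product \<open>C\<^sub>b(M) \<rtimes> \<int>\<close> is represented by its family of Fourier
  coefficients \<open>\<Phi>(x,y,p)\<close>, \<open>p \<in> \<int>\<close>, which determines it.
\<close>

type_synonym pt = "real \<times> real"
type_synonym coeffs = "pt \<Rightarrow> int \<Rightarrow> complex"
type_synonym mfun = "pt \<Rightarrow> complex"

definition echar :: "real \<Rightarrow> complex" where
  "echar t = exp (2 * complex_of_real pi * \<i> * complex_of_real t)"

definition cont_M :: "mfun \<Rightarrow> bool" where
  "cont_M f \<longleftrightarrow> continuous_on UNIV f \<and> (\<forall>x y. f (x, y + 1) = f (x, y))"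

definition Cb_M :: "mfun set" where
  "Cb_M = {f. cont_M f \<and> bounded (range f)}"

text \<open>The circle being compact, only the support in \<open>x\<close> has to be bounded.\<close>

definition Cc_M :: "mfun set" where
  "Cc_M = {f. cont_M f \<and> (\<exists>N. \<forall>x y. \<bar>x\<bar> > N \<longrightarrow> f (x, y) = 0)}"


subsection \<open>Crossed products by the integers\<close>

definition cp_mult :: "(int \<Rightarrow> pt \<Rightarrow> pt) \<Rightarrow> coeffs \<Rightarrow> coeffs \<Rightarrow> coeffs" where
  "cp_mult \<alpha> \<Phi> \<Psi> = (\<lambda>m p. \<Sum>\<^sub>\<infinity>q\<in>UNIV. \<Phi> m q * \<Psi> (\<alpha> (- q) m) (p - q))"

definition cp_star :: "(int \<Rightarrow> pt \<Rightarrow> pt) \<Rightarrow> coeffs \<Rightarrow> coeffs" where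
  "cp_star \<alpha> \<Phi> = (\<lambda>m p. cnj (\<Phi> (\<alpha> (- p) m) (- p)))"

text \<open>
  The \<open>C\<^sup>*\<close>-norm of \<open>C\<^sub>b(M) \<rtimes>\<^sub>\<alpha> \<int>\<close>. As \<open>\<int>\<close> is amenable, it is the supremum over \<open>m \<in> M\<close> of the
  operator norms on \<open>\<ell>\<^sup>2(\<int>)\<close> in the regular representations induced by evaluation at \<open>m\<close>, in
  which \<open>\<Phi>\<close> has the matrix \<open>(n, j) \<mapsto> \<Phi> (\<alpha>\<^sub>n m) (n - j)\<close>; the operator norm is computed
  on finitely supported vectors. The value is infinite if the matrices are not uniformly bounded.
  The crossed product is unital, so it coincides with its multiplier algebra. On limits in this
  norm the rows and columns of the matrices are square-summable, so the series in
  \<^const>\<open>cp_mult\<close> converges absolutely.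
\<close>

definition cp_norm :: "(int \<Rightarrow> pt \<Rightarrow> pt) \<Rightarrow> coeffs \<Rightarrow> ennreal" where
  "cp_norm \<alpha> \<Phi> =
     (SUP (m, A, \<xi>, \<eta>) \<in> {(m :: pt, A :: int set, \<xi> :: int \<Rightarrow> complex, \<eta> :: int \<Rightarrow> complex).
          finite A \<and> (\<Sum>n\<in>A. (cmod (\<xi> n))\<^sup>2) \<le> 1 \<and> (\<Sum>n\<in>A. (cmod (\<eta> n))\<^sup>2) \<le> 1}.
        ennreal (cmod (\<Sum>n\<in>A. \<Sum>j\<in>A. cnj (\<eta> n) * \<Phi> (\<alpha> n m) (n - j) * \<xi> j)))"

definition cp_closure :: "(int \<Rightarrow> pt \<Rightarrow> pt) \<Rightarrow> coeffs set \<Rightarrow> coeffs set" where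
  "cp_closure \<alpha> S =
     {\<Phi>. \<exists>F :: nat \<Rightarrow> coeffs. (\<forall>n. F n \<in> S) \<and>
          ((\<lambda>n. cp_norm \<alpha> (\<lambda>m p. \<Phi> m p - F n m p)) \<longlonglongrightarrow> 0)}"

definition lam :: "real \<Rightarrow> real \<Rightarrow> int \<Rightarrow> pt \<Rightarrow> pt" where
  "lam \<mu> \<nu> p = (\<lambda>(x, y). (x + 2 * of_int p * \<mu>, y + 2 * of_int p * \<nu>))"

definition sig :: "int \<Rightarrow> pt \<Rightarrow> pt" where
  "sig p = (\<lambda>(x, y). (x - of_int p, y))"


subsection \<open>The algebras \<open>D\<^sup>c\<^sub>\<mu>\<^sub>\<nu>\<close> and \<open>E\<^sup>c\<^sub>\<mu>\<^sub>\<nu>\<close>\<close>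

definition D0 :: "int \<Rightarrow> real \<Rightarrow> real \<Rightarrow> coeffs set" where
  "D0 c \<mu> \<nu> =
     {\<Phi>. (\<forall>p. (\<lambda>m. \<Phi> m p) \<in> Cb_M) \<and> finite {p. \<exists>m. \<Phi> m p \<noteq> 0} \<and>
          (\<forall>k x y p. cnj (echar (of_int (c * k * p) * (y - of_int p * \<nu>))) * \<Phi> (x + of_int k, y) p
                       = \<Phi> (x, y) p)}"

definition D_alg :: "int \<Rightarrow> real \<Rightarrow> real \<Rightarrow> coeffs set" where
  "D_alg c \<mu> \<nu> = cp_closure (lam \<mu> \<nu>) (D0 c \<mu> \<nu>)"

definition E0 :: "int \<Rightarrow> real \<Rightarrow> real \<Rightarrow> coeffs set" where
  "E0 c \<mu> \<nu> =
     {\<Psi>. (\<forall>p. (\<lambda>m. \<Psi> m p) \<in> Cb_M) \<and> finite {p. \<exists>m. \<Psi> m p \<noteq> 0} \<and>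
          (\<forall>k x y p. echar (of_int (c * p * k) * (y - of_int k * \<nu>)) *
                       \<Psi> (x - 2 * of_int k * \<mu>, y - 2 * of_int k * \<nu>) p = \<Psi> (x, y) p)}"

definition E_alg :: "int \<Rightarrow> real \<Rightarrow> real \<Rightarrow> coeffs set" where
  "E_alg c \<mu> \<nu> = cp_closure sig (E0 c \<mu> \<nu>)"

definition Id_E :: coeffs where
  "Id_E = (\<lambda>m p. if p = 0 then 1 else 0)"

definition projection_D :: "int \<Rightarrow> real \<Rightarrow> real \<Rightarrow> coeffs \<Rightarrow> bool" where
  "projection_D c \<mu> \<nu> P \<longleftrightarrow>
     P \<in> D_alg c \<mu> \<nu> \<and> cp_mult (lam \<mu> \<nu>) P P = P \<and> cp_star (lam \<mu> \<nu>) P = P"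

definition tau_D :: "coeffs \<Rightarrow> complex" where
  "tau_D \<Phi> = integral (cbox (0, 0) (1, 1)) (\<lambda>m. \<Phi> m 0)"

definition tau_E :: "real \<Rightarrow> coeffs \<Rightarrow> complex" where
  "tau_E \<mu> \<Psi> = integral (cbox (0, 0) (2 * \<mu>, 1)) (\<lambda>m. \<Psi> m 0)"


subsection \<open>The Morita equivalence bimodule\<close>

definition ip_D :: "int \<Rightarrow> real \<Rightarrow> real \<Rightarrow> mfun \<Rightarrow> mfun \<Rightarrow> coeffs" where
  "ip_D c \<mu> \<nu> f g = (\<lambda>(x, y) p. \<Sum>\<^sub>\<infinity>k\<in>UNIV.
     cnj (echar (of_int (c * k * p) * (y - of_int p * \<nu>))) * f (x + of_int k, y) *
       cnj (g (x - 2 * of_int p * \<mu> + of_int k, y - 2 * of_int p * \<nu>)))"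

definition ip_E :: "int \<Rightarrow> real \<Rightarrow> real \<Rightarrow> mfun \<Rightarrow> mfun \<Rightarrow> coeffs" where
  "ip_E c \<mu> \<nu> f g = (\<lambda>(x, y) p. \<Sum>\<^sub>\<infinity>k\<in>UNIV.
     echar (of_int (c * p * k) * (y - of_int k * \<nu>)) *
       cnj (f (x - 2 * of_int k * \<mu>, y - 2 * of_int k * \<nu>)) *
       g (x - 2 * of_int k * \<mu> + of_int p, y - 2 * of_int k * \<nu>))"

text \<open>Both actions are conjugate-linear in the algebra element.\<close>

definition act_E :: "coeffs \<Rightarrow> mfun \<Rightarrow> mfun" where
  "act_E \<Psi> f = (\<lambda>(x, y). \<Sum>\<^sub>\<infinity>q\<in>UNIV. cnj (\<Psi> (x, y) q) * f (x + of_int q, y))"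

definition act_D :: "real \<Rightarrow> real \<Rightarrow> mfun \<Rightarrow> coeffs \<Rightarrow> mfun" where
  "act_D \<mu> \<nu> g \<Phi> = (\<lambda>m. \<Sum>\<^sub>\<infinity>q\<in>UNIV. g (lam \<mu> \<nu> q m) * cnj (\<Phi> (lam \<mu> \<nu> q m) q))"

text \<open>
  The bimodule norm is \<open>\<parallel>f\<parallel>\<^sup>2 = \<parallel>\<langle>f,f\<rangle>\<^sub>R\<parallel>\<close>. It dominates \<open>(\<Sum>\<^sub>k \<bar>f(x + k, y)\<bar>\<^sup>2)\<^sup>1\<^sup>/\<^sup>2\<close> uniformly in \<open>(x, y)\<close>,
  so the elements of the completion of \<open>C\<^sub>c(M)\<close> are again functions on \<open>M\<close>, namely the limits in
  this norm. The summability condition guarantees that the series in \<^const>\<open>ip_D\<close> converge,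
  since \<^const>\<open>infsum\<close> is 0 on a divergent series.
\<close>

definition Xi_closure :: "int \<Rightarrow> real \<Rightarrow> real \<Rightarrow> mfun set \<Rightarrow> mfun set" where
  "Xi_closure c \<mu> \<nu> S =
     {f. (\<forall>x y. (\<lambda>k :: int. (cmod (f (x + of_int k, y)))\<^sup>2) summable_on UNIV) \<and>
         (\<exists>F :: nat \<Rightarrow> mfun. (\<forall>n. F n \<in> S) \<and>
            ((\<lambda>n. cp_norm (lam \<mu> \<nu>)
                    (ip_D c \<mu> \<nu> (\<lambda>m. f m - F n m) (\<lambda>m. f m - F n m))) \<longlonglongrightarrow> 0))}"

definition Xi :: "int \<Rightarrow> real \<Rightarrow> real \<Rightarrow> mfun set" where
  "Xi c \<mu> \<nu> = Xi_closure c \<mu> \<nu> Cc_M"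


subsection \<open>Smooth structure\<close>

text \<open>
  Group and Lie algebra elements are given by their coordinates \<open>(r, s, t)\<close>, so that \<open>X\<close> is the
  second and \<open>Y\<close> the first basis vector.
\<close>

type_synonym lie = "real \<times> real \<times> real"

definition lieX :: lie where "lieX = (0, 1, 0)"
definition lieY :: lie where "lieY = (1, 0, 0)"
definition lieZ :: lie where "lieZ = (0, 0, 1)"

text \<open>Bilinear extension of \<open>[X, Y] = c Z\<close> with \<open>Z\<close> central.\<close>

definition lie_bracket :: "int \<Rightarrow> lie \<Rightarrow> lie \<Rightarrow> lie" where
  "lie_bracket c = (\<lambda>(r, s, t) (r', s', t'). (0, 0, of_int c * (s * r' - r * s')))"

definition heis_act :: "int \<Rightarrow> real \<Rightarrow> lie \<Rightarrow> coeffs \<Rightarrow> coeffs" where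
  "heis_act c \<mu> = (\<lambda>(r, s, t) \<Phi> (x, y) p.
     echar (of_int p * (t + of_int c * s * (x - r - of_int p * \<mu>))) * \<Phi> (x - r, y - s) p)"

text \<open>
  A map on \<open>\<real>\<^sup>3\<close> is smooth in norm if all its iterated partial derivatives exist and are
  continuous in norm; \<open>G bs\<close> is the iterated partial derivative along the basis vectors \<open>bs\<close>.
\<close>

definition cp_smooth_map :: "(int \<Rightarrow> pt \<Rightarrow> pt) \<Rightarrow> (lie \<Rightarrow> coeffs) \<Rightarrow> bool" where
  "cp_smooth_map \<alpha> F \<longleftrightarrow>
     (\<exists>G :: lie list \<Rightarrow> lie \<Rightarrow> coeffs. G [] = F \<and>
        (\<forall>bs. set bs \<subseteq> Basis \<longrightarrow>
           (\<forall>g. ((\<lambda>h. cp_norm \<alpha> (\<lambda>m p. G bs h m p - G bs g m p)) \<longlongrightarrow> 0) (at g)) \<and>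
           (\<forall>g. \<forall>b\<in>Basis.
              ((\<lambda>h :: real. cp_norm \<alpha> (\<lambda>m p.
                   (G bs (g + h *\<^sub>R b) m p - G bs g m p) / complex_of_real h - G (b # bs) g m p))
                \<longlongrightarrow> 0) (at 0))))"

definition D_smooth :: "int \<Rightarrow> real \<Rightarrow> real \<Rightarrow> coeffs set" where
  "D_smooth c \<mu> \<nu> =
     {\<Phi> \<in> D_alg c \<mu> \<nu>. cp_smooth_map (lam \<mu> \<nu>) (\<lambda>g. heis_act c \<mu> g \<Phi>)}"

text \<open>\<open>\<delta>\<^sub>V\<close> for \<open>V = r Y + s X + t Z\<close>\<close>

definition delta :: "int \<Rightarrow> real \<Rightarrow> lie \<Rightarrow> coeffs \<Rightarrow> coeffs" where
  "delta c \<mu> = (\<lambda>(r, s, t) \<Phi> (x, y) p.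
       of_real r * (- vector_derivative (\<lambda>u. \<Phi> (u, y) p) (at x))
     + of_real s * (2 * of_real pi * \<i> * of_int c * of_int p * of_real (x - of_int p * \<mu>) * \<Phi> (x, y) p
                      - vector_derivative (\<lambda>u. \<Phi> (x, u) p) (at y))
     + of_real t * (2 * of_real pi * \<i> * of_int p * \<Phi> (x, y) p))"

text \<open>
  The data provided by the lemma of Connes: a dense *-subalgebra \<open>Einf\<close> of \<open>E\<^sup>c\<^sub>\<mu>\<^sub>\<nu>\<close> and a dense
  \<open>Einf\<close>-\<open>(D\<^sup>c\<^sub>\<mu>\<^sub>\<nu>)\<^sup>\<infinity>\<close> sub-bimodule \<open>Xiinf\<close> on which the inner products are smooth.
\<close>

definition smooth_bimodule ::
  "int \<Rightarrow> real \<Rightarrow> real \<Rightarrow> coeffs set \<Rightarrow> mfun set \<Rightarrow> bool" where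
  "smooth_bimodule c \<mu> \<nu> Einf Xiinf \<longleftrightarrow>
     Einf \<subseteq> E_alg c \<mu> \<nu> \<and> E_alg c \<mu> \<nu> \<subseteq> cp_closure sig Einf \<and>
     (\<forall>\<Phi>\<in>Einf. \<forall>\<Psi>\<in>Einf. \<forall>a b. (\<lambda>m p. a * \<Phi> m p + b * \<Psi> m p) \<in> Einf) \<and>
     (\<forall>\<Phi>\<in>Einf. \<forall>\<Psi>\<in>Einf. cp_mult sig \<Phi> \<Psi> \<in> Einf) \<and>
     (\<forall>\<Phi>\<in>Einf. cp_star sig \<Phi> \<in> Einf) \<and>
     Xiinf \<subseteq> Xi c \<mu> \<nu> \<and> Xi c \<mu> \<nu> \<subseteq> Xi_closure c \<mu> \<nu> Xiinf \<and>
     (\<forall>\<xi>\<in>Xiinf. \<forall>\<eta>\<in>Xiinf. \<forall>a b. (\<lambda>m. a * \<xi> m + b * \<eta> m) \<in> Xiinf) \<and>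
     (\<forall>\<Psi>\<in>Einf. \<forall>\<xi>\<in>Xiinf. act_E \<Psi> \<xi> \<in> Xiinf) \<and>
     (\<forall>\<xi>\<in>Xiinf. \<forall>\<Phi>\<in>D_smooth c \<mu> \<nu>. act_D \<mu> \<nu> \<xi> \<Phi> \<in> Xiinf) \<and>
     (\<forall>\<xi>\<in>Xiinf. \<forall>\<eta>\<in>Xiinf. ip_E c \<mu> \<nu> \<xi> \<eta> \<in> Einf \<and> ip_D c \<mu> \<nu> \<xi> \<eta> \<in> D_smooth c \<mu> \<nu>)"


subsection \<open>Connections and the Yang-Mills functional\<close>

type_synonym conn = "lie \<Rightarrow> mfun \<Rightarrow> mfun"

definition connection :: "int \<Rightarrow> real \<Rightarrow> real \<Rightarrow> mfun set \<Rightarrow> conn \<Rightarrow> bool" where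
  "connection c \<mu> \<nu> Xiinf nab \<longleftrightarrow>
     (\<forall>V. \<forall>\<xi>\<in>Xiinf. nab V \<xi> \<in> Xiinf) \<and>
     (\<forall>V. \<forall>\<xi>\<in>Xiinf. \<forall>\<eta>\<in>Xiinf. \<forall>a b.
        nab V (\<lambda>m. a * \<xi> m + b * \<eta> m) = (\<lambda>m. a * nab V \<xi> m + b * nab V \<eta> m)) \<and>
     (\<forall>V W. \<forall>a b :: real. \<forall>\<xi>\<in>Xiinf.
        nab (a *\<^sub>R V + b *\<^sub>R W) \<xi> = (\<lambda>m. of_real a * nab V \<xi> m + of_real b * nab W \<xi> m)) \<and>
     (\<forall>V. \<forall>\<xi>\<in>Xiinf. \<forall>\<Phi>\<in>D_smooth c \<mu> \<nu>.
        nab V (act_D \<mu> \<nu> \<xi> \<Phi>) =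
          (\<lambda>m. act_D \<mu> \<nu> (nab V \<xi>) \<Phi> m + act_D \<mu> \<nu> \<xi> (delta c \<mu> V \<Phi>) m))"

text \<open>
  The second condition is \<open>\<delta>\<^sub>V(T) = [\<nabla>\<^sub>V, T]\<close> for \<open>T = \<langle>\<xi>,\<eta>\<rangle>\<^sub>L\<close>, as an identity between operators
  on \<open>Xiinf\<close>.
\<close>

definition compatible :: "int \<Rightarrow> real \<Rightarrow> real \<Rightarrow> mfun set \<Rightarrow> conn \<Rightarrow> bool" where
  "compatible c \<mu> \<nu> Xiinf nab \<longleftrightarrow>
     connection c \<mu> \<nu> Xiinf nab \<and>
     (\<forall>V. \<forall>\<xi>\<in>Xiinf. \<forall>\<eta>\<in>Xiinf.
        delta c \<mu> V (ip_D c \<mu> \<nu> \<xi> \<eta>) =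
          (\<lambda>m p. ip_D c \<mu> \<nu> (nab V \<xi>) \<eta> m p + ip_D c \<mu> \<nu> \<xi> (nab V \<eta>) m p)) \<and>
     (\<forall>V. \<forall>\<xi>\<in>Xiinf. \<forall>\<eta>\<in>Xiinf. \<forall>\<zeta>\<in>Xiinf.
        (\<lambda>m. nab V (act_E (ip_E c \<mu> \<nu> \<xi> \<eta>) \<zeta>) m - act_E (ip_E c \<mu> \<nu> \<xi> \<eta>) (nab V \<zeta>) m) =
          act_E (\<lambda>m p. ip_E c \<mu> \<nu> (nab V \<xi>) \<eta> m p + ip_E c \<mu> \<nu> \<xi> (nab V \<eta>) m p) \<zeta>)"

definition curvature :: "int \<Rightarrow> conn \<Rightarrow> lie \<Rightarrow> lie \<Rightarrow> mfun \<Rightarrow> mfun" where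
  "curvature c nab V W \<xi> =
     (\<lambda>m. nab V (nab W \<xi>) m - nab W (nab V \<xi>) m - nab (lie_bracket c V W) \<xi> m)"

text \<open>\<open>\<Theta>\<^sub>\<nabla>(V, W) = T\<close> under the identification of elements of \<open>E\<^sup>c\<^sub>\<mu>\<^sub>\<nu>\<close> with operators by the left action\<close>

definition curvature_is ::
  "int \<Rightarrow> real \<Rightarrow> real \<Rightarrow> mfun set \<Rightarrow> conn \<Rightarrow> lie \<Rightarrow> lie \<Rightarrow> coeffs \<Rightarrow> bool" where
  "curvature_is c \<mu> \<nu> Xiinf nab V W T \<longleftrightarrow>
     T \<in> E_alg c \<mu> \<nu> \<and> (\<forall>\<xi>\<in>Xiinf. curvature c nab V W \<xi> = act_E T \<xi>)"

definition curvature_E ::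
  "int \<Rightarrow> real \<Rightarrow> real \<Rightarrow> mfun set \<Rightarrow> conn \<Rightarrow> lie \<Rightarrow> lie \<Rightarrow> coeffs" where
  "curvature_E c \<mu> \<nu> Xiinf nab V W = (THE T. curvature_is c \<mu> \<nu> Xiinf nab V W T)"

text \<open>
  For compatible connections the curvature is skew-adjoint, so the trace below is real and
  taking the real part loses nothing.
\<close>

definition YM :: "int \<Rightarrow> real \<Rightarrow> real \<Rightarrow> mfun set \<Rightarrow> conn \<Rightarrow> real" where
  "YM c \<mu> \<nu> Xiinf nab =
     (let \<Theta> = curvature_E c \<mu> \<nu> Xiinf nab; sq = (\<lambda>T. cp_mult sig T T) in
      - Re (tau_E \<mu> (\<lambda>m p. sq (\<Theta> lieX lieY) m p + sq (\<Theta> lieX lieZ) m p + sq (\<Theta> lieY lieZ) m p)))"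

text \<open>
  The compatible connections form a real affine space; a critical point is one at which the
  derivative of \<^const>\<open>YM\<close> along every line in this space vanishes.
\<close>

definition YM_critical :: "int \<Rightarrow> real \<Rightarrow> real \<Rightarrow> mfun set \<Rightarrow> conn \<Rightarrow> bool" where
  "YM_critical c \<mu> \<nu> Xiinf nab \<longleftrightarrow>
     compatible c \<mu> \<nu> Xiinf nab \<and>
     (\<forall>nab'. compatible c \<mu> \<nu> Xiinf nab' \<longrightarrow>
        ((\<lambda>t :: real. YM c \<mu> \<nu> Xiinf
             (\<lambda>V \<xi> m. nab V \<xi> m + of_real t * (nab' V \<xi> m - nab V \<xi> m)))
           has_real_derivative 0) (at 0))"

definition constant_curvature :: "int \<Rightarrow> real \<Rightarrow> real \<Rightarrow> mfun set \<Rightarrow> conn \<Rightarrow> bool" where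
  "constant_curvature c \<mu> \<nu> Xiinf nab \<longleftrightarrow>
     (\<forall>V W. \<exists>a :: complex. curvature_is c \<mu> \<nu> Xiinf nab V W (\<lambda>m p. a * Id_E m p))"

definition YM_minimizer_in :: "int \<Rightarrow> real \<Rightarrow> real \<Rightarrow> mfun set \<Rightarrow> conn set \<Rightarrow> conn \<Rightarrow> bool" where
  "YM_minimizer_in c \<mu> \<nu> Xiinf \<C> nab \<longleftrightarrow>
     nab \<in> \<C> \<and> (\<forall>nab'\<in>\<C>. YM c \<mu> \<nu> Xiinf nab \<le> YM c \<mu> \<nu> Xiinf nab')"

definition yang_mills_connection :: "int \<Rightarrow> real \<Rightarrow> real \<Rightarrow> mfun set \<Rightarrow> conn \<Rightarrow> bool" where
  "yang_mills_connection c \<mu> \<nu> Xiinf nab \<longleftrightarrow>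
     compatible c \<mu> \<nu> Xiinf nab \<and> YM_critical c \<mu> \<nu> Xiinf nab \<and>
     (YM_minimizer_in c \<mu> \<nu> Xiinf {nab'. compatible c \<mu> \<nu> Xiinf nab'} nab \<or>
      YM_minimizer_in c \<mu> \<nu> Xiinf
        {nab'. compatible c \<mu> \<nu> Xiinf nab' \<and> constant_curvature c \<mu> \<nu> Xiinf nab'} nab)"

definition S_action :: "int \<Rightarrow> real \<Rightarrow> real \<Rightarrow> coeffs \<Rightarrow> complex" where
  "S_action c \<mu> \<nu> P =
     (let sq = (\<lambda>T. cp_mult (lam \<mu> \<nu>) T T) in
      2 * tau_D (\<lambda>m p. sq (delta c \<mu> lieX P) m p + sq (delta c \<mu> lieY P) m p
                        + sq (delta c \<mu> lieZ P) m p))"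

end

theory Submission
  imports Defs
begin

text \<open>
  At every point \<open>m\<close> a function \<open>f\<close> on \<open>M\<close> gives an infinite matrix, indexed by translates of \<open>m\<close>, such that
  \<open>\<langle>f,g\<rangle>\<^sub>R = F G\<^sup>*\<close> and \<open>\<langle>f,g\<rangle>\<^sub>L = F\<^sup>* G\<close> up to conventions. The matrix \<open>B\<close> of \<open>R\<close> is an isometry. Let \<open>D\<close> be the matrix of
  \<open>\<nabla>\<^sub>V R\<close>. Compatibility on the left side makes \<open>A = B\<^sup>* D\<close> skew-adjoint, so \<open>\<delta>\<^sub>V P = D B\<^sup>* + B D\<^sup>*\<close> equals
  \<open>W B\<^sup>* + B W\<^sup>*\<close> with \<open>W = (1 - B B\<^sup>*) D\<close>, whence \<open>\<tau>(W W\<^sup>*) \<le> \<tau>((\<delta>\<^sub>V P)\<^sup>2)\<close>. Traces of commutators of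
  skew elements vanish, so the imaginary part of \<open>(\<nabla>\<^sub>V R, \<nabla>\<^sub>W R)\<close> in \<open>L\<^sup>2\<close> only depends on the two residuals \<open>W\<close> and is at
  most half the sum of their squares. As \<open>\<tau> \<circ> \<delta>\<^sub>V = 0\<close>, it is given by the curvature: it equals \<open>-\<pi>\<close> for
  \<open>(Y, Z)\<close> and \<open>c \<tau>(\<langle>R, \<nabla>\<^sub>Z R\<rangle>\<^sub>L) / 2i\<close> for \<open>(X, Y)\<close>. These two bounds give more than the claim.

  The elements of \<open>\<Xi>\<close> are only square-summable along translates, so double series over both lattices need not
  converge absolutely; they are exchanged through operator bounds, and all interchanges with integrals are
  reduced by polarization to nonnegative functions.
\<close>

subsection \<open>Square-summable families and bounded matrices\<close>

text \<open>The two traces live on different fundamental domains, of width 1 and 2\<mu> in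
  \<open>x\<close>. Squared rows of a covariant matrix over the first and squared columns over the
  second unfold to the same integral over the whole line times the circle; this is the trace
  identity in the form used. Nothing controls the size of A, so its contribution is cancelled, not
  estimated: 4 Im (f,g) = |f + ig|^2 - |f - ig|^2, Pythagoras splits each square into a residual
  part and an A part, and the A parts agree because, for skew A_f and A_g, the matrix A_f + iA_g is
  minus the adjoint of A_f - iA_g. Only squares of a single matrix are ever integrated. What is left
  is a difference of two numbers between 0 and 2|W_f|^2 + 2|W_g|^2, which is where the factor one
  half comes from. The comparison of W with \<delta>P is a Bessel inequality applied row by row:
  multiplying \<delta>P by B from the right gives W.\<close>

definition l2 :: "('a \<Rightarrow> complex) \<Rightarrow> bool" where
  "l2 u \<longleftrightarrow> (\<lambda>k. (cmod (u k))\<^sup>2) summable_on UNIV"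

definition nsq :: "('a \<Rightarrow> complex) \<Rightarrow> real" where
  "nsq u = (\<Sum>\<^sub>\<infinity>k. (cmod (u k))\<^sup>2)"

text \<open>Bilinear, not sesquilinear: moving a matrix across \<open>dot\<close> is then plain
  transposition (\<open>tr\<close>), and every conjugation is visible as \<open>cnj\<close> or
  \<open>cj\<close>.\<close>

definition dot :: "('a \<Rightarrow> complex) \<Rightarrow> ('a \<Rightarrow> complex) \<Rightarrow> complex" where
  "dot u v = (\<Sum>\<^sub>\<infinity>k. u k * v k)"

lemma nsq_nonneg [simp]: "0 \<le> nsq u"
  unfolding nsq_def by (rule infsum_nonneg) simp

lemma l2_cnj [simp]: "l2 (\<lambda>k. cnj (u k)) = l2 u"
  by (simp add: l2_def)

lemma nsq_cnj [simp]: "nsq (\<lambda>k. cnj (u k)) = nsq u"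
  by (simp add: nsq_def)

lemma dot_commute: "dot u v = dot v u"
  by (simp add: dot_def mult.commute)

lemma cnj_dot: "cnj (dot u v) = dot (\<lambda>k. cnj (u k)) (\<lambda>k. cnj (v k))"
  unfolding dot_def by (simp flip: infsum_cnj)

lemma l2_boundedI:
  assumes "\<And>A. finite A \<Longrightarrow> (\<Sum>k\<in>A. (cmod (u k))\<^sup>2) \<le> C"
  shows "l2 u" "nsq u \<le> C"
proof -
  show "l2 u" unfolding l2_def
    by (rule nonneg_bdd_above_summable_on) (auto intro!: bdd_aboveI[where M = C] assms)
  then show "nsq u \<le> C"
    unfolding nsq_def l2_def by (intro infsum_le_finite_sums) (auto intro: assms)
qed

lemma sum_le_nsq: "l2 u \<Longrightarrow> finite A \<Longrightarrow> (\<Sum>k\<in>A. (cmod (u k))\<^sup>2) \<le> nsq u"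
  unfolding nsq_def l2_def by (rule finite_sum_le_infsum) auto

lemma L2_set_le_nsq: "l2 u \<Longrightarrow> finite A \<Longrightarrow> L2_set (\<lambda>k. cmod (u k)) A \<le> sqrt (nsq u)"
  unfolding L2_set_def by (simp add: sum_le_nsq)

lemma member_le_nsq: "l2 u \<Longrightarrow> (cmod (u k))\<^sup>2 \<le> nsq u"
  using sum_le_nsq[of u "{k}"] by simp

lemma l2_add:
  assumes "l2 u" "l2 v" shows "l2 (\<lambda>k. u k + v k)" and "nsq (\<lambda>k. u k + v k) \<le> 2 * nsq u + 2 * nsq v"
proof -
  have ineq: "(cmod (a + b))\<^sup>2 \<le> 2 * (cmod a)\<^sup>2 + 2 * (cmod b)\<^sup>2" for a b :: complex
  proof -
    have "(cmod (a + b))\<^sup>2 \<le> (cmod a + cmod b)\<^sup>2"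
      by (intro power_mono norm_triangle_ineq) auto
    also have "\<dots> \<le> 2 * (cmod a)\<^sup>2 + 2 * (cmod b)\<^sup>2"
      using sum_squares_bound[of "cmod a" "cmod b"] by (simp add: power2_sum)
    finally show ?thesis .
  qed
  have fin: "(\<Sum>k\<in>A. (cmod (u k + v k))\<^sup>2) \<le> 2 * nsq u + 2 * nsq v" if "finite A" for A
  proof -
    have "(\<Sum>k\<in>A. (cmod (u k + v k))\<^sup>2) \<le> (\<Sum>k\<in>A. 2 * (cmod (u k))\<^sup>2 + 2 * (cmod (v k))\<^sup>2)"
      by (intro sum_mono ineq)
    also have "\<dots> = 2 * (\<Sum>k\<in>A. (cmod (u k))\<^sup>2) + 2 * (\<Sum>k\<in>A. (cmod (v k))\<^sup>2)"
      by (simp add: sum.distrib sum_distrib_left)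
    also have "\<dots> \<le> 2 * nsq u + 2 * nsq v"
      using sum_le_nsq[OF assms(1) that] sum_le_nsq[OF assms(2) that] by simp
    finally show ?thesis .
  qed
  show "l2 (\<lambda>k. u k + v k)" "nsq (\<lambda>k. u k + v k) \<le> 2 * nsq u + 2 * nsq v"
    by (rule l2_boundedI[OF fin]; assumption)+
qed

lemma l2_scale: "l2 u \<Longrightarrow> l2 (\<lambda>k. a * u k)"
  by (simp add: l2_def norm_mult power_mult_distrib summable_on_cmult_right)

lemma nsq_scale: "nsq (\<lambda>k. a * u k) = (cmod a)\<^sup>2 * nsq u"
  by (simp add: nsq_def norm_mult power_mult_distrib infsum_cmult_right')

lemma l2_diff: "l2 u \<Longrightarrow> l2 v \<Longrightarrow> l2 (\<lambda>k. u k - v k)"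
  using l2_add(1)[of u "\<lambda>k. - 1 * v k"] l2_scale[of v "- 1"] by simp

lemma dot_abs_summable:
  assumes "l2 u" "l2 v" shows "(\<lambda>k. cmod (u k * v k)) summable_on UNIV"
proof (rule summable_on_comparison_test)
  show "(\<lambda>k. (cmod (u k))\<^sup>2 + (cmod (v k))\<^sup>2) summable_on UNIV"
    using assms unfolding l2_def by (rule summable_on_add)
next
  fix k
  have "2 * (cmod (u k) * cmod (v k)) \<le> (cmod (u k))\<^sup>2 + (cmod (v k))\<^sup>2"
    using sum_squares_bound[of "cmod (u k)" "cmod (v k)"] by simp
  then show "cmod (u k * v k) \<le> (cmod (u k))\<^sup>2 + (cmod (v k))\<^sup>2"
    using mult_nonneg_nonneg[OF norm_ge_zero[of "u k"] norm_ge_zero[of "v k"]] unfolding norm_mult by linarith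
qed auto

lemma dot_summable: "l2 u \<Longrightarrow> l2 v \<Longrightarrow> (\<lambda>k. u k * v k) summable_on UNIV"
  by (rule abs_summable_summable) (rule dot_abs_summable)

lemma has_sum_finite_sum:
  fixes f :: "'b \<Rightarrow> 'a \<Rightarrow> complex"
  assumes "finite K" "\<And>k. k \<in> K \<Longrightarrow> (f k has_sum s k) A"
  shows "((\<lambda>n. \<Sum>k\<in>K. f k n) has_sum (\<Sum>k\<in>K. s k)) A"
  using assms by (induction K rule: finite_induct) (auto intro!: has_sum_add)

lemma dot_le:
  assumes "l2 u" "l2 v" shows "cmod (dot u v) \<le> sqrt (nsq u) * sqrt (nsq v)"
proof -
  have "cmod (dot u v) \<le> (\<Sum>\<^sub>\<infinity>k. cmod (u k * v k))"
    unfolding dot_def by (intro norm_infsum_bound dot_abs_summable assms)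
  also have "\<dots> \<le> sqrt (nsq u) * sqrt (nsq v)"
  proof (rule infsum_le_finite_sums[OF dot_abs_summable[OF assms]])
    fix A :: "'a set" assume A: "finite A"
    have "(\<Sum>k\<in>A. cmod (u k * v k)) \<le> L2_set (\<lambda>k. cmod (u k)) A * L2_set (\<lambda>k. cmod (v k)) A"
      using L2_set_mult_ineq[of "\<lambda>k. cmod (u k)" "\<lambda>k. cmod (v k)" A] by (simp add: norm_mult)
    also have "\<dots> \<le> sqrt (nsq u) * sqrt (nsq v)"
      using A assms by (intro mult_mono L2_set_le_nsq) auto
    finally show "(\<Sum>k\<in>A. cmod (u k * v k)) \<le> sqrt (nsq u) * sqrt (nsq v)" .
  qed
  finally show ?thesis .
qed

lemma dot_add_right: "l2 u \<Longrightarrow> l2 v \<Longrightarrow> l2 w \<Longrightarrow> dot u (\<lambda>k. v k + w k) = dot u v + dot u w"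
  unfolding dot_def by (simp add: distrib_left infsum_add dot_summable)

lemma dot_diff_right:
  assumes "l2 u" "l2 v" "l2 w" shows "dot u (\<lambda>k. v k - w k) = dot u v - dot u w"
proof -
  have "dot u v = dot u (\<lambda>k. (v k - w k) + w k)" by simp
  also have "\<dots> = dot u (\<lambda>k. v k - w k) + dot u w"
    using assms by (intro dot_add_right l2_diff)
  finally show ?thesis by simp
qed

lemma dot_scale_right: "dot u (\<lambda>k. a * v k) = a * dot u v"
  unfolding dot_def by (subst infsum_cmult_right'[symmetric]) (simp only: mult.left_commute)

lemma dot_add_left: "l2 u \<Longrightarrow> l2 v \<Longrightarrow> l2 w \<Longrightarrow> dot (\<lambda>k. v k + w k) u = dot v u + dot w u"
  by (simp add: dot_commute[of _ u] dot_add_right)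

lemma dot_scale_left: "dot (\<lambda>k. a * v k) u = a * dot v u"
  by (simp add: dot_commute[of _ u] dot_scale_right)

lemma dot_unit: "dot (\<lambda>l. if k = l then 1 else 0) v = v k"
proof -
  have "dot (\<lambda>l. if k = l then 1 else 0) v = (\<Sum>\<^sub>\<infinity>l\<in>{k}. v l)"
    unfolding dot_def by (rule infsum_cong_neutral) auto
  then show ?thesis by simp
qed

lemma dot_cnj_self: "l2 u \<Longrightarrow> dot u (\<lambda>k. cnj (u k)) = of_real (nsq u)"
  unfolding dot_def nsq_def l2_def
  by (auto simp flip: complex_norm_square of_real_power intro!: infsumI has_sum_of_real)

text \<open>Operator norm at most \<open>C\<close>, tested on finite pieces only. No series has to
  converge in order to state it, it passes to \<open>tr\<close> and \<open>cj\<close>, and it has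
  the shape of the finite sections in \<open>cp_norm\<close>.\<close>

definition opbound :: "real \<Rightarrow> ('a \<Rightarrow> 'b \<Rightarrow> complex) \<Rightarrow> bool" where
  "opbound C M \<longleftrightarrow> (\<forall>A K u v. finite A \<longrightarrow> finite K \<longrightarrow>
     cmod (\<Sum>n\<in>A. \<Sum>k\<in>K. u n * M n k * v k) \<le> C * L2_set (\<lambda>n. cmod (u n)) A * L2_set (\<lambda>k. cmod (v k)) K)"

definition mv :: "('a \<Rightarrow> 'b \<Rightarrow> complex) \<Rightarrow> ('b \<Rightarrow> complex) \<Rightarrow> 'a \<Rightarrow> complex" where
  "mv M v = (\<lambda>n. dot (M n) v)"

definition tr :: "('a \<Rightarrow> 'b \<Rightarrow> complex) \<Rightarrow> 'b \<Rightarrow> 'a \<Rightarrow> complex" where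
  "tr M = (\<lambda>k n. M n k)"

definition cj :: "('a \<Rightarrow> 'b \<Rightarrow> complex) \<Rightarrow> 'a \<Rightarrow> 'b \<Rightarrow> complex" where
  "cj M = (\<lambda>n k. cnj (M n k))"

lemma tr_simps [simp]: "tr (tr M) = M" "cj (cj M) = M" "tr (cj M) = cj (tr M)"
  by (simp_all add: tr_def cj_def)

lemma opbound_nonneg: "opbound C M \<Longrightarrow> 0 \<le> C"
  unfolding opbound_def
  by (drule spec[of _ "{undefined}"], drule spec[of _ "{undefined}"], drule spec[of _ "\<lambda>_. 1"],
      drule spec[of _ "\<lambda>_. 1"]) (auto simp: L2_set_def intro: order_trans[OF norm_ge_zero])

lemma opbound_tr: "opbound C M \<Longrightarrow> opbound C (tr M)"
  unfolding opbound_def tr_def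
proof (intro allI impI)
  fix A K u v
  assume H: "\<forall>A K u v. finite A \<longrightarrow> finite K \<longrightarrow>
     cmod (\<Sum>n\<in>A. \<Sum>k\<in>K. u n * M n k * v k) \<le> C * L2_set (\<lambda>n. cmod (u n)) A * L2_set (\<lambda>k. cmod (v k)) K"
    and fin: "finite (A :: 'b set)" "finite (K :: 'a set)"
  have "(\<Sum>n\<in>A. \<Sum>k\<in>K. u n * M k n * v k) = (\<Sum>k\<in>K. \<Sum>n\<in>A. v k * M k n * u n)"
    by (subst sum.swap) (simp add: mult_ac)
  then show "cmod (\<Sum>n\<in>A. \<Sum>k\<in>K. u n * M k n * v k) \<le> C * L2_set (\<lambda>n. cmod (u n)) A * L2_set (\<lambda>k. cmod (v k)) K"
    using H[rule_format, OF fin(2,1), of v u] by (simp add: mult.assoc mult.commute[of "L2_set (\<lambda>n. cmod (u n)) A"])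
qed

lemma opbound_cj: "opbound C M \<Longrightarrow> opbound C (cj M)"
  unfolding opbound_def cj_def
proof (intro allI impI)
  fix A K u v
  assume H: "\<forall>A K u v. finite A \<longrightarrow> finite K \<longrightarrow>
     cmod (\<Sum>n\<in>A. \<Sum>k\<in>K. u n * M n k * v k) \<le> C * L2_set (\<lambda>n. cmod (u n)) A * L2_set (\<lambda>k. cmod (v k)) K"
    and fin: "finite (A :: 'a set)" "finite (K :: 'b set)"
  have "(\<Sum>n\<in>A. \<Sum>k\<in>K. u n * cnj (M n k) * v k) = cnj (\<Sum>n\<in>A. \<Sum>k\<in>K. cnj (u n) * M n k * cnj (v k))"
    by simp
  then show "cmod (\<Sum>n\<in>A. \<Sum>k\<in>K. u n * cnj (M n k) * v k) \<le> C * L2_set (\<lambda>n. cmod (u n)) A * L2_set (\<lambda>k. cmod (v k)) K"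
    using H[rule_format, OF fin, of "\<lambda>n. cnj (u n)" "\<lambda>k. cnj (v k)"] by (simp only: complex_mod_cnj)
qed

lemma opbound_add:
  assumes "opbound C M" "opbound D N" shows "opbound (C + D) (\<lambda>n k. M n k + N n k)"
  unfolding opbound_def
proof (intro allI impI)
  fix A K u v assume fin: "finite (A :: 'a set)" "finite (K :: 'b set)"
  have "(\<Sum>n\<in>A. \<Sum>k\<in>K. u n * (M n k + N n k) * v k)
      = (\<Sum>n\<in>A. \<Sum>k\<in>K. u n * M n k * v k) + (\<Sum>n\<in>A. \<Sum>k\<in>K. u n * N n k * v k)"
    by (simp add: algebra_simps sum.distrib)
  then show "cmod (\<Sum>n\<in>A. \<Sum>k\<in>K. u n * (M n k + N n k) * v k)
      \<le> (C + D) * L2_set (\<lambda>n. cmod (u n)) A * L2_set (\<lambda>k. cmod (v k)) K"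
    using assms[unfolded opbound_def, rule_format, OF fin, of u v] norm_triangle_ineq
    by (smt (verit) distrib_right)
qed

lemma opbound_scale:
  assumes "opbound C M" shows "opbound (cmod a * C) (\<lambda>n k. a * M n k)"
  unfolding opbound_def
proof (intro allI impI)
  fix A K u v assume fin: "finite (A :: 'a set)" "finite (K :: 'b set)"
  have "(\<Sum>n\<in>A. \<Sum>k\<in>K. u n * (a * M n k) * v k) = a * (\<Sum>n\<in>A. \<Sum>k\<in>K. u n * M n k * v k)"
    by (simp add: sum_distrib_left mult_ac)
  then show "cmod (\<Sum>n\<in>A. \<Sum>k\<in>K. u n * (a * M n k) * v k)
      \<le> cmod a * C * L2_set (\<lambda>n. cmod (u n)) A * L2_set (\<lambda>k. cmod (v k)) K"
    using mult_left_mono[OF assms[unfolded opbound_def, rule_format, OF fin, of u v], of "cmod a"]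
    by (simp add: norm_mult mult.assoc)
qed

lemma L2_set_sq: "(L2_set f A)\<^sup>2 = (\<Sum>k\<in>A. (f k)\<^sup>2)"
  by (simp add: L2_set_def sum_nonneg)

text \<open>Testing a finite piece of the row on its own conjugate gives
  \<open>s\<^sup>2 \<le> C * s\<close> for its norm \<open>s\<close>; after division by
  \<open>s\<close> the bound no longer depends on the piece.\<close>

lemma opbound_row:
  assumes "opbound C M" shows "l2 (M n)" "nsq (M n) \<le> C\<^sup>2"
proof -
  have "(\<Sum>k\<in>K. (cmod (M n k))\<^sup>2) \<le> C\<^sup>2" if "finite K" for K
  proof -
    define s where "s = L2_set (\<lambda>k. cmod (M n k)) K"
    have "(\<Sum>k\<in>K. M n k * cnj (M n k)) = of_real (s\<^sup>2)"
      unfolding s_def L2_set_sq by (simp flip: complex_norm_square)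
    then have "s\<^sup>2 \<le> C * s"
      using assms[unfolded opbound_def, rule_format, of "{n}" K "\<lambda>_. 1" "\<lambda>k. cnj (M n k)"] that
      by (simp add: s_def norm_power)
    then have "s \<le> C"
      using opbound_nonneg[OF assms] L2_set_nonneg[of "\<lambda>k. cmod (M n k)" K]
      unfolding power2_eq_square s_def[symmetric] by (cases "s = 0") (auto simp: mult_le_cancel_right)
    then have "s\<^sup>2 \<le> C\<^sup>2" by (intro power_mono) (auto simp: s_def)
    then show ?thesis by (simp add: s_def L2_set_sq)
  qed
  from l2_boundedI[OF this] show "l2 (M n)" "nsq (M n) \<le> C\<^sup>2" by auto
qed

lemma opbound_mv_finite:
  assumes M: "opbound C M" and v: "l2 v" and A: "finite A"
  shows "cmod (\<Sum>n\<in>A. u n * mv M v n) \<le> C * L2_set (\<lambda>n. cmod (u n)) A * sqrt (nsq v)"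
proof (rule tendsto_upperbound)
  have "((\<lambda>K. \<Sum>k\<in>K. M n k * v k) \<longlongrightarrow> mv M v n) (finite_subsets_at_top UNIV)" for n
    unfolding mv_def dot_def by (intro infsum_tendsto dot_summable opbound_row(1)[OF M] v)
  then show "((\<lambda>K. cmod (\<Sum>n\<in>A. u n * (\<Sum>k\<in>K. M n k * v k))) \<longlongrightarrow> cmod (\<Sum>n\<in>A. u n * mv M v n))
      (finite_subsets_at_top UNIV)"
    by (intro tendsto_intros)
  show "\<forall>\<^sub>F K in finite_subsets_at_top UNIV. cmod (\<Sum>n\<in>A. u n * (\<Sum>k\<in>K. M n k * v k))
     \<le> C * L2_set (\<lambda>n. cmod (u n)) A * sqrt (nsq v)"
  proof (rule eventually_finite_subsets_at_top_weakI)
    fix K :: "'b set" assume K: "finite K"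
    have "cmod (\<Sum>n\<in>A. u n * (\<Sum>k\<in>K. M n k * v k)) \<le> C * L2_set (\<lambda>n. cmod (u n)) A * L2_set (\<lambda>k. cmod (v k)) K"
      using M[unfolded opbound_def, rule_format, OF A K, of u v] by (simp add: sum_distrib_left mult.assoc)
    also have "\<dots> \<le> C * L2_set (\<lambda>n. cmod (u n)) A * sqrt (nsq v)"
      using opbound_nonneg[OF M] by (intro mult_left_mono L2_set_le_nsq v K) auto
    finally show "cmod (\<Sum>n\<in>A. u n * (\<Sum>k\<in>K. M n k * v k)) \<le> C * L2_set (\<lambda>n. cmod (u n)) A * sqrt (nsq v)" .
  qed
qed simp

lemma opbound_mv:
  assumes M: "opbound C M" and v: "l2 v"
  shows "l2 (mv M v)" "nsq (mv M v) \<le> C\<^sup>2 * nsq v"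
proof -
  have "(\<Sum>n\<in>A. (cmod (mv M v n))\<^sup>2) \<le> C\<^sup>2 * nsq v" if "finite A" for A
  proof -
    define s where "s = L2_set (\<lambda>n. cmod (mv M v n)) A"
    have "(\<Sum>n\<in>A. cnj (mv M v n) * mv M v n) = of_real (s\<^sup>2)"
      unfolding s_def L2_set_sq by (simp add: mult.commute flip: complex_norm_square)
    then have "s\<^sup>2 \<le> C * s * sqrt (nsq v)"
      using opbound_mv_finite[OF M v that, of "\<lambda>n. cnj (mv M v n)"] by (simp add: s_def norm_power)
    then have "s \<le> C * sqrt (nsq v)"
      using opbound_nonneg[OF M] L2_set_nonneg[of "\<lambda>n. cmod (mv M v n)" A] mult_le_cancel_right[of s s "C * sqrt (nsq v)"]
      unfolding power2_eq_square s_def[symmetric] by (cases "s = 0") (auto simp: mult_ac)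
    then have "s\<^sup>2 \<le> (C * sqrt (nsq v))\<^sup>2" by (intro power_mono) (auto simp: s_def)
    then show ?thesis by (simp add: s_def L2_set_sq power_mult_distrib)
  qed
  from l2_boundedI[OF this] show "l2 (mv M v)" "nsq (mv M v) \<le> C\<^sup>2 * nsq v" by auto
qed

lemma nsq_tail_tendsto:
  assumes "l2 v"
  shows "((\<lambda>K. nsq (\<lambda>k. if k \<in> K then 0 else v k)) \<longlongrightarrow> 0) (finite_subsets_at_top UNIV)"
proof -
  have s: "(\<lambda>k. (cmod (v k))\<^sup>2) summable_on UNIV" using assms by (simp add: l2_def)
  have "nsq (\<lambda>k. if k \<in> K then 0 else v k) = nsq v - (\<Sum>k\<in>K. (cmod (v k))\<^sup>2)" if "finite K" for K
  proof -
    have "nsq v = (\<Sum>\<^sub>\<infinity>k\<in>K \<union> (- K). (cmod (v k))\<^sup>2)" by (simp add: nsq_def)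
    also have "\<dots> = (\<Sum>k\<in>K. (cmod (v k))\<^sup>2) + (\<Sum>\<^sub>\<infinity>k\<in>- K. (cmod (v k))\<^sup>2)"
      using that by (subst infsum_Un_disjoint) (auto intro: summable_on_subset_banach[OF s])
    also have "(\<Sum>\<^sub>\<infinity>k\<in>- K. (cmod (v k))\<^sup>2) = nsq (\<lambda>k. if k \<in> K then 0 else v k)"
      unfolding nsq_def by (rule infsum_cong_neutral) auto
    finally show ?thesis by simp
  qed
  then have ev: "\<forall>\<^sub>F K in finite_subsets_at_top UNIV.
      nsq v - (\<Sum>k\<in>K. (cmod (v k))\<^sup>2) = nsq (\<lambda>k. if k \<in> K then 0 else v k)"
    by (intro eventually_finite_subsets_at_top_weakI) auto
  have "((\<lambda>K. nsq v - (\<Sum>k\<in>K. (cmod (v k))\<^sup>2)) \<longlongrightarrow> nsq v - nsq v) (finite_subsets_at_top UNIV)"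
    unfolding nsq_def by (intro tendsto_intros infsum_tendsto s)
  then show ?thesis using Lim_transform_eventually[OF _ ev] by simp
qed

text \<open>With \<open>v\<close> cut to a finite \<open>K\<close> the two sums commute trivially.
  The remainder is at most \<open>C\<close> times the norms of \<open>u\<close> and of the tail of
  \<open>v\<close>, and the tail tends to 0 by \<open>nsq_tail_tendsto\<close>.\<close>

lemma dot_mv:
  assumes M: "opbound C M" and u: "l2 u" and v: "l2 v"
  shows "dot u (mv M v) = dot (mv (tr M) u) v"
proof (rule tendsto_unique[OF finite_subsets_at_top_neq_bot])
  have Mt: "l2 (mv (tr M) u)" by (rule opbound_mv(1)[OF opbound_tr[OF M] u])
  show "((\<lambda>K. \<Sum>k\<in>K. mv (tr M) u k * v k) \<longlongrightarrow> dot (mv (tr M) u) v) (finite_subsets_at_top UNIV)"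
    unfolding dot_def by (intro infsum_tendsto dot_summable Mt v)
  let ?t = "\<lambda>K k. if k \<in> K then 0 else v k"
  have eq: "(\<Sum>k\<in>K. mv (tr M) u k * v k) = dot u (mv M v) - dot u (mv M (?t K))"
    if K: "finite K" for K
  proof -
    have t: "l2 (?t K)"
      using v unfolding l2_def by (rule summable_on_comparison_test) auto
    have row: "l2 (M n)" for n by (rule opbound_row(1)[OF M])
    have col: "l2 (\<lambda>n. M n k)" for k using opbound_row(1)[OF opbound_tr[OF M]] by (simp add: tr_def)
    have "mv M v n - mv M (?t K) n = (\<Sum>k\<in>K. M n k * v k)" for n
    proof -
      have "mv M v n - mv M (?t K) n = dot (M n) (\<lambda>k. v k - ?t K k)"
        unfolding mv_def by (rule dot_diff_right[symmetric]) (use row v t in auto)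
      also have "\<dots> = (\<Sum>\<^sub>\<infinity>k\<in>K. M n k * v k)"
        unfolding dot_def by (rule infsum_cong_neutral) auto
      finally show ?thesis using K by simp
    qed
    then have "dot u (mv M v) - dot u (mv M (?t K)) = dot u (\<lambda>n. \<Sum>k\<in>K. M n k * v k)"
      by (subst dot_diff_right[symmetric]) (auto intro!: opbound_mv(1)[OF M] u v t)
    also have "\<dots> = (\<Sum>\<^sub>\<infinity>n. \<Sum>k\<in>K. u n * M n k * v k)"
      by (simp add: dot_def sum_distrib_left mult.assoc)
    also have "\<dots> = (\<Sum>k\<in>K. \<Sum>\<^sub>\<infinity>n. u n * M n k * v k)"
      by (intro infsumI has_sum_finite_sum has_sum_infsum K summable_on_cmult_left dot_summable u col)
    also have "\<dots> = (\<Sum>k\<in>K. mv (tr M) u k * v k)"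
      by (simp add: mv_def dot_def tr_def infsum_cmult_left' mult.commute[of "u _"])
    finally show ?thesis by simp
  qed
  have "((\<lambda>K. dot u (mv M (?t K))) \<longlongrightarrow> 0) (finite_subsets_at_top UNIV)"
  proof (rule Lim_null_comparison)
    show "((\<lambda>K. sqrt (nsq u) * (C * sqrt (nsq (?t K)))) \<longlongrightarrow> 0) (finite_subsets_at_top UNIV)"
      using tendsto_mult_right_zero[OF tendsto_mult_right_zero[OF tendsto_real_sqrt[OF nsq_tail_tendsto[OF v], simplified]]] .
    have "cmod (dot u (mv M (?t K))) \<le> sqrt (nsq u) * (C * sqrt (nsq (?t K)))" for K
    proof -
      have t: "l2 (?t K)"
        using v unfolding l2_def by (rule summable_on_comparison_test) auto
      have "cmod (dot u (mv M (?t K))) \<le> sqrt (nsq u) * sqrt (nsq (mv M (?t K)))"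
        by (intro dot_le u opbound_mv(1)[OF M] t)
      also have "\<dots> \<le> sqrt (nsq u) * sqrt (C\<^sup>2 * nsq (?t K))"
        by (intro mult_left_mono real_sqrt_le_mono opbound_mv(2)[OF M] t) auto
      finally show ?thesis using opbound_nonneg[OF M] by (simp add: real_sqrt_mult)
    qed
    then show "\<forall>\<^sub>F K in finite_subsets_at_top UNIV.
      cmod (dot u (mv M (?t K))) \<le> sqrt (nsq u) * (C * sqrt (nsq (?t K)))" by simp
  qed
  then have "((\<lambda>K. dot u (mv M v) - dot u (mv M (?t K))) \<longlongrightarrow> dot u (mv M v) - 0) (finite_subsets_at_top UNIV)"
    by (intro tendsto_intros)
  moreover have "\<forall>\<^sub>F K in finite_subsets_at_top UNIV.
      dot u (mv M v) - dot u (mv M (?t K)) = (\<Sum>k\<in>K. mv (tr M) u k * v k)"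
    by (intro eventually_finite_subsets_at_top_weakI) (simp add: eq)
  ultimately show "((\<lambda>K. \<Sum>k\<in>K. mv (tr M) u k * v k) \<longlongrightarrow> dot u (mv M v)) (finite_subsets_at_top UNIV)"
    using Lim_transform_eventually by fastforce
qed

section \<open>Isometries: left inverse, Pythagoras, Bessel\<close>

definition orthonormal_columns :: "('a \<Rightarrow> 'b \<Rightarrow> complex) \<Rightarrow> bool" where
  "orthonormal_columns B \<longleftrightarrow> (\<forall>k l. dot (\<lambda>n. cnj (B n k)) (\<lambda>n. B n l) = (if k = l then 1 else 0))"

text \<open>The content is the associativity of infinite matrix products: \<open>dot_mv\<close>
  moves \<open>B\<close> onto column \<open>k\<close>, where orthonormality produces a unit
  vector.\<close>

lemma isometry_left_inverse:
  assumes B: "opbound C B" and o: "orthonormal_columns B" and v: "l2 v"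
  shows "mv (cj (tr B)) (mv B v) = v"
proof
  fix k
  have col: "l2 (\<lambda>n. cnj (B n k))" using opbound_row(1)[OF opbound_tr[OF B]] by (simp add: tr_def)
  have "mv (cj (tr B)) (mv B v) k = dot (\<lambda>n. cnj (B n k)) (mv B v)"
    by (simp add: mv_def cj_def tr_def)
  also have "\<dots> = dot (mv (tr B) (\<lambda>n. cnj (B n k))) v"
    by (rule dot_mv[OF B col v])
  also have "mv (tr B) (\<lambda>n. cnj (B n k)) = (\<lambda>l. if k = l then 1 else 0)"
    using o unfolding orthonormal_columns_def mv_def tr_def by (simp add: dot_commute)
  finally show "mv (cj (tr B)) (mv B v) k = v k" by (simp add: dot_unit)
qed

lemma isometry_left_inverse_cnj:
  assumes B: "opbound C B" and o: "orthonormal_columns B" and v: "l2 v"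
  shows "mv (tr B) (mv (cj B) v) = v"
proof -
  have "mv (cj (tr B)) (mv B (\<lambda>k. cnj (v k))) = (\<lambda>k. cnj (v k))"
    by (rule isometry_left_inverse[OF B o]) (use v in simp)
  then have "(\<lambda>k. cnj (mv (cj (tr B)) (mv B (\<lambda>k. cnj (v k))) k)) = v" by simp
  then show ?thesis by (simp add: mv_def cnj_dot cj_def)
qed

lemma isometry_residual:
  assumes B: "opbound C B" and o: "orthonormal_columns B" and u: "l2 u"
  defines "s \<equiv> mv (cj (tr B)) u"
  shows "l2 s" and "l2 (\<lambda>n. u n - mv B s n)" and "nsq (\<lambda>n. u n - mv B s n) + nsq s = nsq u"
proof -
  show s: "l2 s" unfolding s_def by (rule opbound_mv(1)[OF opbound_cj[OF opbound_tr[OF B]] u])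
  have Bs: "l2 (mv B s)" by (rule opbound_mv(1)[OF B s])
  show w: "l2 (\<lambda>n. u n - mv B s n)" by (rule l2_diff[OF u Bs])
  let ?w = "\<lambda>n. u n - mv B s n"
  \<comment> \<open>The adjoint of \<open>B\<close> kills the residual, which is thus orthogonal to
    the range of \<open>B\<close>.\<close>
  have sw: "mv (cj (tr B)) ?w = (\<lambda>k. 0)"
  proof
    fix k
    have col: "l2 (cj (tr B) k)" by (rule opbound_row(1)[OF opbound_cj[OF opbound_tr[OF B]]])
    have "mv (cj (tr B)) ?w k = s k - mv (cj (tr B)) (mv B s) k"
      unfolding s_def mv_def[of "cj (tr B)"] by (rule dot_diff_right) (use col u Bs s_def in \<open>auto simp: mv_def\<close>)
    then show "mv (cj (tr B)) ?w k = 0" by (simp add: isometry_left_inverse[OF B o s])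
  qed
  have orth: "dot (mv B s) (\<lambda>n. cnj (?w n)) = 0"
  proof -
    have "dot (mv B s) (\<lambda>n. cnj (?w n)) = dot (\<lambda>n. cnj (?w n)) (mv B s)" by (rule dot_commute)
    also have "\<dots> = dot (mv (tr B) (\<lambda>n. cnj (?w n))) s" by (rule dot_mv[OF B _ s]) (use w in \<open>simp only: l2_cnj\<close>)
    also have "mv (tr B) (\<lambda>n. cnj (?w n)) = (\<lambda>k. cnj (mv (cj (tr B)) ?w k))"
      by (simp add: mv_def cnj_dot cj_def)
    finally show ?thesis by (simp add: sw dot_def)
  qed
  have nBs: "complex_of_real (nsq (mv B s)) = of_real (nsq s)"
  proof -
    have "of_real (nsq (mv B s)) = dot (\<lambda>n. cnj (mv B s n)) (mv B s)"
      by (simp add: dot_cnj_self[OF Bs] flip: dot_commute[of "mv B s"])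
    also have "\<dots> = dot (mv (tr B) (\<lambda>n. cnj (mv B s n))) s" by (rule dot_mv[OF B _ s]) (use Bs in simp)
    also have "mv (tr B) (\<lambda>n. cnj (mv B s n)) = (\<lambda>k. cnj (mv (cj (tr B)) (mv B s) k))"
      unfolding mv_def[of "tr B"] mv_def[of "cj (tr B)"] by (simp add: cnj_dot cj_def)
    also have "\<dots> = (\<lambda>k. cnj (s k))" by (simp add: isometry_left_inverse[OF B o s])
    finally show ?thesis by (simp add: dot_cnj_self[OF s] flip: dot_commute[of s])
  qed
  have cdec: "(\<lambda>n. cnj (u n)) = (\<lambda>n. cnj (u n - mv B s n) + cnj (mv B s n))" by simp
  have "of_real (nsq u) = dot u (\<lambda>n. cnj (u n))" by (simp add: dot_cnj_self[OF u])
  also have "\<dots> = dot ?w (\<lambda>n. cnj (u n)) + dot (mv B s) (\<lambda>n. cnj (u n))"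
    by (subst dot_add_left[symmetric]) (use w Bs u in auto)
  also have "dot (mv B s) (\<lambda>n. cnj (u n)) = dot (mv B s) (\<lambda>n. cnj (?w n)) + dot (mv B s) (\<lambda>n. cnj (mv B s n))"
    unfolding cdec by (rule dot_add_right) (use w Bs in \<open>simp_all only: l2_cnj\<close>)
  also have "dot ?w (\<lambda>n. cnj (u n)) = dot ?w (\<lambda>n. cnj (?w n)) + dot ?w (\<lambda>n. cnj (mv B s n))"
    unfolding cdec by (rule dot_add_right) (use w Bs in \<open>simp_all only: l2_cnj\<close>)
  also have "dot ?w (\<lambda>n. cnj (mv B s n)) = cnj (dot (mv B s) (\<lambda>n. cnj (?w n)))"
    by (simp add: cnj_dot dot_commute)
  finally have "complex_of_real (nsq u) = of_real (nsq ?w) + of_real (nsq s)"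
    by (simp only: orth dot_cnj_self[OF w] dot_cnj_self[OF Bs] nBs complex_cnj_zero add_0_right add_0_left)
  then show "nsq (\<lambda>n. u n - mv B s n) + nsq s = nsq u"
    by (metis of_real_add of_real_eq_iff)
qed

text \<open>Up to conjugation, \<open>tr B\<close> applied to \<open>u\<close> is the component
  \<open>s\<close> in \<open>isometry_residual\<close> for the conjugate of
  \<open>u\<close>.\<close>

lemma bessel:
  assumes "opbound C B" "orthonormal_columns B" "l2 u"
  shows "l2 (mv (tr B) u)" "nsq (mv (tr B) u) \<le> nsq u"
proof -
  define s where "s = mv (cj (tr B)) (\<lambda>n. cnj (u n))"
  have eq: "mv (tr B) u = (\<lambda>k. cnj (s k))"
    by (simp add: s_def mv_def cnj_dot cj_def)
  have u: "l2 (\<lambda>n. cnj (u n))" using assms(3) by simp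
  note r = isometry_residual[OF assms(1,2) u, folded s_def]
  show "l2 (mv (tr B) u)" using r(1) by (simp add: eq)
  show "nsq (mv (tr B) u) \<le> nsq u"
    using r(3) nsq_nonneg[of "\<lambda>n. cnj (u n) - mv B s n"] by (simp only: eq nsq_cnj)
qed

subsection \<open>Integrals over fundamental domains\<close>

text \<open>Half-open intervals tile the line without overlap: the only \<open>n\<close> that
  contributes is \<open>- \<lfloor>(x - s) / a\<rfloor>\<close>.\<close>

lemma nn_integral_indicator_translates:
  assumes "a > 0"
  shows "(\<integral>\<^sup>+n. indicator {s..<s + a} (x + real_of_int n * a) \<partial>count_space UNIV) = (1 :: ennreal)"
proof -
  have "x + real_of_int n * a \<in> {s..<s + a} \<longleftrightarrow> n = - \<lfloor>(x - s) / a\<rfloor>" for n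
  proof -
    have "x + real_of_int n * a \<in> {s..<s + a} \<longleftrightarrow> - real_of_int n \<le> (x - s) / a \<and> (x - s) / a < - real_of_int n + 1"
      using assms by (auto simp: field_simps)
    also have "\<dots> \<longleftrightarrow> \<lfloor>(x - s) / a\<rfloor> = - n"
      by (simp add: floor_eq_iff)
    finally show ?thesis by auto
  qed
  then have "(\<integral>\<^sup>+n. indicator {s..<s + a} (x + real_of_int n * a) \<partial>count_space UNIV)
      = (\<integral>\<^sup>+n. indicator {- \<lfloor>(x - s) / a\<rfloor>} n \<partial>count_space UNIV :: ennreal)"
    by (intro nn_integral_cong) (simp add: indicator_def)
  then show ?thesis by simp
qed

lemma nn_integral_translate:
  fixes h :: "real \<Rightarrow> ennreal"
  assumes "h \<in> borel_measurable borel"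
  shows "(\<integral>\<^sup>+x. h (x + t) \<partial>lborel) = (\<integral>\<^sup>+x. h x \<partial>lborel)"
  using nn_integral_real_affine[OF assms, of 1 t] by (simp add: add.commute)

text \<open>After Tonelli and a shift by \<open>n * a\<close> the sum over \<open>n\<close> falls on
  the indicator alone, where it is 1.\<close>

lemma nn_integral_unfold_line:
  fixes h :: "real \<Rightarrow> ennreal"
  assumes [measurable]: "h \<in> borel_measurable borel" and a: "a > 0"
  shows "(\<integral>\<^sup>+x\<in>{0..<a}. (\<integral>\<^sup>+n. h (x + real_of_int n * a) \<partial>count_space UNIV) \<partial>lborel) = (\<integral>\<^sup>+x. h x \<partial>lborel)"
proof -
  have "(\<integral>\<^sup>+x\<in>{0..<a}. (\<integral>\<^sup>+n. h (x + real_of_int n * a) \<partial>count_space UNIV) \<partial>lborel)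
      = (\<integral>\<^sup>+x. (\<integral>\<^sup>+n. h (x + real_of_int n * a) * indicator {0..<a} x \<partial>count_space UNIV) \<partial>lborel)"
    by (rule nn_integral_cong) (simp add: nn_integral_multc)
  also have "\<dots> = (\<integral>\<^sup>+n. (\<integral>\<^sup>+x. h (x + real_of_int n * a) * indicator {0..<a} x \<partial>lborel) \<partial>count_space UNIV)"
    by (rule nn_integral_count_space_nn_integral) auto
  also have "\<dots> = (\<integral>\<^sup>+n. (\<integral>\<^sup>+x. h x * indicator {0..<a} (x + real_of_int (- n) * a) \<partial>lborel) \<partial>count_space UNIV)"
  proof (rule nn_integral_cong)
    fix n :: int
    show "(\<integral>\<^sup>+x. h (x + real_of_int n * a) * indicator {0..<a} x \<partial>lborel)
        = (\<integral>\<^sup>+x. h x * indicator {0..<a} (x + real_of_int (- n) * a) \<partial>lborel)"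
      using nn_integral_translate[of "\<lambda>x. h x * indicator {0..<a} (x + real_of_int (- n) * a)" "real_of_int n * a"]
      by simp
  qed
  also have "\<dots> = (\<integral>\<^sup>+n. (\<integral>\<^sup>+x. h x * indicator {0..<a} (x + real_of_int n * a) \<partial>lborel) \<partial>count_space UNIV)"
    by (rule nn_integral_bij_count_space[where g = uminus]) (rule bij_uminus)
  also have "\<dots> = (\<integral>\<^sup>+x. (\<integral>\<^sup>+n. h x * indicator {0..<a} (x + real_of_int n * a) \<partial>count_space UNIV) \<partial>lborel)"
    by (rule nn_integral_count_space_nn_integral[symmetric]) auto
  also have "\<dots> = (\<integral>\<^sup>+x. h x \<partial>lborel)"
    using nn_integral_indicator_translates[OF a, of 0] by (simp add: nn_integral_cmult)
  finally show ?thesis .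
qed

text \<open>\<open>{0..<a}\<close> and \<open>{s..<s + a}\<close> are fundamental domains of the
  same lattice, so \<open>g\<close> restricted to the second can be unfolded over the first.\<close>

lemma nn_integral_periodic:
  fixes g :: "real \<Rightarrow> ennreal"
  assumes [measurable]: "g \<in> borel_measurable borel" and a: "a > 0" and per: "\<And>x. g (x + a) = g x"
  shows "(\<integral>\<^sup>+x\<in>{0..<a}. g (x + s) \<partial>lborel) = (\<integral>\<^sup>+x\<in>{0..<a}. g x \<partial>lborel)"
proof -
  have per_nat: "g (x + real n * a) = g x" for x n
  proof (induction n)
    case (Suc n)
    have "g (x + real (Suc n) * a) = g ((x + real n * a) + a)" by (simp add: algebra_simps)
    then show ?case using Suc per by simp
  qed simp
  have per_int: "g (x + real_of_int n * a) = g x" for x n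
  proof (cases "n \<ge> 0")
    case True then show ?thesis using per_nat[of x "nat n"] by simp
  next
    case False then show ?thesis using per_nat[of "x + real_of_int n * a" "nat (- n)"] by simp
  qed
  have "(\<integral>\<^sup>+x\<in>{0..<a}. g (x + s) \<partial>lborel) = (\<integral>\<^sup>+x. g x * indicator {s..<s + a} x \<partial>lborel)"
    using nn_integral_translate[of "\<lambda>x. g x * indicator {s..<s + a} x" s]
    by (simp add: indicator_def algebra_simps cong: nn_integral_cong)
  also have "\<dots> = (\<integral>\<^sup>+x\<in>{0..<a}. (\<integral>\<^sup>+n. g (x + real_of_int n * a) * indicator {s..<s + a} (x + real_of_int n * a)
      \<partial>count_space UNIV) \<partial>lborel)"
    by (rule nn_integral_unfold_line[symmetric]) (use a in auto)
  also have "\<dots> = (\<integral>\<^sup>+x\<in>{0..<a}. g x \<partial>lborel)"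
    using nn_integral_indicator_translates[OF a, of s] by (simp add: per_int nn_integral_cmult)
  finally show ?thesis .
qed

lemma set_nn_integral_count_space:
  fixes f :: "int \<Rightarrow> 'a \<Rightarrow> ennreal"
  assumes [measurable]: "\<And>n. f n \<in> borel_measurable M" "A \<in> sets M"
  shows "(\<integral>\<^sup>+x\<in>A. (\<integral>\<^sup>+n. f n x \<partial>count_space UNIV) \<partial>M) = (\<integral>\<^sup>+n. (\<integral>\<^sup>+x\<in>A. f n x \<partial>M) \<partial>count_space UNIV)"
proof -
  have "(\<integral>\<^sup>+x\<in>A. (\<integral>\<^sup>+n. f n x \<partial>count_space UNIV) \<partial>M)
      = (\<integral>\<^sup>+x. (\<integral>\<^sup>+n. f n x * indicator A x \<partial>count_space UNIV) \<partial>M)"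
    by (rule nn_integral_cong) (simp add: nn_integral_multc)
  also have "\<dots> = (\<integral>\<^sup>+n. (\<integral>\<^sup>+x\<in>A. f n x \<partial>M) \<partial>count_space UNIV)"
    by (rule nn_integral_count_space_nn_integral) auto
  finally show ?thesis .
qed

text \<open>Half-open sides, so that translates tile; values in \<open>ennreal\<close>, so that sums
  and integrals may be exchanged on measurability alone.\<close>

definition SI :: "real \<Rightarrow> (pt \<Rightarrow> ennreal) \<Rightarrow> ennreal" where
  "SI a g = (\<integral>\<^sup>+x\<in>{0..<a}. (\<integral>\<^sup>+y\<in>{0..<1}. g (x, y) \<partial>lborel) \<partial>lborel)"

lemma SI_mono: "(\<And>m. g m \<le> h m) \<Longrightarrow> SI a g \<le> SI a h"
  unfolding SI_def by (intro nn_integral_mono mult_right_mono) auto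

lemma SI_cong: "(\<And>m. g m = h m) \<Longrightarrow> SI a g = SI a h"
  by (simp add: SI_def)

lemma SI_add:
  assumes "g \<in> borel_measurable borel" "h \<in> borel_measurable borel"
  shows "SI a (\<lambda>m. g m + h m) = SI a g + SI a h"
proof -
  have [measurable]: "g \<in> borel_measurable (borel \<Otimes>\<^sub>M borel)" "h \<in> borel_measurable (borel \<Otimes>\<^sub>M borel)"
    using assms by (simp_all add: borel_prod)
  show ?thesis unfolding SI_def by (simp add: distrib_right nn_integral_add)
qed

lemma SI_cmult:
  assumes "g \<in> borel_measurable borel"
  shows "SI a (\<lambda>m. b * g m) = b * SI a g"
proof -
  have [measurable]: "g \<in> borel_measurable (borel \<Otimes>\<^sub>M borel)"
    using assms by (simp add: borel_prod)
  show ?thesis unfolding SI_def by (simp add: mult.assoc nn_integral_cmult)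
qed

lemma SI_count_space:
  fixes g :: "int \<Rightarrow> pt \<Rightarrow> ennreal"
  assumes "\<And>n. g n \<in> borel_measurable borel"
  shows "SI a (\<lambda>m. \<integral>\<^sup>+n. g n m \<partial>count_space UNIV) = (\<integral>\<^sup>+n. SI a (g n) \<partial>count_space UNIV)"
proof -
  have [measurable]: "g n \<in> borel_measurable (borel \<Otimes>\<^sub>M borel)" for n
    using assms by (simp add: borel_prod)
  have "(\<integral>\<^sup>+y\<in>{0..<1}. (\<integral>\<^sup>+n. g n (x, y) \<partial>count_space UNIV) \<partial>lborel)
      = (\<integral>\<^sup>+n. (\<integral>\<^sup>+y\<in>{0..<1}. g n (x, y) \<partial>lborel) \<partial>count_space UNIV)" for x
    by (rule set_nn_integral_count_space) auto
  then show ?thesis unfolding SI_def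
    by (simp only:) (rule set_nn_integral_count_space; measurable)
qed

text \<open>Each step \<open>a\<close> in \<open>x\<close> carries a shift \<open>s\<close> in
  \<open>y\<close>. Integrating over \<open>y\<close> first removes that shift by periodicity,
  whatever \<open>s\<close> is, and the line is then unfolded. The steps of interest are
  \<open>(1, 0)\<close> and \<open>(2 * \<mu>, 2 * \<nu>)\<close>.\<close>

lemma SI_unfold:
  assumes g: "g \<in> borel_measurable borel" and per: "\<And>x y. g (x, y + 1) = g (x, y)" and a: "a > 0"
  shows "SI a (\<lambda>(x, y). \<integral>\<^sup>+n. g (x + real_of_int n * a, y + real_of_int n * s) \<partial>count_space UNIV)
    = (\<integral>\<^sup>+x. (\<integral>\<^sup>+y\<in>{0..<1}. g (x, y) \<partial>lborel) \<partial>lborel)"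
proof -
  have [measurable]: "g \<in> borel_measurable (borel \<Otimes>\<^sub>M borel)"
    using g by (simp add: borel_prod)
  have 1: "(\<integral>\<^sup>+y\<in>{0..<1}. g (x, y + t) \<partial>lborel) = (\<integral>\<^sup>+y\<in>{0..<1}. g (x, y) \<partial>lborel)" for x t
    by (rule nn_integral_periodic) (auto simp: per)
  have "SI a (\<lambda>(x, y). \<integral>\<^sup>+n. g (x + real_of_int n * a, y + real_of_int n * s) \<partial>count_space UNIV)
      = (\<integral>\<^sup>+x\<in>{0..<a}. (\<integral>\<^sup>+n. (\<integral>\<^sup>+y\<in>{0..<1}. g (x + real_of_int n * a, y + real_of_int n * s) \<partial>lborel)
          \<partial>count_space UNIV) \<partial>lborel)"
    unfolding SI_def case_prod_conv
    by (subst set_nn_integral_count_space) auto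
  also have "\<dots> = (\<integral>\<^sup>+x\<in>{0..<a}. (\<integral>\<^sup>+n. (\<integral>\<^sup>+y\<in>{0..<1}. g (x + real_of_int n * a, y) \<partial>lborel)
          \<partial>count_space UNIV) \<partial>lborel)"
    by (simp only: 1)
  also have "\<dots> = (\<integral>\<^sup>+x. (\<integral>\<^sup>+y\<in>{0..<1}. g (x, y) \<partial>lborel) \<partial>lborel)"
    by (rule nn_integral_unfold_line) (use a in auto)
  finally show ?thesis .
qed

text \<open>Here \<open>t\<close> need not be a multiple of \<open>a\<close>. Once \<open>y\<close>
  is integrated out, invariance under the combined step \<open>(a, s)\<close> becomes plain
  \<open>a\<close>-periodicity in \<open>x\<close>, and an integral over a full period does not see
  \<open>t\<close>.\<close>

lemma SI_shift:
  assumes g: "g \<in> borel_measurable borel" and per: "\<And>x y. g (x, y + 1) = g (x, y)" and a: "a > 0"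
    and inv: "\<And>x y. g (x + a, y + s) = g (x, y)"
  shows "SI a (\<lambda>(x, y). g (x + t, y)) = SI a g"
proof -
  have [measurable]: "g \<in> borel_measurable (borel \<Otimes>\<^sub>M borel)"
    using g by (simp add: borel_prod)
  have 1: "(\<integral>\<^sup>+y\<in>{0..<1}. g (x + a, y) \<partial>lborel) = (\<integral>\<^sup>+y\<in>{0..<1}. g (x, y) \<partial>lborel)" for x
  proof -
    have "(\<integral>\<^sup>+y\<in>{0..<1}. g (x + a, y + s) \<partial>lborel) = (\<integral>\<^sup>+y\<in>{0..<1}. g (x + a, y) \<partial>lborel)"
      by (rule nn_integral_periodic) (auto simp: per)
    then show ?thesis by (simp add: inv)
  qed
  show ?thesis
    unfolding SI_def case_prod_conv by (rule nn_integral_periodic) (use a 1 in auto)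
qed

lemma integral_SI:
  fixes u :: "pt \<Rightarrow> real"
  assumes u: "u \<in> borel_measurable borel" and nn: "\<And>m. 0 \<le> u m" and bd: "\<And>m. u m \<le> C"
  shows "u integrable_on cbox (0, 0) (a, 1)"
    and "ennreal (integral (cbox (0, 0) (a, 1)) u) = SI a (\<lambda>m. ennreal (u m))"
proof -
  let ?B = "cbox (0, 0) (a, 1 :: real) :: pt set"
  have [measurable]: "u \<in> borel_measurable (borel \<Otimes>\<^sub>M borel)" "u \<in> borel_measurable borel"
    using u by (simp_all add: borel_prod)
  have "set_integrable lborel ?B u"
    unfolding set_integrable_def
  proof (rule integrableI_bounded_set[where A = ?B and B = C])
    show "emeasure lborel ?B < \<infinity>" by (rule emeasure_lborel_cbox_finite)
  qed (use nn bd in \<open>auto simp: indicator_def\<close>)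
  then show int: "u integrable_on ?B"
    by (rule set_borel_integral_eq_integral(1))
  have "((\<lambda>m. indicator ?B m * u m) has_integral integral ?B u) UNIV"
  proof -
    have "(\<lambda>m. indicator ?B m * u m) = (\<lambda>m. if m \<in> ?B then u m else 0)"
      by (auto simp: indicator_def)
    then show ?thesis
      using integrable_integral[OF int] by (simp only: has_integral_restrict_UNIV)
  qed
  then have "ennreal (integral ?B u) = (\<integral>\<^sup>+m. ennreal (indicator ?B m * u m) \<partial>lborel)"
    by (intro nn_integral_has_integral_lborel[symmetric]) (auto intro!: mult_nonneg_nonneg nn)
  also have "\<dots> = (\<integral>\<^sup>+m. ennreal (indicator ?B m * u m) \<partial>(lborel \<Otimes>\<^sub>M lborel))"
    by (simp add: lborel_prod)
  also have "\<dots> = (\<integral>\<^sup>+x. (\<integral>\<^sup>+y. ennreal (indicator ?B (x, y) * u (x, y)) \<partial>lborel) \<partial>lborel)"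
    by (rule lborel.nn_integral_fst[symmetric]) (unfold lborel_prod, measurable)
  also have "\<dots> = (\<integral>\<^sup>+x. (\<integral>\<^sup>+y. ennreal (u (x, y)) * indicator {0..<1} y * indicator {0..<a} x \<partial>lborel) \<partial>lborel)"
  proof (rule nn_integral_cong_AE)
    \<comment> \<open>The closed box and the half-open one differ only on the sides
      \<open>x = a\<close> and \<open>y = 1\<close>, which are null sets.\<close>
    have "AE x in lborel. x \<noteq> a" by (rule AE_lborel_singleton)
    then show "AE x in lborel. (\<integral>\<^sup>+y. ennreal (indicator ?B (x, y) * u (x, y)) \<partial>lborel)
        = (\<integral>\<^sup>+y. ennreal (u (x, y)) * indicator {0..<1} y * indicator {0..<a} x \<partial>lborel)"
    proof eventually_elim
      case (elim x)
      show ?case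
      proof (rule nn_integral_cong_AE)
        have "AE y in lborel. y \<noteq> (1 :: real)" by (rule AE_lborel_singleton)
        then show "AE y in lborel. ennreal (indicator ?B (x, y) * u (x, y))
            = ennreal (u (x, y)) * indicator {0..<1} y * indicator {0..<a} x"
          by eventually_elim (use elim in \<open>auto simp: indicator_def cbox_Pair_eq\<close>)
      qed
    qed
  qed
  also have "\<dots> = SI a (\<lambda>m. ennreal (u m))"
    unfolding SI_def by (simp add: nn_integral_multc)
  finally show "ennreal (integral ?B u) = SI a (\<lambda>m. ennreal (u m))" .
qed

lemma nn_integral_count_space_infsum:
  assumes "f summable_on UNIV" and "\<And>k. 0 \<le> f k"
  shows "(\<integral>\<^sup>+k. ennreal (f k) \<partial>count_space UNIV) = ennreal (\<Sum>\<^sub>\<infinity>k. f k)"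
proof -
  have "(\<lambda>k. norm (f k)) summable_on UNIV" using assms by simp
  then have "Infinite_Set_Sum.abs_summable_on f UNIV" by (simp only: abs_summable_equivalent)
  then show ?thesis
    using assms by (simp add: nn_integral_conv_infsetsum infsetsum_infsum)
qed

lemma nn_integral_count_space_nsq: "l2 u \<Longrightarrow> (\<integral>\<^sup>+k. ennreal ((cmod (u k))\<^sup>2) \<partial>count_space UNIV) = ennreal (nsq u)"
  unfolding l2_def nsq_def by (rule nn_integral_count_space_infsum) auto

text \<open>\<open>infsum\<close> is a limit along the net of finite sets, while measurability
  passes only to limits of sequences. The intervals \<open>{- N..N}\<close> eventually contain every
  finite set, so their sums have the same limit.\<close>

lemma borel_measurable_infsum:
  fixes f :: "int \<Rightarrow> 'a \<Rightarrow> complex"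
  assumes meas: "\<And>k. f k \<in> borel_measurable M" and summ: "\<And>m. m \<in> space M \<Longrightarrow> (\<lambda>k. f k m) summable_on UNIV"
  shows "(\<lambda>m. \<Sum>\<^sub>\<infinity>k. f k m) \<in> borel_measurable M"
proof (rule borel_measurable_LIMSEQ_metric)
  fix N :: nat
  show "(\<lambda>m. \<Sum>k\<in>{- int N..int N}. f k m) \<in> borel_measurable M"
    using meas by measurable
next
  fix m assume m: "m \<in> space M"
  have "filterlim (\<lambda>N. {- int N..int N}) (finite_subsets_at_top UNIV) sequentially"
    unfolding filterlim_finite_subsets_at_top
  proof (intro allI impI)
    fix X :: "int set" assume X: "finite X \<and> X \<subseteq> UNIV"
    obtain N where N: "\<And>x. x \<in> X \<Longrightarrow> nat \<bar>x\<bar> \<le> N"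
      using finite_nat_set_iff_bounded_le[of "(\<lambda>x. nat \<bar>x\<bar>) ` X"] X by auto
    have "X \<subseteq> {- int n..int n}" if "N \<le> n" for n
      using N that by force
    then show "\<forall>\<^sub>F n in sequentially. finite {- int n..int n} \<and> X \<subseteq> {- int n..int n} \<and> {- int n..int n} \<subseteq> UNIV"
      by (auto simp: eventually_sequentially)
  qed
  then show "(\<lambda>N. \<Sum>k\<in>{- int N..int N}. f k m) \<longlonglongrightarrow> (\<Sum>\<^sub>\<infinity>k. f k m)"
    using filterlim_compose[OF infsum_tendsto[OF summ[OF m]]] by blast
qed

subsection \<open>The matrices of a function on \<open>M\<close>\<close>

lemma echar_add: "echar (s + t) = echar s * echar t"
  by (simp add: echar_def distrib_left exp_add)

lemma cnj_echar: "cnj (echar t) = echar (- t)"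
  by (simp add: echar_def exp_cnj)

lemma cmod_echar [simp]: "cmod (echar t) = 1"
  by (simp add: echar_def norm_exp_eq_Re)

lemma echar_0 [simp]: "echar 0 = 1"
  by (simp add: echar_def)

lemma echar_of_int [simp]: "echar (of_int n) = 1"
  unfolding echar_def using exp_integer_2pi[of "of_int n"] by (simp add: mult_ac)

lemma echar_add_of_int: "echar (t + of_int n) = echar t"
  by (simp add: echar_add)

lemma echar_mult: "echar s * echar t = echar (s + t)"
  by (simp add: echar_add)

text \<open>
  Up to the ordering of the indices, the matrix of \<open>f\<close> at \<open>m\<close> turns \<^const>\<open>ip_D\<close> into \<open>A B\<^sup>*\<close> and \<^const>\<open>ip_E\<close>
  into \<open>A\<^sup>* B\<close>: the phase of \<^const>\<open>ip_D\<close> splits because \<open>(n - j) (y + (n + j) \<nu>) = n (y + n \<nu>) - j (y + j \<nu>)\<close>.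
\<close>

definition fmat :: "int \<Rightarrow> real \<Rightarrow> real \<Rightarrow> mfun \<Rightarrow> pt \<Rightarrow> int \<Rightarrow> int \<Rightarrow> complex" where
  "fmat c \<mu> \<nu> f = (\<lambda>(x, y) n k. echar (- (of_int (c * k * n) * (y + of_int n * \<nu>))) *
     f (x + 2 * of_int n * \<mu> + of_int k, y + 2 * of_int n * \<nu>))"

lemma fmat_00 [simp]: "fmat c \<mu> \<nu> f m 0 0 = f m"
  by (cases m) (simp add: fmat_def)

lemma fmat_0 [simp]: "fmat c \<mu> \<nu> f (x, y) 0 k = f (x + of_int k, y)"
  by (simp add: fmat_def)

lemma cmod_fmat: "cmod (fmat c \<mu> \<nu> f (x, y) n k) = cmod (f (x + 2 * of_int n * \<mu> + of_int k, y + 2 * of_int n * \<nu>))"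
  by (simp add: fmat_def norm_mult)

lemma fmat_lincomb: "fmat c \<mu> \<nu> (\<lambda>m. a * f m + b * g m) m n k = a * fmat c \<mu> \<nu> f m n k + b * fmat c \<mu> \<nu> g m n k"
  by (cases m) (simp add: fmat_def algebra_simps)

lemma fmat_diff: "fmat c \<mu> \<nu> (\<lambda>m. f m - g m) m n k = fmat c \<mu> \<nu> f m n k - fmat c \<mu> \<nu> g m n k"
  by (cases m) (simp add: fmat_def algebra_simps)

text \<open>A translation of the base point relabels rows by \<open>j\<close> and columns by
  \<open>l\<close>, up to one phase that depends on the row only and one that depends on the column
  only. All later covariance rests on this separation.\<close>

lemma fmat_shift:
  "fmat c \<mu> \<nu> f (x + 2 * of_int j * \<mu> + of_int l, y + 2 * of_int j * \<nu>) n k =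
     echar (of_int (c * l * n) * (y + 2 * of_int j * \<nu> + of_int n * \<nu>)) *
     echar (of_int (c * (k + l) * j) * (y + of_int j * \<nu>)) * fmat c \<mu> \<nu> f (x, y) (n + j) (k + l)"
proof -
  have "- (of_int (c * k * n) * (y + 2 * of_int j * \<nu> + of_int n * \<nu>)) =
      of_int (c * l * n) * (y + 2 * of_int j * \<nu> + of_int n * \<nu>) + of_int (c * (k + l) * j) * (y + of_int j * \<nu>)
      - of_int (c * (k + l) * (n + j)) * (y + of_int (n + j) * \<nu>)"
    by (simp add: algebra_simps)
  then show ?thesis
    unfolding fmat_def case_prod_conv mult.assoc[symmetric] echar_mult
    by (simp add: algebra_simps)
qed

lemma fmat_period:
  assumes "\<And>x y. f (x, y + 1) = f (x, y)"
  shows "fmat c \<mu> \<nu> f (x, y + 1) n k = fmat c \<mu> \<nu> f (x, y) n k"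
proof -
  have "echar (- (of_int (c * k * n) * (y + 1 + of_int n * \<nu>)))
      = echar (- (of_int (c * k * n) * (y + of_int n * \<nu>)) + of_int (- (c * k * n)))"
    by (rule arg_cong[of _ _ echar]) (simp add: algebra_simps)
  also have "\<dots> = echar (- (of_int (c * k * n) * (y + of_int n * \<nu>)))"
    by (rule echar_add_of_int)
  finally show ?thesis
    using assms[of "x + 2 * of_int n * \<mu> + of_int k" "y + 2 * of_int n * \<nu>"]
    by (simp add: fmat_def algebra_simps)
qed

text \<open>The left side is the entry \<open>(n, j)\<close> in the regular representation at
  \<open>m\<close> that defines \<open>cp_norm\<close>. Norm bounds on the inner product thus bound
  the Gram matrix of the rows.\<close>

lemma ip_D_fmat:
  "ip_D c \<mu> \<nu> f g (lam \<mu> \<nu> n m) (n - j) = dot (fmat c \<mu> \<nu> f m n) (\<lambda>k. cnj (fmat c \<mu> \<nu> g m j k))"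
proof -
  obtain x y where m: "m = (x, y)" by (cases m)
  show ?thesis
    unfolding m lam_def ip_D_def dot_def case_prod_conv fmat_def
  proof (rule infsum_cong)
    fix k :: int
    have phase: "- (of_int (c * k * (n - j)) * (y + 2 * of_int n * \<nu> - of_int (n - j) * \<nu>)) =
        - (of_int (c * k * n) * (y + of_int n * \<nu>)) + of_int (c * k * j) * (y + of_int j * \<nu>)"
      by (simp add: algebra_simps)
    have arg: "x + 2 * of_int n * \<mu> - 2 * of_int (n - j) * \<mu> = x + 2 * of_int j * \<mu>"
      "y + 2 * of_int n * \<nu> - 2 * of_int (n - j) * \<nu> = y + 2 * of_int j * \<nu>"
      by (simp_all add: algebra_simps)
    show "cnj (echar (of_int (c * k * (n - j)) * (y + 2 * of_int n * \<nu> - of_int (n - j) * \<nu>))) *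
        f (x + 2 * of_int n * \<mu> + of_int k, y + 2 * of_int n * \<nu>) *
        cnj (g (x + 2 * of_int n * \<mu> - 2 * of_int (n - j) * \<mu> + of_int k, y + 2 * of_int n * \<nu> - 2 * of_int (n - j) * \<nu>)) =
      echar (- (of_int (c * k * n) * (y + of_int n * \<nu>))) * f (x + 2 * of_int n * \<mu> + of_int k, y + 2 * of_int n * \<nu>) *
        cnj (echar (- (of_int (c * k * j) * (y + of_int j * \<nu>))) * g (x + 2 * of_int j * \<mu> + of_int k, y + 2 * of_int j * \<nu>))"
      unfolding arg cnj_echar phase echar_add complex_cnj_mult by (simp add: mult_ac)
  qed
qed

lemma ip_D_fmat_row: "ip_D c \<mu> \<nu> f g m (- n) = dot (fmat c \<mu> \<nu> f m 0) (\<lambda>k. cnj (fmat c \<mu> \<nu> g m n k))"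
  using ip_D_fmat[of c \<mu> \<nu> f g 0 m n] by (simp add: lam_def case_prod_unfold)

lemma ip_D_fmat_0: "ip_D c \<mu> \<nu> f g m 0 = dot (fmat c \<mu> \<nu> f m 0) (\<lambda>k. cnj (fmat c \<mu> \<nu> g m 0 k))"
  using ip_D_fmat_row[of c \<mu> \<nu> f g m 0] by simp

lemma ip_D_hermitian: "ip_D c \<mu> \<nu> f g (lam \<mu> \<nu> (- q) m) (- q) = cnj (ip_D c \<mu> \<nu> g f m q)"
  using ip_D_fmat[of c \<mu> \<nu> f g "- q" m 0] ip_D_fmat_row[of c \<mu> \<nu> g f m "- q"]
  by (simp add: cnj_dot dot_commute)

text \<open>In operator notation, \<^term>\<open>amat c \<mu> \<nu> f g\<close> is \<open>F\<^sup>* G\<close>.\<close>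

definition amat :: "int \<Rightarrow> real \<Rightarrow> real \<Rightarrow> mfun \<Rightarrow> mfun \<Rightarrow> pt \<Rightarrow> int \<Rightarrow> int \<Rightarrow> complex" where
  "amat c \<mu> \<nu> f g m q p = dot (\<lambda>n. cnj (fmat c \<mu> \<nu> f m n q)) (\<lambda>n. fmat c \<mu> \<nu> g m n p)"

lemma ip_E_amat: "ip_E c \<mu> \<nu> f g m p = amat c \<mu> \<nu> f g m 0 p"
proof -
  obtain x y where m: "m = (x, y)" by (cases m)
  have "amat c \<mu> \<nu> f g m 0 p = (\<Sum>\<^sub>\<infinity>n. cnj (fmat c \<mu> \<nu> f m (- n) 0) * fmat c \<mu> \<nu> g m (- n) p)"
    unfolding amat_def dot_def by (rule infsum_reindex_bij_betw[OF bij_uminus, symmetric])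
  also have "\<dots> = ip_E c \<mu> \<nu> f g m p"
    unfolding m ip_E_def case_prod_conv fmat_def
    by (rule infsum_cong) (simp add: algebra_simps)
  finally show ?thesis by simp
qed

lemma cnj_amat: "cnj (amat c \<mu> \<nu> f g m q p) = amat c \<mu> \<nu> g f m p q"
  by (simp add: amat_def cnj_dot dot_commute)

text \<open>The row phases of \<open>fmat_shift\<close> depend on the summation index but meet their
  own conjugates and cancel; the column phases come out in front.\<close>

lemma amat_shift:
  "amat c \<mu> \<nu> f g (x + 2 * of_int j * \<mu> + of_int l, y + 2 * of_int j * \<nu>) q p =
     cnj (echar (of_int (c * (q + l) * j) * (y + of_int j * \<nu>))) *
     echar (of_int (c * (p + l) * j) * (y + of_int j * \<nu>)) * amat c \<mu> \<nu> f g (x, y) (q + l) (p + l)"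
proof -
  define \<beta> where "\<beta> k = echar (of_int (c * (k + l) * j) * (y + of_int j * \<nu>))" for k
  let ?t = "\<lambda>n. cnj (fmat c \<mu> \<nu> f (x, y) n (q + l)) * fmat c \<mu> \<nu> g (x, y) n (p + l)"
  have unit: "cnj (echar t) * echar t = 1" for t
    by (simp add: cnj_echar echar_mult)
  have "amat c \<mu> \<nu> f g (x + 2 * of_int j * \<mu> + of_int l, y + 2 * of_int j * \<nu>) q p
      = (\<Sum>\<^sub>\<infinity>n. cnj (\<beta> q) * \<beta> p * ?t (n + j))"
    unfolding amat_def dot_def fmat_shift \<beta>_def[symmetric] complex_cnj_mult
  proof (rule infsum_cong)
    fix n
    let ?e = "echar (of_int (c * l * n) * (y + 2 * of_int j * \<nu> + of_int n * \<nu>))"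
    have "cnj ?e * cnj B * cnj F * (?e * B' * G) = (cnj ?e * ?e) * (cnj B * B' * (cnj F * G))" for B B' F G
      by (simp add: mult_ac)
    then show "cnj ?e * cnj (\<beta> q) * cnj (fmat c \<mu> \<nu> f (x, y) (n + j) (q + l)) *
        (?e * \<beta> p * fmat c \<mu> \<nu> g (x, y) (n + j) (p + l)) =
      cnj (\<beta> q) * \<beta> p * ?t (n + j)"
      by (simp only: unit mult_1_left)
  qed
  also have "\<dots> = cnj (\<beta> q) * \<beta> p * (\<Sum>\<^sub>\<infinity>n. ?t (n + j))"
    by (rule infsum_cmult_right')
  also have "(\<Sum>\<^sub>\<infinity>n. ?t (n + j)) = (\<Sum>\<^sub>\<infinity>n. ?t n)"
    by (rule infsum_reindex_bij_betw) (rule bij_betw_byWitness[of _ "\<lambda>n. n - j"]; auto)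
  finally show ?thesis by (simp add: amat_def dot_def \<beta>_def)
qed

lemma cmod_amat_shift:
  "cmod (amat c \<mu> \<nu> f g (x + 2 * of_int j * \<mu> + of_int l, y + 2 * of_int j * \<nu>) q p) =
     cmod (amat c \<mu> \<nu> f g (x, y) (q + l) (p + l))"
  unfolding amat_shift by (simp add: norm_mult)

text \<open>This is what is kept of membership in \<open>Xi\<close>: measurability, periodicity and
  a matrix bound uniform in the base point. The class is stable under complex linear combinations,
  so the functions in polarization identities stay inside it.\<close>

definition admissible :: "int \<Rightarrow> real \<Rightarrow> real \<Rightarrow> mfun \<Rightarrow> bool" where
  "admissible c \<mu> \<nu> f \<longleftrightarrow> f \<in> borel_measurable borel \<and> (\<forall>x y. f (x, y + 1) = f (x, y)) \<and>
     (\<exists>C. \<forall>m. opbound C (fmat c \<mu> \<nu> f m))"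

lemma admissibleD:
  assumes "admissible c \<mu> \<nu> f"
  shows "f \<in> borel_measurable borel" "f (x, y + 1) = f (x, y)"
    "l2 (fmat c \<mu> \<nu> f m n)" "l2 (\<lambda>n. fmat c \<mu> \<nu> f m n k)"
proof -
  obtain C where C: "opbound C (fmat c \<mu> \<nu> f m)" using assms unfolding admissible_def by blast
  show "l2 (fmat c \<mu> \<nu> f m n)" "l2 (\<lambda>n. fmat c \<mu> \<nu> f m n k)"
    using opbound_row(1)[OF C] opbound_row(1)[OF opbound_tr[OF C]] by (auto simp: tr_def)
qed (use assms in \<open>auto simp: admissible_def\<close>)

lemma admissible_opbound:
  assumes "admissible c \<mu> \<nu> f" obtains C where "\<And>m. opbound C (fmat c \<mu> \<nu> f m)"
  using assms by (auto simp: admissible_def)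

lemma admissible_lincomb:
  assumes f: "admissible c \<mu> \<nu> f" and g: "admissible c \<mu> \<nu> g" shows "admissible c \<mu> \<nu> (\<lambda>m. a * f m + b * g m)"
proof -
  obtain C D where "\<And>m. opbound C (fmat c \<mu> \<nu> f m)" "\<And>m. opbound D (fmat c \<mu> \<nu> g m)"
    using admissible_opbound[OF f] admissible_opbound[OF g] by metis
  then have "\<And>m. opbound (cmod a * C + cmod b * D) (fmat c \<mu> \<nu> (\<lambda>m. a * f m + b * g m) m)"
    unfolding fmat_lincomb[abs_def] by (intro opbound_add opbound_scale)
  then show ?thesis
    using admissibleD(1,2)[OF f] admissibleD(1,2)[OF g] unfolding admissible_def by auto
qed

lemma fmat_measurable:
  assumes f: "f \<in> borel_measurable borel" shows "(\<lambda>m. fmat c \<mu> \<nu> f m n k) \<in> borel_measurable borel"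
proof -
  have "(\<lambda>m :: pt. (fst m + 2 * of_int n * \<mu> + of_int k, snd m + 2 * of_int n * \<nu>)) \<in> borel_measurable borel"
    by (intro borel_measurable_continuous_onI continuous_intros)
  then have "(\<lambda>m. f (fst m + 2 * of_int n * \<mu> + of_int k, snd m + 2 * of_int n * \<nu>)) \<in> borel_measurable borel"
    by (rule measurable_compose) (rule f)
  moreover have "(\<lambda>m :: pt. echar (- (of_int (c * k * n) * (snd m + of_int n * \<nu>)))) \<in> borel_measurable borel"
    unfolding echar_def by (intro borel_measurable_continuous_onI continuous_intros)
  ultimately show ?thesis
    unfolding fmat_def case_prod_unfold by (rule borel_measurable_times[rotated])
qed

lemma amat_measurable:
  assumes "admissible c \<mu> \<nu> f" "admissible c \<mu> \<nu> g" shows "(\<lambda>m. amat c \<mu> \<nu> f g m q p) \<in> borel_measurable borel"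
proof -
  have "(\<lambda>m. cnj (fmat c \<mu> \<nu> f m n k)) \<in> borel_measurable borel" for n k
    by (rule measurable_compose[OF fmat_measurable[OF admissibleD(1)[OF assms(1)]]])
       (intro borel_measurable_continuous_onI continuous_intros)
  then show ?thesis
    unfolding amat_def dot_def
    by (intro borel_measurable_infsum borel_measurable_times fmat_measurable admissibleD[OF assms(2)] dot_summable)
       (simp_all add: admissibleD[OF assms(1)])
qed

lemma amat_period:
  assumes "admissible c \<mu> \<nu> f" "admissible c \<mu> \<nu> g"
  shows "amat c \<mu> \<nu> f g (x, y + 1) q p = amat c \<mu> \<nu> f g (x, y) q p"
  unfolding amat_def by (simp add: fmat_period admissibleD(2)[OF assms(1)] admissibleD(2)[OF assms(2)])

text \<open>In operator notation, \<open>(1 - B B\<^sup>*) F\<close> for the matrices \<open>B\<close> of \<open>R\<close> and \<open>F\<close> of \<open>f\<close>.\<close>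

definition wmat :: "int \<Rightarrow> real \<Rightarrow> real \<Rightarrow> mfun \<Rightarrow> mfun \<Rightarrow> pt \<Rightarrow> int \<Rightarrow> int \<Rightarrow> complex" where
  "wmat c \<mu> \<nu> R f m n k = fmat c \<mu> \<nu> f m n k - mv (fmat c \<mu> \<nu> R m) (\<lambda>q. amat c \<mu> \<nu> R f m q k) n"

text \<open>The phases of the inner index \<open>q\<close> cancel between the matrix of
  \<open>R\<close> and \<open>amat\<close>, so the residual is as covariant as the matrix of
  \<open>f\<close> itself.\<close>

lemma cmod_wmat_shift:
  "cmod (wmat c \<mu> \<nu> R f (x + 2 * of_int j * \<mu> + of_int l, y + 2 * of_int j * \<nu>) n k) =
     cmod (wmat c \<mu> \<nu> R f (x, y) (n + j) (k + l))"
proof -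
  let ?m' = "(x + 2 * of_int j * \<mu> + of_int l, y + 2 * of_int j * \<nu>)"
  define \<alpha> where "\<alpha> n = echar (of_int (c * l * n) * (y + 2 * of_int j * \<nu> + of_int n * \<nu>))" for n
  define \<beta> where "\<beta> k = echar (of_int (c * (k + l) * j) * (y + of_int j * \<nu>))" for k
  let ?t = "\<lambda>q. fmat c \<mu> \<nu> R (x, y) (n + j) q * amat c \<mu> \<nu> R f (x, y) q (k + l)"
  have unit: "\<beta> q * cnj (\<beta> q) = 1" for q
    by (simp add: \<beta>_def cnj_echar echar_mult)
  have "mv (fmat c \<mu> \<nu> R ?m') (\<lambda>q. amat c \<mu> \<nu> R f ?m' q k) n
      = (\<Sum>\<^sub>\<infinity>q. \<alpha> n * \<beta> k * ?t (q + l))"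
    unfolding mv_def dot_def fmat_shift amat_shift \<alpha>_def[symmetric] \<beta>_def[symmetric]
  proof (rule infsum_cong)
    fix q
    have "\<alpha> n * \<beta> q * F * (cnj (\<beta> q) * \<beta> k * G) = (\<beta> q * cnj (\<beta> q)) * (\<alpha> n * \<beta> k * (F * G))" for F G
      by (simp add: mult_ac)
    then show "\<alpha> n * \<beta> q * fmat c \<mu> \<nu> R (x, y) (n + j) (q + l) *
         (cnj (\<beta> q) * \<beta> k * amat c \<mu> \<nu> R f (x, y) (q + l) (k + l)) = \<alpha> n * \<beta> k * ?t (q + l)"
      by (simp only: unit mult_1_left)
  qed
  also have "\<dots> = \<alpha> n * \<beta> k * (\<Sum>\<^sub>\<infinity>q. ?t (q + l))"
    by (rule infsum_cmult_right')
  also have "(\<Sum>\<^sub>\<infinity>q. ?t (q + l)) = (\<Sum>\<^sub>\<infinity>q. ?t q)"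
    by (rule infsum_reindex_bij_betw) (rule bij_betw_byWitness[of _ "\<lambda>n. n - l"]; auto)
  finally have "wmat c \<mu> \<nu> R f ?m' n k = \<alpha> n * \<beta> k * wmat c \<mu> \<nu> R f (x, y) (n + j) (k + l)"
    unfolding wmat_def fmat_shift \<alpha>_def[symmetric] \<beta>_def[symmetric]
    by (simp add: mv_def dot_def right_diff_distrib)
  then show ?thesis by (simp add: norm_mult \<alpha>_def \<beta>_def)
qed

subsection \<open>Boundedness of the matrices of elements of \<open>\<Xi>\<close>\<close>

text \<open>Cauchy-Schwarz over the related pairs: each term of \<open>u\<close> and each term of
  \<open>v\<close> is counted at most \<open>q\<close> times, which yields \<open>sqrt q\<close>
  twice.\<close>

lemma opbound_finite_degree:
  fixes M :: "'a \<Rightarrow> 'b \<Rightarrow> complex"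
  assumes B: "\<And>n k. cmod (M n k) \<le> B" and supp: "\<And>n k. M n k \<noteq> 0 \<Longrightarrow> rel n k"
    and q1: "\<And>n K. finite K \<Longrightarrow> card {k \<in> K. rel n k} \<le> q"
    and q2: "\<And>k A. finite A \<Longrightarrow> card {n \<in> A. rel n k} \<le> q"
  shows "opbound (B * real q) M"
  unfolding opbound_def
proof (intro allI impI)
  fix A K u v assume A: "finite (A :: 'a set)" and K: "finite (K :: 'b set)"
  define S where "S = {(n, k) \<in> A \<times> K. rel n k}"
  have S: "S = (SIGMA n:A. {k \<in> K. rel n k})" by (auto simp: S_def)
  have "0 \<le> B" using norm_ge_zero[of "M undefined undefined"] B[of undefined undefined] by linarith
  have l1: "L2_set (\<lambda>p. cmod (u (fst p))) S \<le> sqrt (real q) * L2_set (\<lambda>n. cmod (u n)) A"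
  proof -
    have "(\<Sum>p\<in>S. (cmod (u (fst p)))\<^sup>2) = (\<Sum>n\<in>A. \<Sum>k\<in>{k \<in> K. rel n k}. (cmod (u n))\<^sup>2)"
      unfolding S using A K by (subst sum.Sigma) (auto simp: case_prod_unfold)
    also have "\<dots> = (\<Sum>n\<in>A. real (card {k \<in> K. rel n k}) * (cmod (u n))\<^sup>2)" by simp
    also have "\<dots> \<le> (\<Sum>n\<in>A. real q * (cmod (u n))\<^sup>2)"
      by (intro sum_mono mult_right_mono) (auto intro: q1 K)
    finally show ?thesis
      unfolding L2_set_def by (simp add: sum_distrib_left flip: real_sqrt_mult)
  qed
  have l2: "L2_set (\<lambda>p. cmod (v (snd p))) S \<le> sqrt (real q) * L2_set (\<lambda>n. cmod (v n)) K"
  proof -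
    have "(\<Sum>p\<in>S. (cmod (v (snd p)))\<^sup>2) = (\<Sum>n\<in>A. \<Sum>k\<in>{k \<in> K. rel n k}. (cmod (v k))\<^sup>2)"
      unfolding S using A K by (subst sum.Sigma) (auto simp: case_prod_unfold)
    also have "\<dots> = (\<Sum>n\<in>A. \<Sum>k\<in>K. if rel n k then (cmod (v k))\<^sup>2 else 0)"
      using K by (simp add: sum.inter_filter)
    also have "\<dots> = (\<Sum>k\<in>K. \<Sum>n\<in>A. if rel n k then (cmod (v k))\<^sup>2 else 0)"
      by (rule sum.swap)
    also have "\<dots> = (\<Sum>k\<in>K. real (card {n \<in> A. rel n k}) * (cmod (v k))\<^sup>2)"
      using A by (simp flip: sum.inter_filter)
    also have "\<dots> \<le> (\<Sum>k\<in>K. real q * (cmod (v k))\<^sup>2)"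
      by (intro sum_mono mult_right_mono) (auto intro: q2 A)
    finally show ?thesis
      unfolding L2_set_def by (simp add: sum_distrib_left flip: real_sqrt_mult)
  qed
  have "(\<Sum>n\<in>A. \<Sum>k\<in>K. u n * M n k * v k) = (\<Sum>p\<in>A \<times> K. u (fst p) * M (fst p) (snd p) * v (snd p))"
    by (simp add: sum.cartesian_product case_prod_unfold)
  also have "\<dots> = (\<Sum>p\<in>S. u (fst p) * M (fst p) (snd p) * v (snd p))"
    using A K supp by (intro sum.mono_neutral_right) (auto simp: S_def)
  finally have "cmod (\<Sum>n\<in>A. \<Sum>k\<in>K. u n * M n k * v k) \<le> (\<Sum>p\<in>S. cmod (u (fst p) * M (fst p) (snd p) * v (snd p)))"
    by (simp only: norm_sum)
  also have "\<dots> \<le> (\<Sum>p\<in>S. B * (\<bar>cmod (u (fst p))\<bar> * \<bar>cmod (v (snd p))\<bar>))"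
  proof (rule sum_mono)
    fix p
    show "cmod (u (fst p) * M (fst p) (snd p) * v (snd p)) \<le> B * (\<bar>cmod (u (fst p))\<bar> * \<bar>cmod (v (snd p))\<bar>)"
      using mult_right_mono[OF B, of "cmod (u (fst p)) * cmod (v (snd p))" "fst p" "snd p"]
      by (simp add: norm_mult mult_ac)
  qed
  also have "\<dots> \<le> B * (L2_set (\<lambda>p. cmod (u (fst p))) S * L2_set (\<lambda>p. cmod (v (snd p))) S)"
    unfolding sum_distrib_left[symmetric] using \<open>0 \<le> B\<close> by (intro mult_left_mono L2_set_mult_ineq)
  also have "\<dots> \<le> B * ((sqrt (real q) * L2_set (\<lambda>n. cmod (u n)) A) * (sqrt (real q) * L2_set (\<lambda>k. cmod (v k)) K))"
    using \<open>0 \<le> B\<close> by (intro mult_left_mono mult_mono l1 l2) auto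
  also have "\<dots> = B * (sqrt (real q) * sqrt (real q)) * L2_set (\<lambda>n. cmod (u n)) A * L2_set (\<lambda>k. cmod (v k)) K"
    by (simp only: mult_ac)
  also have "sqrt (real q) * sqrt (real q) = real q" by simp
  finally show "cmod (\<Sum>n\<in>A. \<Sum>k\<in>K. u n * M n k * v k) \<le> B * real q * L2_set (\<lambda>n. cmod (u n)) A * L2_set (\<lambda>k. cmod (v k)) K" .
qed

lemma card_int_progression:
  fixes A :: "int set"
  assumes "finite A" and a: "a > 0" and N: "N \<ge> 0"
  shows "card {n \<in> A. \<bar>t + real_of_int n * a\<bar> \<le> N} \<le> nat \<lceil>2 * N / a\<rceil> + 1"
proof -
  let ?l = "\<lceil>(- N - t) / a\<rceil>" and ?u = "\<lfloor>(N - t) / a\<rfloor>"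
  have "{n \<in> A. \<bar>t + real_of_int n * a\<bar> \<le> N} \<subseteq> {?l..?u}"
    using a by (auto simp: ceiling_le_iff le_floor_iff field_simps abs_le_iff)
  then have "card {n \<in> A. \<bar>t + real_of_int n * a\<bar> \<le> N} \<le> card {?l..?u}"
    by (intro card_mono) auto
  also have "\<dots> = nat (?u - ?l + 1)" by simp
  also have "\<dots> \<le> nat (\<lceil>2 * N / a\<rceil> + 1)"
  proof (rule nat_mono)
    have "real_of_int ?u - real_of_int ?l \<le> (N - t) / a - (- N - t) / a"
      by (intro diff_mono) auto
    also have "\<dots> = 2 * N / a" using a by (simp add: field_simps)
    also have "\<dots> \<le> real_of_int \<lceil>2 * N / a\<rceil>" by simp
    finally show "?u - ?l + 1 \<le> \<lceil>2 * N / a\<rceil> + 1" by linarith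
  qed
  also have "\<dots> \<le> nat \<lceil>2 * N / a\<rceil> + 1" by linarith
  finally show ?thesis .
qed

lemma periodic_of_int:
  assumes per: "\<And>x y. f (x, y + 1) = f (x, y)" shows "f (x, y + real_of_int n) = f (x, y)"
proof -
  have per_nat: "f (x, y + real n) = f (x, y)" for y n
  proof (induction n)
    case (Suc n)
    then show ?case using per[of x "y + real n"] by (simp add: add_ac)
  qed simp
  show ?thesis
  proof (cases "n \<ge> 0")
    case True then show ?thesis using per_nat[of y "nat n"] by simp
  next
    case False then show ?thesis using per_nat[of "y + real_of_int n" "nat (- n)"] by simp
  qed
qed

lemma Cc_M_bounded:
  assumes "f \<in> Cc_M"
  obtains B N where "\<And>m. cmod (f m) \<le> B" and "\<And>x y. f (x, y) \<noteq> 0 \<Longrightarrow> \<bar>x\<bar> \<le> N" and "N \<ge> 0"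
proof -
  have cont: "continuous_on UNIV f" and per: "\<And>x y. f (x, y + 1) = f (x, y)"
    and "\<exists>N. \<forall>x y. \<bar>x\<bar> > N \<longrightarrow> f (x, y) = 0"
    using assms by (simp_all add: Cc_M_def cont_M_def)
  then obtain N where N: "\<And>x y. \<bar>x\<bar> > N \<Longrightarrow> f (x, y) = 0"
    by metis
  have "compact (f ` cbox (- N, 0) (N, 1))"
    by (intro compact_continuous_image continuous_on_subset[OF cont]) auto
  then obtain B where B: "\<And>m. m \<in> cbox (- N, 0) (N, 1) \<Longrightarrow> cmod (f m) \<le> B"
    using compact_imp_bounded[of "f ` cbox (- N, 0) (N, 1)"] unfolding bounded_iff by auto
  have bd: "cmod (f (x, y)) \<le> max B 0" for x y
  proof (cases "\<bar>x\<bar> > N")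
    case True then show ?thesis by (simp add: N)
  next
    case False
    have "f (x, y) = f (x, frac y + real_of_int \<lfloor>y\<rfloor>)" by (simp add: frac_def)
    also have "\<dots> = f (x, frac y)" by (rule periodic_of_int) (rule per)
    finally show ?thesis
      using B[of "(x, frac y)"] False frac_lt_1[of y] by (simp add: cbox_Pair_eq abs_le_iff not_less le_max_iff_disj less_imp_le)
  qed
  show thesis
  proof (rule that)
    show "cmod (f m) \<le> max B 0" for m using bd[of "fst m" "snd m"] by simp
    show "\<bar>x\<bar> \<le> max N 0" if "f (x, y) \<noteq> 0" for x y using N[of x y] that by force
  qed simp
qed

lemma Cc_M_admissible:
  assumes \<mu>: "\<mu> > 0" and f: "f \<in> Cc_M"
  shows "admissible c \<mu> \<nu> f"
proof -
  obtain B N where B: "\<And>m. cmod (f m) \<le> B" and N: "\<And>x y. f (x, y) \<noteq> 0 \<Longrightarrow> \<bar>x\<bar> \<le> N" and "N \<ge> 0"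
    using Cc_M_bounded[OF f] by metis
  \<comment> \<open>The sum dominates both counts at once: columns meeting a row form a progression
    of step 1, rows meeting a column one of step \<open>2 * \<mu>\<close>.\<close>
  define q where "q = (nat \<lceil>2 * N / 1\<rceil> + 1) + (nat \<lceil>2 * N / (2 * \<mu>)\<rceil> + 1)"
  have "opbound (B * real q) (fmat c \<mu> \<nu> f (x, y))" for x y
  proof (rule opbound_finite_degree[where rel = "\<lambda>n k. \<bar>x + 2 * of_int n * \<mu> + of_int k\<bar> \<le> N"])
    show "cmod (fmat c \<mu> \<nu> f (x, y) n k) \<le> B" for n k by (simp add: cmod_fmat B)
    show "\<bar>x + 2 * of_int n * \<mu> + of_int k\<bar> \<le> N" if "fmat c \<mu> \<nu> f (x, y) n k \<noteq> 0" for n k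
      using that N unfolding fmat_def by auto
    show "card {k \<in> K. \<bar>x + 2 * of_int n * \<mu> + of_int k\<bar> \<le> N} \<le> q" if "finite K" for n K
      using card_int_progression[OF that, of 1 N "x + 2 * of_int n * \<mu>"] \<open>N \<ge> 0\<close> by (simp add: q_def)
    show "card {n \<in> A. \<bar>x + 2 * of_int n * \<mu> + of_int k\<bar> \<le> N} \<le> q" if "finite A" for k A
      using card_int_progression[OF that, of "2 * \<mu>" N "x + of_int k"] \<open>N \<ge> 0\<close> \<mu>
      by (simp add: q_def algebra_simps)
  qed
  then have "\<exists>C. \<forall>m. opbound C (fmat c \<mu> \<nu> f m)" by auto
  moreover have "f \<in> borel_measurable borel" "\<forall>x y. f (x, y + 1) = f (x, y)"
    using f unfolding Cc_M_def cont_M_def by (auto intro: borel_measurable_continuous_onI)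
  ultimately show ?thesis unfolding admissible_def by blast
qed

text \<open>A finite form of the identity between the squared norm of a matrix and the norm of its
  Gram matrix: for \<open>w = u M\<close> the number \<open>nsq w\<close> is the quadratic form of
  the Gram matrix at the conjugate of \<open>u\<close>. Unit vectors suffice by scaling.\<close>

lemma opbound_gram:
  fixes M :: "'a \<Rightarrow> 'b \<Rightarrow> complex"
  assumes row: "\<And>n. l2 (M n)"
    and gram: "\<And>A \<eta>. finite A \<Longrightarrow> (\<Sum>n\<in>A. (cmod (\<eta> n))\<^sup>2) \<le> 1 \<Longrightarrow>
      cmod (\<Sum>n\<in>A. \<Sum>j\<in>A. cnj (\<eta> n) * dot (M n) (\<lambda>k. cnj (M j k)) * \<eta> j) \<le> 1"
  shows "opbound 1 M"
  unfolding opbound_def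
proof (intro allI impI)
  fix A K u v assume A: "finite (A :: 'a set)" and K: "finite (K :: 'b set)"
  have unit: "cmod (\<Sum>n\<in>A. \<Sum>k\<in>K. u n * M n k * v k) \<le> L2_set (\<lambda>k. cmod (v k)) K"
    if u: "(\<Sum>n\<in>A. (cmod (u n))\<^sup>2) \<le> 1" for u :: "'a \<Rightarrow> complex"
  proof -
    define w where "w k = (\<Sum>n\<in>A. u n * M n k)" for k
    have "((\<lambda>k. \<Sum>n\<in>A. \<Sum>j\<in>A. u n * cnj (u j) * (M n k * cnj (M j k))) has_sum
        (\<Sum>n\<in>A. \<Sum>j\<in>A. u n * cnj (u j) * dot (M n) (\<lambda>k. cnj (M j k)))) UNIV"
      unfolding dot_def
      by (intro has_sum_finite_sum A has_sum_cmult_right has_sum_infsum dot_summable) (simp_all add: row)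
    also have "(\<lambda>k. \<Sum>n\<in>A. \<Sum>j\<in>A. u n * cnj (u j) * (M n k * cnj (M j k))) = (\<lambda>k. of_real ((cmod (w k))\<^sup>2))"
      unfolding complex_norm_square w_def by (simp add: sum_product cnj_sum mult_ac)
    finally have hs: "((\<lambda>k. complex_of_real ((cmod (w k))\<^sup>2)) has_sum
        (\<Sum>n\<in>A. \<Sum>j\<in>A. u n * cnj (u j) * dot (M n) (\<lambda>k. cnj (M j k)))) UNIV" (is "(_ has_sum ?G) _") .
    have "((\<lambda>k. (cmod (w k))\<^sup>2) has_sum Re ?G) UNIV"
      using has_sum_Re[OF hs] by simp
    then have l2w: "l2 w" and nw: "nsq w = Re ?G"
      unfolding l2_def nsq_def by (auto simp: has_sum_iff)
    have "cmod ?G \<le> 1"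
      using gram[OF A, of "\<lambda>n. cnj (u n)"] u by (simp add: mult_ac)
    then have "nsq w \<le> 1"
      using nw complex_Re_le_cmod[of ?G] by linarith
    have "(\<Sum>n\<in>A. \<Sum>k\<in>K. u n * M n k * v k) = (\<Sum>k\<in>K. w k * v k)"
      unfolding w_def sum_distrib_right by (rule sum.swap)
    also have "cmod \<dots> \<le> (\<Sum>k\<in>K. \<bar>cmod (w k)\<bar> * \<bar>cmod (v k)\<bar>)"
      by (rule order_trans[OF norm_sum]) (simp add: norm_mult)
    also have "\<dots> \<le> L2_set (\<lambda>k. cmod (w k)) K * L2_set (\<lambda>k. cmod (v k)) K"
      by (rule L2_set_mult_ineq)
    also have "\<dots> \<le> 1 * L2_set (\<lambda>k. cmod (v k)) K"
    proof (rule mult_right_mono)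
      show "L2_set (\<lambda>k. cmod (w k)) K \<le> 1"
        using L2_set_le_nsq[OF l2w K] \<open>nsq w \<le> 1\<close> by (meson order_trans real_sqrt_le_1_iff)
    qed simp
    finally show ?thesis by simp
  qed
  define s where "s = L2_set (\<lambda>n. cmod (u n)) A"
  show "cmod (\<Sum>n\<in>A. \<Sum>k\<in>K. u n * M n k * v k) \<le> 1 * s * L2_set (\<lambda>k. cmod (v k)) K"
  proof (cases "s = 0")
    case True
    then have "u n = 0" if "n \<in> A" for n
      using L2_set_eq_0_iff[OF A, of "\<lambda>n. cmod (u n)"] that by (simp add: s_def)
    then show ?thesis using True by simp
  next
    case False
    then have s: "s > 0" using L2_set_nonneg[of "\<lambda>n. cmod (u n)" A] by (simp add: s_def order_less_le)
    have "(\<Sum>n\<in>A. (cmod (u n / of_real s))\<^sup>2) = s\<^sup>2 / s\<^sup>2"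
      unfolding s_def L2_set_sq sum_divide_distrib
      by (intro sum.cong) (auto simp: norm_divide power_divide L2_set_sq)
    then have "cmod (\<Sum>n\<in>A. \<Sum>k\<in>K. u n / of_real s * M n k * v k) \<le> L2_set (\<lambda>k. cmod (v k)) K"
      using s by (intro unit) auto
    moreover have "(\<Sum>n\<in>A. \<Sum>k\<in>K. u n / of_real s * M n k * v k) = (\<Sum>n\<in>A. \<Sum>k\<in>K. u n * M n k * v k) / of_real s"
      by (simp add: sum_divide_distrib)
    ultimately have "cmod (\<Sum>n\<in>A. \<Sum>k\<in>K. u n * M n k * v k) / s \<le> L2_set (\<lambda>k. cmod (v k)) K"
      using s by (simp only: norm_divide norm_of_real abs_of_pos)
    then show ?thesis using s by (simp add: pos_divide_le_eq mult.commute)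
  qed
qed

lemma cp_norm_ge:
  assumes "finite A" "(\<Sum>n\<in>A. (cmod (\<xi> n))\<^sup>2) \<le> 1" "(\<Sum>n\<in>A. (cmod (\<eta> n))\<^sup>2) \<le> 1"
  shows "ennreal (cmod (\<Sum>n\<in>A. \<Sum>j\<in>A. cnj (\<eta> n) * \<Phi> (\<alpha> n m) (n - j) * \<xi> j)) \<le> cp_norm \<alpha> \<Phi>"
  unfolding cp_norm_def by (rule SUP_upper2[of "(m, A, \<xi>, \<eta>)"]) (use assms in auto)

lemma cp_norm_ge_coeff0: "ennreal (cmod (\<Phi> m 0)) \<le> cp_norm (lam \<mu> \<nu>) \<Phi>"
  using cp_norm_ge[of "{0}" "\<lambda>_. 1" "\<lambda>_. 1" \<Phi> "lam \<mu> \<nu>" m] by (simp add: lam_def case_prod_unfold)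

text \<open>One approximant at distance below 1 gives the matrix bound: it is bounded itself, and
  \<open>opbound_gram\<close> bounds the difference by 1. Measurability and periodicity pass to the
  pointwise limit, since coefficient 0 of the inner product dominates the squared difference at each
  point.\<close>

lemma Xi_closure_admissible:
  assumes f: "f \<in> Xi_closure c \<mu> \<nu> S" and S: "\<And>g. g \<in> S \<Longrightarrow> admissible c \<mu> \<nu> g"
  shows "admissible c \<mu> \<nu> f"
proof -
  from f obtain F where summ: "\<And>x y. (\<lambda>k :: int. (cmod (f (x + of_int k, y)))\<^sup>2) summable_on UNIV"
    and F: "\<And>n. F n \<in> S"
    and lim: "(\<lambda>n. cp_norm (lam \<mu> \<nu>) (ip_D c \<mu> \<nu> (\<lambda>m. f m - F n m) (\<lambda>m. f m - F n m))) \<longlonglongrightarrow> 0"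
    unfolding Xi_closure_def by blast
  let ?d = "\<lambda>n m. f m - F n m"
  \<comment> \<open>A divergent \<open>infsum\<close> is 0, so smallness of \<open>ip_D\<close>
    alone would not make the rows square-summable; this comes from the summability clause of
    \<open>Xi_closure\<close>.\<close>
  have row_f: "l2 (fmat c \<mu> \<nu> f m n)" for m n
    using summ[of "fst m + 2 * of_int n * \<mu>" "snd m + 2 * of_int n * \<nu>"]
    by (cases m) (simp add: l2_def cmod_fmat)
  have row: "l2 (fmat c \<mu> \<nu> (?d i) m n)" for i m n
    unfolding fmat_diff[abs_def] by (intro l2_diff row_f admissibleD(3)[OF S] F)
  have small: "ennreal ((cmod (?d i m))\<^sup>2) \<le> cp_norm (lam \<mu> \<nu>) (ip_D c \<mu> \<nu> (?d i) (?d i))" for i m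
  proof -
    have "(cmod (?d i m))\<^sup>2 \<le> nsq (fmat c \<mu> \<nu> (?d i) m 0)"
      using member_le_nsq[OF row, of i m 0 0] by simp
    also have "\<dots> = cmod (ip_D c \<mu> \<nu> (?d i) (?d i) m 0)"
      unfolding ip_D_fmat_0 dot_cnj_self[OF row] by simp
    finally show ?thesis
      using cp_norm_ge_coeff0[of "ip_D c \<mu> \<nu> (?d i) (?d i)" m \<mu> \<nu>] by (meson ennreal_leI order_trans)
  qed
  have conv: "(\<lambda>i. F i m) \<longlonglongrightarrow> f m" for m
  proof -
    have "(\<lambda>i. ennreal ((cmod (?d i m))\<^sup>2)) \<longlonglongrightarrow> 0"
      by (rule tendsto_sandwich[OF _ _ tendsto_const lim]) (auto simp: small)
    then have "(\<lambda>i. (cmod (?d i m))\<^sup>2) \<longlonglongrightarrow> 0"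
      by (subst (asm) ennreal_0[symmetric], subst (asm) tendsto_ennreal_iff) auto
    then have "(\<lambda>i. sqrt ((cmod (?d i m))\<^sup>2)) \<longlonglongrightarrow> sqrt 0" by (rule tendsto_real_sqrt)
    then have "(\<lambda>i. f m - F i m) \<longlonglongrightarrow> 0" by (simp add: tendsto_norm_zero_iff)
    then have "(\<lambda>i. f m - (f m - F i m)) \<longlonglongrightarrow> f m - 0" by (intro tendsto_intros)
    then show ?thesis by simp
  qed
  have meas: "f \<in> borel_measurable borel"
    by (rule borel_measurable_LIMSEQ_metric[OF admissibleD(1)[OF S[OF F]] conv])
  have per: "f (x, y + 1) = f (x, y)" for x y
    using LIMSEQ_unique[OF conv[of "(x, y)"], of "f (x, y + 1)"] conv[of "(x, y + 1)"]
    by (simp add: admissibleD(2)[OF S[OF F]])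
  have "\<forall>\<^sub>F i in sequentially. cp_norm (lam \<mu> \<nu>) (ip_D c \<mu> \<nu> (?d i) (?d i)) < 1"
    by (rule order_tendstoD(2)[OF lim]) simp
  then obtain i where i: "cp_norm (lam \<mu> \<nu>) (ip_D c \<mu> \<nu> (?d i) (?d i)) < 1"
    using eventually_happens by force
  have d: "opbound 1 (fmat c \<mu> \<nu> (?d i) m)" for m
  proof (rule opbound_gram[OF row])
    fix A :: "int set" and \<eta> :: "int \<Rightarrow> complex"
    assume A: "finite A" "(\<Sum>n\<in>A. (cmod (\<eta> n))\<^sup>2) \<le> 1"
    show "cmod (\<Sum>n\<in>A. \<Sum>j\<in>A. cnj (\<eta> n) * dot (fmat c \<mu> \<nu> (?d i) m n)
        (\<lambda>k. cnj (fmat c \<mu> \<nu> (?d i) m j k)) * \<eta> j) \<le> 1"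
      using order_trans[OF cp_norm_ge[OF A(1) A(2) A(2), of "ip_D c \<mu> \<nu> (?d i) (?d i)" "lam \<mu> \<nu>" m] less_imp_le[OF i]]
      by (simp add: ip_D_fmat)
  qed
  obtain C where C: "\<And>m. opbound C (fmat c \<mu> \<nu> (F i) m)"
    using admissible_opbound[OF S[OF F]] by metis
  have "opbound (1 + C) (fmat c \<mu> \<nu> f m)" for m
    using opbound_add[OF d[of m] C[of m]] by (simp add: fmat_diff)
  then show ?thesis using meas per unfolding admissible_def by blast
qed

lemma Xi_admissible: "\<mu> > 0 \<Longrightarrow> f \<in> Xi c \<mu> \<nu> \<Longrightarrow> admissible c \<mu> \<nu> f"
  unfolding Xi_def using Xi_closure_admissible Cc_M_admissible by blast

subsection \<open>The residual of a skew derivative\<close>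

lemma amat_shift_x: "amat c \<mu> \<nu> f g (x + of_int l, y) q p = amat c \<mu> \<nu> f g (x, y) (q + l) (p + l)"
  using amat_shift[of c \<mu> \<nu> f g x 0 l y q p] by simp

lemma amat_eq_first_row: "amat c \<mu> \<nu> f g (x, y) q p = amat c \<mu> \<nu> f g (x + of_int q, y) 0 (p - q)"
  by (simp add: amat_shift_x)

lemma amat_row_mv: "amat c \<mu> \<nu> f g m q = mv (tr (fmat c \<mu> \<nu> g m)) (\<lambda>n. cnj (fmat c \<mu> \<nu> f m n q))"
  by (simp add: fun_eq_iff amat_def mv_def tr_def dot_commute)

lemma amat_col_mv: "(\<lambda>q. amat c \<mu> \<nu> f g m q p) = mv (cj (tr (fmat c \<mu> \<nu> f m))) (\<lambda>n. fmat c \<mu> \<nu> g m n p)"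
  by (simp add: amat_def mv_def cj_def tr_def)

lemma l2_amat:
  assumes f: "admissible c \<mu> \<nu> f" and g: "admissible c \<mu> \<nu> g"
  shows "l2 (amat c \<mu> \<nu> f g m q)" "l2 (\<lambda>q. amat c \<mu> \<nu> f g m q p)"
proof -
  obtain C D where C: "\<And>m. opbound C (fmat c \<mu> \<nu> f m)" and D: "\<And>m. opbound D (fmat c \<mu> \<nu> g m)"
    using admissible_opbound[OF f] admissible_opbound[OF g] by metis
  show "l2 (amat c \<mu> \<nu> f g m q)"
    unfolding amat_row_mv by (rule opbound_mv(1)[OF opbound_tr[OF D]]) (simp add: admissibleD[OF f])
  show "l2 (\<lambda>q. amat c \<mu> \<nu> f g m q p)"
    unfolding amat_col_mv by (rule opbound_mv(1)[OF opbound_cj[OF opbound_tr[OF C]]]) (simp add: admissibleD[OF g])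
qed

lemma amat_lincomb_right:
  assumes R: "admissible c \<mu> \<nu> R" and f: "admissible c \<mu> \<nu> f" and g: "admissible c \<mu> \<nu> g"
  shows "amat c \<mu> \<nu> R (\<lambda>m. a * f m + b * g m) m q p = a * amat c \<mu> \<nu> R f m q p + b * amat c \<mu> \<nu> R g m q p"
  unfolding amat_def fmat_lincomb
  by (subst dot_add_right) (simp_all add: dot_scale_right l2_scale admissibleD[OF R] admissibleD[OF f] admissibleD[OF g])

lemma wmat_lincomb:
  assumes R: "admissible c \<mu> \<nu> R" and f: "admissible c \<mu> \<nu> f" and g: "admissible c \<mu> \<nu> g"
  shows "wmat c \<mu> \<nu> R (\<lambda>m. a * f m + b * g m) m n k = a * wmat c \<mu> \<nu> R f m n k + b * wmat c \<mu> \<nu> R g m n k"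
proof -
  have "mv (fmat c \<mu> \<nu> R m) (\<lambda>q. a * amat c \<mu> \<nu> R f m q k + b * amat c \<mu> \<nu> R g m q k) n
      = a * mv (fmat c \<mu> \<nu> R m) (\<lambda>q. amat c \<mu> \<nu> R f m q k) n + b * mv (fmat c \<mu> \<nu> R m) (\<lambda>q. amat c \<mu> \<nu> R g m q k) n"
    unfolding mv_def
    by (subst dot_add_right) (simp_all add: dot_scale_right l2_scale admissibleD[OF R] l2_amat[OF R f] l2_amat[OF R g])
  then show ?thesis
    unfolding wmat_def amat_lincomb_right[OF R f g] fmat_lincomb by (simp add: algebra_simps)
qed

lemma l2_wmat:
  assumes R: "admissible c \<mu> \<nu> R" and f: "admissible c \<mu> \<nu> f"
  shows "l2 (\<lambda>n. wmat c \<mu> \<nu> R f m n k)"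
proof -
  obtain C where C: "\<And>m. opbound C (fmat c \<mu> \<nu> R m)"
    using admissible_opbound[OF R] by metis
  show ?thesis
    unfolding wmat_def by (intro l2_diff admissibleD(4)[OF f] opbound_mv(1)[OF C] l2_amat(2)[OF R f])
qed

lemma wmat_measurable:
  assumes R: "admissible c \<mu> \<nu> R" and f: "admissible c \<mu> \<nu> f"
  shows "(\<lambda>m. wmat c \<mu> \<nu> R f m n k) \<in> borel_measurable borel"
  unfolding wmat_def mv_def dot_def
  by (intro borel_measurable_diff fmat_measurable admissibleD(1)[OF f] borel_measurable_infsum borel_measurable_times
      admissibleD(1)[OF R] amat_measurable[OF R f] dot_summable admissibleD(3)[OF R] l2_amat(2)[OF R f])

lemma wmat_period:
  assumes R: "admissible c \<mu> \<nu> R" and f: "admissible c \<mu> \<nu> f"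
  shows "wmat c \<mu> \<nu> R f (x, y + 1) n k = wmat c \<mu> \<nu> R f (x, y) n k"
  unfolding wmat_def mv_def dot_def by (simp add: fmat_period admissibleD(2)[OF R] admissibleD(2)[OF f] amat_period[OF R f])

text \<open>Both sides are the integral of the squared corner entry over the line times the circle:
  row entries are its translates by integers in \<open>x\<close>, column entries its translates by
  multiples of \<open>(2 * \<mu>, 2 * \<nu>)\<close>.\<close>

lemma SI_row_eq_col:
  fixes T :: "pt \<Rightarrow> int \<Rightarrow> int \<Rightarrow> complex"
  assumes \<mu>: "\<mu> > 0"
    and meas: "(\<lambda>m. T m 0 0) \<in> borel_measurable borel"
    and per: "\<And>x y. T (x, y + 1) 0 0 = T (x, y) 0 0"
    and shift: "\<And>x y j l n k. cmod (T (x + 2 * of_int j * \<mu> + of_int l, y + 2 * of_int j * \<nu>) n k) = cmod (T (x, y) (n + j) (k + l))"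
    and l2: "\<And>m. l2 (T m 0)" "\<And>m. l2 (\<lambda>n. T m n 0)"
  shows "SI (2 * \<mu>) (\<lambda>m. ennreal (nsq (\<lambda>n. T m n 0))) = SI 1 (\<lambda>m. ennreal (nsq (T m 0)))"
proof -
  define g where "g m = ennreal ((cmod (T m 0 0))\<^sup>2)" for m
  have g: "g \<in> borel_measurable borel" "\<And>x y. g (x, y + 1) = g (x, y)"
    using meas per by (simp_all add: g_def[abs_def])
  have col: "ennreal (nsq (\<lambda>n. T (x, y) n 0)) = (\<integral>\<^sup>+n. g (x + real_of_int n * (2 * \<mu>), y + real_of_int n * (2 * \<nu>)) \<partial>count_space UNIV)" for x y
    unfolding g_def nn_integral_count_space_nsq[OF l2(2), symmetric]
    using shift[of x _ 0 y 0 0] by (simp add: mult_ac)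
  have row: "ennreal (nsq (T (x, y) 0)) = (\<integral>\<^sup>+k. g (x + real_of_int k * 1, y + real_of_int k * 0) \<partial>count_space UNIV)" for x y
    unfolding g_def nn_integral_count_space_nsq[OF l2(1), symmetric]
    using shift[of x 0 _ y 0 0] by simp
  have "SI (2 * \<mu>) (\<lambda>m. ennreal (nsq (\<lambda>n. T m n 0)))
      = SI (2 * \<mu>) (\<lambda>(x, y). \<integral>\<^sup>+n. g (x + real_of_int n * (2 * \<mu>), y + real_of_int n * (2 * \<nu>)) \<partial>count_space UNIV)"
    by (rule SI_cong) (auto simp: col)
  also have "\<dots> = SI 1 (\<lambda>(x, y). \<integral>\<^sup>+k. g (x + real_of_int k * 1, y + real_of_int k * 0) \<partial>count_space UNIV)"
    using \<mu> by (subst (1 2) SI_unfold[OF g]) auto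
  also have "\<dots> = SI 1 (\<lambda>m. ennreal (nsq (T m 0)))"
    by (rule SI_cong) (auto simp: row)
  finally show ?thesis .
qed

lemma SI_fmat:
  assumes \<mu>: "\<mu> > 0" and f: "admissible c \<mu> \<nu> f"
  shows "SI (2 * \<mu>) (\<lambda>m. ennreal (nsq (\<lambda>n. fmat c \<mu> \<nu> f m n 0))) = SI 1 (\<lambda>m. ennreal (nsq (fmat c \<mu> \<nu> f m 0)))"
proof (rule SI_row_eq_col[OF \<mu> fmat_measurable[OF admissibleD(1)[OF f]] _ _ admissibleD(3)[OF f] admissibleD(4)[OF f]])
  show "fmat c \<mu> \<nu> f (x, y + 1) 0 0 = fmat c \<mu> \<nu> f (x, y) 0 0" for x y
    by (rule fmat_period) (rule admissibleD(2)[OF f])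
  show "cmod (fmat c \<mu> \<nu> f (x + 2 * of_int j * \<mu> + of_int l, y + 2 * of_int j * \<nu>) n k)
      = cmod (fmat c \<mu> \<nu> f (x, y) (n + j) (k + l))" for x y j l n k
    unfolding fmat_shift by (simp only: norm_mult cmod_echar mult_1_left)
qed

lemma nsq_measurable:
  assumes "\<And>n. (\<lambda>m. T m n) \<in> borel_measurable M" and l2: "\<And>m. l2 (T m)"
  shows "(\<lambda>m. nsq (T m :: int \<Rightarrow> complex)) \<in> borel_measurable M"
proof -
  have "(\<lambda>m. complex_of_real (nsq (T m))) \<in> borel_measurable M"
    unfolding dot_cnj_self[OF l2, symmetric] dot_def
  proof (rule borel_measurable_infsum)
    show "(\<lambda>m. T m k * cnj (T m k)) \<in> borel_measurable M" for k
      by (rule measurable_compose[OF assms(1)[of k]]) (intro borel_measurable_continuous_onI continuous_intros)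
    show "(\<lambda>k. T m k * cnj (T m k)) summable_on UNIV" for m
      by (rule dot_summable) (simp_all add: l2)
  qed
  then have "(\<lambda>m. Re (complex_of_real (nsq (T m)))) \<in> borel_measurable M"
    by (rule measurable_compose[OF _ borel_measurable_Re])
  then show ?thesis by simp
qed

section \<open>The isometries of a normalized vector and its skew derivatives\<close>

locale frame =
  fixes c :: int and \<mu> \<nu> :: real and R :: mfun
  assumes mu_pos: "\<mu> > 0"
    and R: "admissible c \<mu> \<nu> R"
    and R_frame: "ip_E c \<mu> \<nu> R R = Id_E"
begin

abbreviation "A \<equiv> amat c \<mu> \<nu> R"
abbreviation "W \<equiv> wmat c \<mu> \<nu> R"
abbreviation "F \<equiv> fmat c \<mu> \<nu>"

text \<open>The hypothesis on \<open>ip_E\<close> describes only row 0 of the Gram matrix of the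
  columns, but at every point; row \<open>k\<close> at \<open>(x, y)\<close> is row 0 at
  \<open>(x + k, y)\<close>, shifted by \<open>k\<close>.\<close>

lemma orthonormal: "orthonormal_columns (F R m)"
  unfolding orthonormal_columns_def
proof (intro allI)
  fix k l
  obtain x y where m: "m = (x, y)" by (cases m)
  have "dot (\<lambda>n. cnj (F R m n k)) (\<lambda>n. F R m n l) = A R (x + of_int k, y) 0 (l - k)"
    unfolding m using amat_eq_first_row[of c \<mu> \<nu> R R x y k l] by (simp only: amat_def)
  also have "\<dots> = (if k = l then 1 else 0)"
    unfolding ip_E_amat[symmetric] R_frame Id_E_def by simp
  finally show "dot (\<lambda>n. cnj (F R m n k)) (\<lambda>n. F R m n l) = (if k = l then 1 else 0)" .
qed

lemma col_pythagoras:
  assumes f: "admissible c \<mu> \<nu> f"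
  shows "nsq (\<lambda>n. W f m n 0) + nsq (\<lambda>q. A f m q 0) = nsq (\<lambda>n. F f m n 0)"
proof -
  obtain C where C: "opbound C (F R m)" using admissible_opbound[OF R] by metis
  show ?thesis
    unfolding wmat_def amat_col_mv by (rule isometry_residual(3)[OF C orthonormal admissibleD(4)[OF f]])
qed

text \<open>As \<open>amat c \<mu> \<nu> f R\<close> is the adjoint of \<open>A f\<close> (see
  \<open>cnj_amat\<close>), the equation says that \<open>A f\<close> is skew-adjoint.\<close>

definition skew :: "mfun \<Rightarrow> bool" where
  "skew f \<longleftrightarrow> admissible c \<mu> \<nu> f \<and> (\<forall>m q p. amat c \<mu> \<nu> f R m q p = - A f m q p)"

lemma skewD: "skew f \<Longrightarrow> amat c \<mu> \<nu> f R m q p = - A f m q p"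
  unfolding skew_def by blast

text \<open>The left action is faithful on \<open>R\<close>. Vanishing at the translates by
  multiples of \<open>(2 * \<mu>, 2 * \<nu>)\<close> says that the matrix of \<open>R\<close>
  annihilates the conjugated row 0 of the sum, and an isometry is injective. Integer shifts in
  \<open>x\<close> give the other rows.\<close>

lemma skewI:
  assumes f: "admissible c \<mu> \<nu> f"
    and zero: "\<And>m. act_E (\<lambda>m p. ip_E c \<mu> \<nu> f R m p + ip_E c \<mu> \<nu> R f m p) R m = 0"
  shows "skew f"
proof -
  define s where "s m q = amat c \<mu> \<nu> f R m 0 q + A f m 0 q" for m q
  have s0: "s (x, y) q = 0" for x y q
  proof -
    obtain C where C: "opbound C (F R (x, y))" using admissible_opbound[OF R] by metis
    have l2s: "l2 (\<lambda>q. cnj (s (x, y) q))"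
      unfolding l2_cnj s_def by (intro l2_add l2_amat R f)
    have "mv (F R (x, y)) (\<lambda>q. cnj (s (x, y) q)) j = 0" for j
    proof -
      let ?m = "(x + 2 * of_int j * \<mu> + of_int 0, y + 2 * of_int j * \<nu>)"
      let ?\<beta> = "\<lambda>q. echar (of_int (c * q * j) * (y + of_int j * \<nu>))"
      have "0 = (\<Sum>\<^sub>\<infinity>q. cnj (s ?m q) * F R ?m 0 q)"
        using zero[of ?m] unfolding act_E_def case_prod_conv ip_E_amat s_def[symmetric] fmat_0 by (rule sym)
      also have "\<dots> = (\<Sum>\<^sub>\<infinity>q. F R (x, y) j q * cnj (s (x, y) q))"
      proof (rule infsum_cong)
        fix q
        have "s ?m q = ?\<beta> q * s (x, y) q"
          unfolding s_def amat_shift by (simp add: algebra_simps)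
        moreover have "F R ?m 0 q = ?\<beta> q * F R (x, y) j q"
          unfolding fmat_shift by simp
        moreover have "cnj (b * t) * (b * u) = (cnj b * b) * (u * cnj t)" for b t u :: complex
          by (simp add: mult_ac)
        moreover have "cnj (?\<beta> q) * ?\<beta> q = 1" by (simp add: cnj_echar echar_mult)
        ultimately show "cnj (s ?m q) * F R ?m 0 q = F R (x, y) j q * cnj (s (x, y) q)"
          by (simp only: mult_1_left)
      qed
      finally show ?thesis by (simp add: mv_def dot_def)
    qed
    then have Bs: "mv (F R (x, y)) (\<lambda>q. cnj (s (x, y) q)) = (\<lambda>j. 0)" by (rule ext)
    have "(\<lambda>q. cnj (s (x, y) q)) = mv (cj (tr (F R (x, y)))) (\<lambda>j. 0)"
      unfolding Bs[symmetric] by (rule isometry_left_inverse[OF C orthonormal l2s, symmetric])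
    also have "\<dots> = (\<lambda>q. 0)" by (simp add: mv_def dot_def)
    finally have "cnj (s (x, y) q) = 0" by (rule fun_cong)
    then show ?thesis by simp
  qed
  have "amat c \<mu> \<nu> f R (x, y) q p = - A f (x, y) q p" for x y q p
    using s0[of "x + of_int q" y "p - q"] unfolding s_def
    by (simp add: amat_shift_x add_eq_0_iff2)
  then show ?thesis using f unfolding skew_def by auto
qed

text \<open>\<open>\<phi> m n\<close> is the entry \<open>(0, n)\<close> of the symmetrized product
  of the matrices of \<open>f\<close> and \<open>R\<close>, hence the argument \<open>- n\<close>.
  Multiplied by the matrix of \<open>R\<close>, the first summand returns row 0 of
  \<open>F f\<close>, as the columns are orthonormal, and the second gives the subtracted term of
  \<open>W f\<close>, by skewness.\<close>

lemma skew_row: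
  assumes f: "skew f"
  defines "\<phi> \<equiv> \<lambda>m n. ip_D c \<mu> \<nu> f R m (- n) + ip_D c \<mu> \<nu> R f m (- n)"
  shows "l2 (\<phi> m)" and "W f m 0 = mv (tr (F R m)) (\<phi> m)" and "\<exists>C. \<forall>m. nsq (\<phi> m) \<le> C"
proof -
  have gf: "admissible c \<mu> \<nu> f" using f by (simp add: skew_def)
  obtain C D where C: "\<And>m. opbound C (F R m)" and D: "\<And>m. opbound D (F f m)"
    using admissible_opbound[OF R] admissible_opbound[OF gf] by metis
  have \<phi>: "\<phi> m = (\<lambda>n. mv (cj (F R m)) (F f m 0) n + mv (cj (F f m)) (F R m 0) n)" for m
    unfolding \<phi>_def ip_D_fmat_row by (simp add: fun_eq_iff mv_def cj_def dot_commute)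
  have l: "l2 (mv (cj (F R m)) (F f m 0))" "l2 (mv (cj (F f m)) (F R m 0))" for m
    by (intro opbound_mv(1)[OF opbound_cj[OF C]] opbound_mv(1)[OF opbound_cj[OF D]] admissibleD[OF R] admissibleD[OF gf])+
  show "l2 (\<phi> m)" unfolding \<phi> by (rule l2_add(1)[OF l])
  show "W f m 0 = mv (tr (F R m)) (\<phi> m)"
  proof
    fix k
    have rowk: "l2 (tr (F R m) k)" using admissibleD(4)[OF R] by (simp add: tr_def)
    have "mv (tr (F R m)) (\<phi> m) k = mv (tr (F R m)) (mv (cj (F R m)) (F f m 0)) k
        + mv (tr (F R m)) (mv (cj (F f m)) (F R m 0)) k"
      unfolding \<phi> mv_def[of "tr (F R m)"] by (rule dot_add_right[OF rowk l])
    also have "mv (tr (F R m)) (mv (cj (F R m)) (F f m 0)) k = F f m 0 k"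
      by (simp add: isometry_left_inverse_cnj[OF C orthonormal admissibleD(3)[OF gf]])
    also have "mv (tr (F R m)) (mv (cj (F f m)) (F R m 0)) k
        = dot (mv (cj (tr (F f m))) (tr (F R m) k)) (F R m 0)"
      unfolding mv_def[of "tr (F R m)"]
      using dot_mv[OF opbound_cj[OF D] rowk admissibleD(3)[OF R]] by simp
    also have "mv (cj (tr (F f m))) (tr (F R m) k) = (\<lambda>q. amat c \<mu> \<nu> f R m q k)"
      unfolding amat_col_mv by (simp add: tr_def)
    also have "\<dots> = (\<lambda>q. (- 1) * A f m q k)"
      by (simp add: skewD[OF f])
    also have "dot \<dots> (F R m 0) = - mv (F R m) (\<lambda>q. A f m q k) 0"
      unfolding dot_scale_left by (simp add: mv_def dot_commute)
    finally show "W f m 0 k = mv (tr (F R m)) (\<phi> m) k"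
      by (simp add: wmat_def)
  qed
  have "nsq (\<phi> m) \<le> 2 * (C\<^sup>2 * D\<^sup>2) + 2 * (D\<^sup>2 * C\<^sup>2)" for m
  proof -
    have "nsq (\<phi> m) \<le> 2 * nsq (mv (cj (F R m)) (F f m 0)) + 2 * nsq (mv (cj (F f m)) (F R m 0))"
      unfolding \<phi> by (rule l2_add(2)[OF l])
    also have "\<dots> \<le> 2 * (C\<^sup>2 * nsq (F f m 0)) + 2 * (D\<^sup>2 * nsq (F R m 0))"
      by (intro add_mono mult_left_mono opbound_mv(2)[OF opbound_cj[OF C]] opbound_mv(2)[OF opbound_cj[OF D]]
          admissibleD[OF R] admissibleD[OF gf]) auto
    also have "\<dots> \<le> 2 * (C\<^sup>2 * D\<^sup>2) + 2 * (D\<^sup>2 * C\<^sup>2)"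
      by (intro add_mono mult_left_mono opbound_row(2)[OF C] opbound_row(2)[OF D]) auto
    finally show ?thesis .
  qed
  then show "\<exists>C. \<forall>m. nsq (\<phi> m) \<le> C" by blast
qed

lemma skew_row_le:
  assumes f: "skew f"
  shows "l2 (W f m 0)"
    and "nsq (W f m 0) \<le> nsq (\<lambda>n. ip_D c \<mu> \<nu> f R m (- n) + ip_D c \<mu> \<nu> R f m (- n))"
proof -
  obtain C where C: "opbound C (F R m)" using admissible_opbound[OF R] by metis
  show "l2 (W f m 0)" "nsq (W f m 0) \<le> nsq (\<lambda>n. ip_D c \<mu> \<nu> f R m (- n) + ip_D c \<mu> \<nu> R f m (- n))"
    unfolding skew_row(2)[OF f] by (rule bessel[OF C orthonormal skew_row(1)[OF f]])+
qed

text \<open>The values of \<open>tau_E\<close> on the Gram matrices of the columns of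
  \<open>F f\<close>, \<open>A f\<close> and \<open>W f\<close>. Using \<open>ennreal\<close>
  postpones every finiteness question to the one subtraction, in
  \<open>Im_pairing_le\<close>.\<close>

definition nF :: "mfun \<Rightarrow> ennreal" where "nF f = SI (2 * \<mu>) (\<lambda>m. ennreal (nsq (\<lambda>n. F f m n 0)))"
definition nA :: "mfun \<Rightarrow> ennreal" where "nA f = SI (2 * \<mu>) (\<lambda>m. ennreal (nsq (\<lambda>q. A f m q 0)))"
definition nW :: "mfun \<Rightarrow> ennreal" where "nW f = SI (2 * \<mu>) (\<lambda>m. ennreal (nsq (\<lambda>n. W f m n 0)))"

lemma nF_eq:
  assumes f: "admissible c \<mu> \<nu> f" shows "nF f = nW f + nA f"
proof -
  have [measurable]: "(\<lambda>m. nsq (\<lambda>q. A f m q 0)) \<in> borel_measurable borel" "(\<lambda>m. nsq (\<lambda>n. W f m n 0)) \<in> borel_measurable borel"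
    by (intro nsq_measurable amat_measurable wmat_measurable l2_amat l2_wmat R f)+
  have "nF f = SI (2 * \<mu>) (\<lambda>m. ennreal (nsq (\<lambda>n. W f m n 0)) + ennreal (nsq (\<lambda>q. A f m q 0)))"
    unfolding nF_def col_pythagoras[OF f, symmetric] by (simp add: ennreal_plus)
  then show ?thesis unfolding nW_def nA_def by (simp add: SI_add)
qed

text \<open>The column entry \<open>(q, 0)\<close> at \<open>(x, y)\<close> is the row entry
  \<open>(0, - q)\<close> at \<open>(x + q, y)\<close>. Its modulus is invariant under
  \<open>(2 * \<mu>, 2 * \<nu>)\<close>, so \<open>SI_shift\<close> drops the integer shift although
  the domain has width \<open>2 * \<mu>\<close>.\<close>

lemma nA_transpose:
  assumes f: "admissible c \<mu> \<nu> f"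
  shows "nA f = SI (2 * \<mu>) (\<lambda>m. ennreal (nsq (A f m 0)))"
proof -
  define g where "g q m = ennreal ((cmod (A f m 0 q))\<^sup>2)" for q m
  have g: "g q \<in> borel_measurable borel" "g q (x, y + 1) = g q (x, y)" for q x y
    using amat_measurable[OF R f, of 0 q] by (simp_all add: g_def[abs_def] amat_period[OF R f])
  have inv: "g q (x + 2 * \<mu>, y + 2 * \<nu>) = g q (x, y)" for q x y
    using cmod_amat_shift[of c \<mu> \<nu> R f x 1 0 y 0 q] by (simp add: g_def)
  have "nA f = SI (2 * \<mu>) (\<lambda>m. \<integral>\<^sup>+q. (case m of (x, y) \<Rightarrow> g (- q) (x + of_int q, y)) \<partial>count_space UNIV)"
    unfolding nA_def nn_integral_count_space_nsq[OF l2_amat(2)[OF R f], symmetric]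
    by (rule SI_cong) (auto simp: g_def amat_shift_x)
  also have "\<dots> = (\<integral>\<^sup>+q. SI (2 * \<mu>) (\<lambda>(x, y). g (- q) (x + of_int q, y)) \<partial>count_space UNIV)"
  proof (rule SI_count_space)
    fix q
    have "(\<lambda>m :: pt. (fst m + of_int q, snd m)) \<in> borel_measurable borel"
      by (intro borel_measurable_continuous_onI continuous_intros)
    then show "(\<lambda>m. case m of (x, y) \<Rightarrow> g (- q) (x + of_int q, y)) \<in> borel_measurable borel"
      unfolding case_prod_unfold by (rule measurable_compose) (rule g)
  qed
  also have "\<dots> = (\<integral>\<^sup>+q. SI (2 * \<mu>) (g (- q)) \<partial>count_space UNIV)"
    using mu_pos by (subst SI_shift[OF g(1) g(2) _ inv]) auto
  also have "\<dots> = (\<integral>\<^sup>+q. SI (2 * \<mu>) (g q) \<partial>count_space UNIV)"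
    by (rule nn_integral_bij_count_space[where g = uminus]) (rule bij_uminus)
  also have "\<dots> = SI (2 * \<mu>) (\<lambda>m. \<integral>\<^sup>+q. g q m \<partial>count_space UNIV)"
    by (rule SI_count_space[symmetric]) (rule g)
  also have "\<dots> = SI (2 * \<mu>) (\<lambda>m. ennreal (nsq (A f m 0)))"
    unfolding g_def by (simp add: nn_integral_count_space_nsq[OF l2_amat(1)[OF R f]])
  finally show ?thesis .
qed

text \<open>The two matrices are adjoint to each other up to sign, so \<open>nA_transpose\<close>
  applies. This is the vanishing trace of the commutator of \<open>A f\<close> and
  \<open>A g\<close> in polarized form.\<close>

lemma nA_skew:
  assumes f: "skew f" and g: "skew g"
  shows "nA (\<lambda>m. 1 * f m + \<i> * g m) = nA (\<lambda>m. 1 * f m + (- \<i>) * g m)"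
proof -
  have gf: "admissible c \<mu> \<nu> f" and gg: "admissible c \<mu> \<nu> g" using f g by (simp_all add: skew_def)
  have tr: "A f m 0 q = - cnj (A f m q 0)" if "skew f" for f m q
    using cnj_amat[of c \<mu> \<nu> R f m q 0] by (simp add: skewD[OF that])
  have "A (\<lambda>m. 1 * f m + \<i> * g m) m 0 = (\<lambda>q. cnj (- A (\<lambda>m. 1 * f m + (- \<i>) * g m) m q 0))" for m
    unfolding amat_lincomb_right[OF R gf gg] fun_eq_iff by (simp add: tr[OF f] tr[OF g])
  then have "nsq (A (\<lambda>m. 1 * f m + \<i> * g m) m 0) = nsq (\<lambda>q. A (\<lambda>m. 1 * f m + (- \<i>) * g m) m q 0)" for m
    by (simp only: nsq_cnj) (simp add: nsq_def)
  then show ?thesis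
    unfolding nA_transpose[OF admissible_lincomb[OF gf gg], of 1 \<i>] by (simp add: nA_def)
qed

lemma nW_le:
  assumes f: "admissible c \<mu> \<nu> f" and g: "admissible c \<mu> \<nu> g" and b: "cmod b = 1"
  shows "nW (\<lambda>m. 1 * f m + b * g m) \<le> 2 * nW f + 2 * nW g"
proof -
  have [measurable]: "(\<lambda>m. nsq (\<lambda>n. W f m n 0)) \<in> borel_measurable borel" "(\<lambda>m. nsq (\<lambda>n. W g m n 0)) \<in> borel_measurable borel"
    by (intro nsq_measurable wmat_measurable l2_wmat R f g)+
  have "nsq (\<lambda>n. W (\<lambda>m. 1 * f m + b * g m) m n 0) \<le> 2 * nsq (\<lambda>n. W f m n 0) + 2 * nsq (\<lambda>n. W g m n 0)" for m
  proof -
    have "nsq (\<lambda>n. 1 * W f m n 0 + b * W g m n 0) \<le> 2 * nsq (\<lambda>n. 1 * W f m n 0) + 2 * nsq (\<lambda>n. b * W g m n 0)"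
      by (intro l2_add l2_scale l2_wmat R f g)
    then show ?thesis unfolding wmat_lincomb[OF R f g] nsq_scale b by simp
  qed
  then have "nW (\<lambda>m. 1 * f m + b * g m) \<le> SI (2 * \<mu>) (\<lambda>m. ennreal (2 * nsq (\<lambda>n. W f m n 0) + 2 * nsq (\<lambda>n. W g m n 0)))"
    unfolding nW_def by (intro SI_mono ennreal_leI)
  also have "\<dots> = SI (2 * \<mu>) (\<lambda>m. 2 * ennreal (nsq (\<lambda>n. W f m n 0)) + 2 * ennreal (nsq (\<lambda>n. W g m n 0)))"
    by (simp add: ennreal_plus ennreal_mult)
  also have "\<dots> = 2 * nW f + 2 * nW g"
    unfolding nW_def by (simp add: SI_add SI_cmult)
  finally show ?thesis .
qed

text \<open>Pythagoras controls columns of \<open>W f\<close>, whereas the Bessel estimate controls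
  rows; \<open>SI_row_eq_col\<close> connects the two.\<close>

lemma nW_le_row:
  assumes f: "skew f"
  shows "nW f \<le> SI 1 (\<lambda>m. ennreal (nsq (\<lambda>n. ip_D c \<mu> \<nu> f R m (- n) + ip_D c \<mu> \<nu> R f m (- n))))"
proof -
  have gf: "admissible c \<mu> \<nu> f" using f by (simp add: skew_def)
  have "nW f = SI 1 (\<lambda>m. ennreal (nsq (W f m 0)))"
    unfolding nW_def
    by (rule SI_row_eq_col[OF mu_pos wmat_measurable[OF R gf] wmat_period[OF R gf] cmod_wmat_shift
        skew_row_le(1)[OF f] l2_wmat[OF R gf]])
  also have "\<dots> \<le> SI 1 (\<lambda>m. ennreal (nsq (\<lambda>n. ip_D c \<mu> \<nu> f R m (- n) + ip_D c \<mu> \<nu> R f m (- n))))"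
    by (intro SI_mono ennreal_leI skew_row_le(2) f)
  finally show ?thesis .
qed

end

subsection \<open>Traces of derivatives and of inner products\<close>

lemma uniform_limit_ennreal_bound:
  fixes l :: "'a \<Rightarrow> complex"
  assumes bound: "\<And>i m. ennreal (cmod (g i m - l m)) \<le> N i" and lim: "(N \<longlongrightarrow> 0) F"
  shows "uniform_limit UNIV g l F"
proof (rule uniform_limitI)
  fix e :: real assume e: "e > 0"
  have "\<forall>\<^sub>F i in F. N i < ennreal e"
    by (rule order_tendstoD(2)[OF lim]) (use e in simp)
  then show "\<forall>\<^sub>F i in F. \<forall>m\<in>UNIV. dist (g i m) (l m) < e"
  proof eventually_elim
    case (elim i)
    then have "ennreal (cmod (g i m - l m)) < ennreal e" for m
      using bound[of i m] by (rule le_less_trans[rotated])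
    then show ?case using e by (auto simp: dist_norm ennreal_less_iff)
  qed
qed

text \<open>Coefficient 0 is a diagonal entry, so \<open>cp_norm\<close> dominates it uniformly, and
  the phase in \<open>D0\<close> is 1 at \<open>p = 0\<close>: the limit is a continuous function on
  the torus.\<close>

lemma D_alg_coeff0:
  assumes "\<Phi> \<in> D_alg c \<mu> \<nu>"
  shows "continuous_on UNIV (\<lambda>m. \<Phi> m 0)"
    and "\<Phi> (x + 1, y) 0 = \<Phi> (x, y) 0" and "\<Phi> (x, y + 1) 0 = \<Phi> (x, y) 0"
proof -
  obtain G where G: "\<And>n. G n \<in> D0 c \<mu> \<nu>"
    and lim: "(\<lambda>n. cp_norm (lam \<mu> \<nu>) (\<lambda>m p. \<Phi> m p - G n m p)) \<longlonglongrightarrow> 0"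
    using assms unfolding D_alg_def cp_closure_def by blast
  have ul: "uniform_limit UNIV (\<lambda>n m. G n m 0) (\<lambda>m. \<Phi> m 0) sequentially"
    by (rule uniform_limit_ennreal_bound[OF _ lim])
       (use cp_norm_ge_coeff0[of "\<lambda>m p. \<Phi> m p - G _ m p"] in \<open>simp add: norm_minus_commute\<close>)
  have cont: "continuous_on UNIV (\<lambda>m. G n m 0)" and y: "G n (x, y + 1) 0 = G n (x, y) 0" for n x y
    using G[of n] unfolding D0_def Cb_M_def cont_M_def by auto
  have x: "G n (x + 1, y) 0 = G n (x, y) 0" for n x y
  proof -
    have "cnj (echar (of_int (c * k * p) * (y - of_int p * \<nu>))) * G n (x + of_int k, y) p = G n (x, y) p" for k p
      using G[of n] unfolding D0_def by blast
    from this[of 1 0] show ?thesis by simp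
  qed
  show "continuous_on UNIV (\<lambda>m. \<Phi> m 0)"
    by (rule uniform_limit_theorem[OF _ ul]) (simp_all add: cont)
  have pt: "(\<lambda>n. G n m 0) \<longlonglongrightarrow> \<Phi> m 0" for m
    by (rule tendsto_uniform_limitI[OF ul]) simp
  show "\<Phi> (x + 1, y) 0 = \<Phi> (x, y) 0"
    using LIMSEQ_unique[OF pt[of "(x + 1, y)"], of "\<Phi> (x, y) 0"] pt[of "(x, y)"] by (simp add: x)
  show "\<Phi> (x, y + 1) 0 = \<Phi> (x, y) 0"
    using LIMSEQ_unique[OF pt[of "(x, y + 1)"], of "\<Phi> (x, y) 0"] pt[of "(x, y)"] by (simp add: y)
qed

text \<open>The group translates by \<open>x - r\<close> and \<open>y - s\<close>, so the available
  quotients are taken at \<open>t - h\<close>; this produces the minus sign that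
  \<open>delta\<close> carries.\<close>

lemma vector_derivative_reflected_quotient:
  fixes f :: "real \<Rightarrow> complex"
  assumes "((\<lambda>h. (f (t - h) - f t) / of_real h) \<longlongrightarrow> d) (at 0)"
  shows "(f has_vector_derivative - d) (at t)"
proof -
  have "filterlim (\<lambda>h :: real. - h) (at 0) (at 0)"
    by (auto simp: filterlim_at eventually_at intro!: tendsto_eq_intros exI[of _ 1])
  from filterlim_compose[OF assms this]
  have "((\<lambda>h. - ((f (t + h) - f t) / of_real h)) \<longlongrightarrow> d) (at 0)" by simp
  then have "((\<lambda>h. (f (t + h) - f t) / of_real h - (- d)) \<longlongrightarrow> 0) (at 0)"
    using tendsto_minus[of _ d "at 0"] LIM_zero[of _ "- d" "at 0"] by fastforce
  then have *: "((\<lambda>h. cmod ((f (t + h) - f t) / of_real h - (- d))) \<longlongrightarrow> 0) (at 0)"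
    by (rule tendsto_norm_zero)
  have "\<forall>\<^sub>F h in at 0. cmod ((f (t + h) - f t) / of_real h - (- d)) = cmod (f (t + h) - f t - h *\<^sub>R (- d)) / cmod h"
  proof (rule eventually_at_filter[THEN iffD2], rule always_eventually, intro allI impI)
    fix h :: real assume "h \<noteq> 0"
    then have "(f (t + h) - f t) / of_real h - (- d) = (f (t + h) - f t - h *\<^sub>R (- d)) / of_real h"
      by (simp add: field_simps scaleR_conv_of_real)
    then show "cmod ((f (t + h) - f t) / of_real h - (- d)) = cmod (f (t + h) - f t - h *\<^sub>R (- d)) / cmod h"
      by (simp add: norm_divide)
  qed
  then have "((\<lambda>h. cmod (f (t + h) - f t - h *\<^sub>R (- d)) / cmod h) \<longlongrightarrow> 0) (at 0)"
    using Lim_transform_eventually[OF *] by simp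
  then show ?thesis
    unfolding has_vector_derivative_def has_derivative_at
    by (intro conjI bounded_linear_scaleR_left) simp
qed

lemma heis_act_coeff0: "heis_act c \<mu> (r, s, t) \<Phi> (x, y) 0 = \<Phi> (x - r, y - s) 0"
  by (simp add: heis_act_def)

text \<open>Norm differentiability of the orbit at the identity makes the difference quotients of
  coefficient 0 converge uniformly. Hence \<open>D\<close> is continuous, as the iterated integrals
  in \<open>tau_D_delta\<close> require.\<close>

lemma D_smooth_partial:
  assumes "\<Phi> \<in> D_smooth c \<mu> \<nu>" and b: "(r, s, 0) \<in> (Basis :: lie set)"
  shows "\<exists>D. continuous_on UNIV D \<and>
    (\<forall>x y. ((\<lambda>h. (\<Phi> (x - h * r, y - h * s) 0 - \<Phi> (x, y) 0) / of_real h) \<longlongrightarrow> D (x, y)) (at 0))"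
proof -
  have \<Phi>: "\<Phi> \<in> D_alg c \<mu> \<nu>" and sm: "cp_smooth_map (lam \<mu> \<nu>) (\<lambda>g. heis_act c \<mu> g \<Phi>)"
    using assms(1) by (simp_all add: D_smooth_def)
  obtain G where G0: "G [] = (\<lambda>g. heis_act c \<mu> g \<Phi>)"
    and G: "\<And>bs g b. set bs \<subseteq> Basis \<Longrightarrow> b \<in> Basis \<Longrightarrow>
      ((\<lambda>h :: real. cp_norm (lam \<mu> \<nu>) (\<lambda>m p. (G bs (g + h *\<^sub>R b) m p - G bs g m p) / complex_of_real h
        - G (b # bs) g m p)) \<longlongrightarrow> 0) (at 0)"
    using sm unfolding cp_smooth_map_def by blast
  define D where "D m = G [(r, s, 0)] 0 m 0" for m
  have lim: "((\<lambda>h :: real. cp_norm (lam \<mu> \<nu>) (\<lambda>m p. (G [] (0 + h *\<^sub>R (r, s, 0)) m p - G [] 0 m p) / complex_of_real h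
        - G [(r, s, 0)] 0 m p)) \<longlongrightarrow> 0) (at 0)"
    by (rule G) (use b in auto)
  define Q where "Q h m = (\<Phi> (fst m - h * r, snd m - h * s) 0 - \<Phi> m 0) / complex_of_real h" for h m
  have ul: "uniform_limit UNIV Q D (at 0)"
  proof (rule uniform_limit_ennreal_bound[OF _ lim])
    fix h m
    have eq: "Q h m - D m = (G [] (0 + h *\<^sub>R (r, s, 0)) m 0 - G [] 0 m 0) / complex_of_real h - G [(r, s, 0)] 0 m 0"
      using heis_act_coeff0[of c \<mu> "h * r" "h * s" 0 \<Phi> "fst m" "snd m"] heis_act_coeff0[of c \<mu> 0 0 0 \<Phi> "fst m" "snd m"]
      by (simp add: Q_def D_def G0 zero_prod_def)
    show "ennreal (cmod (Q h m - D m)) \<le> cp_norm (lam \<mu> \<nu>) (\<lambda>m p. (G [] (0 + h *\<^sub>R (r, s, 0)) m p - G [] 0 m p) / complex_of_real h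
        - G [(r, s, 0)] 0 m p)"
      unfolding eq
      by (rule cp_norm_ge_coeff0[of "\<lambda>m p. (G [] (0 + h *\<^sub>R (r, s, 0)) m p - G [] 0 m p) / complex_of_real h
        - G [(r, s, 0)] 0 m p"])
  qed
  show ?thesis
  proof (intro exI conjI allI)
    \<comment> \<open>This includes \<open>h = 0\<close>, where division by zero makes
      \<open>Q 0\<close> vanish.\<close>
    have "continuous_on UNIV (Q h)" for h
      unfolding Q_def divide_inverse
      by (intro continuous_intros continuous_on_compose2[OF D_alg_coeff0(1)[OF \<Phi>]]) auto
    then show "continuous_on UNIV D"
      by (intro uniform_limit_theorem[OF _ ul]) auto
    show "((\<lambda>h. (\<Phi> (x - h * r, y - h * s) 0 - \<Phi> (x, y) 0) / of_real h) \<longlongrightarrow> D (x, y)) (at 0)" for x y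
      using tendsto_uniform_limitI[OF ul, of "(x, y)"] by (simp add: Q_def)
  qed
qed

lemma lie_Basis: "(1, 0, 0) \<in> (Basis :: lie set)" "(0, 1, 0) \<in> (Basis :: lie set)"
  by (auto simp: Basis_prod_def zero_prod_def image_iff)

text \<open>At \<open>p = 0\<close> the multiplication terms of \<open>delta\<close> vanish with
  their factor \<open>p\<close>; what remains is a derivative along the torus, whose integral over a
  period is 0.\<close>

lemma tau_D_delta:
  assumes \<Phi>: "\<Phi> \<in> D_smooth c \<mu> \<nu>" and V: "V \<in> {lieX, lieY, lieZ}"
  shows "tau_D (delta c \<mu> V \<Phi>) = 0"
proof -
  have alg: "\<Phi> \<in> D_alg c \<mu> \<nu>" using \<Phi> by (simp add: D_smooth_def)
  consider "V = lieX" | "V = lieY" | "V = lieZ" using V by auto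
  then show ?thesis
  proof cases
    case 1
    obtain D where D: "continuous_on UNIV D"
      and q: "\<And>x y. ((\<lambda>h. (\<Phi> (x - h * 0, y - h * 1) 0 - \<Phi> (x, y) 0) / of_real h) \<longlongrightarrow> D (x, y)) (at 0)"
      using D_smooth_partial[OF \<Phi> lie_Basis(2)] by blast
    have vd: "((\<lambda>u. \<Phi> (x, u) 0) has_vector_derivative - D (x, y)) (at y)" for x y
      using q[of x y] by (intro vector_derivative_reflected_quotient) simp
    have "integral (cbox 0 1) (\<lambda>y. D (x, y)) = 0" for x
    proof -
      have "((\<lambda>y. - D (x, y)) has_integral (\<Phi> (x, 1) 0 - \<Phi> (x, 0) 0)) {0..1}"
        by (rule fundamental_theorem_of_calculus) (auto intro: has_vector_derivative_at_within vd)
      then have "((\<lambda>y. - (- D (x, y))) has_integral - (\<Phi> (x, 1) 0 - \<Phi> (x, 0) 0)) {0..1}"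
        by (rule has_integral_neg)
      then show ?thesis
        using D_alg_coeff0(3)[OF alg, of x 0] by (simp add: integral_unique)
    qed
    then have "integral (cbox (0, 0) (1, 1)) D = 0"
      by (subst integral_prod_continuous) (auto intro: continuous_on_subset[OF D])
    moreover have "delta c \<mu> lieX \<Phi> m 0 = D m" for m
      by (cases m) (simp add: delta_def lieX_def vector_derivative_at[OF vd])
    ultimately show ?thesis using 1 by (simp add: tau_D_def)
  next
    case 2
    obtain D where D: "continuous_on UNIV D"
      and q: "\<And>x y. ((\<lambda>h. (\<Phi> (x - h * 1, y - h * 0) 0 - \<Phi> (x, y) 0) / of_real h) \<longlongrightarrow> D (x, y)) (at 0)"
      using D_smooth_partial[OF \<Phi> lie_Basis(1)] by blast
    have vd: "((\<lambda>u. \<Phi> (u, y) 0) has_vector_derivative - D (x, y)) (at x)" for x y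
      using q[of x y] by (intro vector_derivative_reflected_quotient) simp
    have "integral (cbox 0 1) (\<lambda>x. D (x, y)) = 0" for y
    proof -
      have "((\<lambda>x. - D (x, y)) has_integral (\<Phi> (1, y) 0 - \<Phi> (0, y) 0)) {0..1}"
        by (rule fundamental_theorem_of_calculus) (auto intro: has_vector_derivative_at_within vd)
      then have "((\<lambda>x. - (- D (x, y))) has_integral - (\<Phi> (1, y) 0 - \<Phi> (0, y) 0)) {0..1}"
        by (rule has_integral_neg)
      then show ?thesis
        using D_alg_coeff0(2)[OF alg, of 0 y] by (simp add: integral_unique)
    qed
    moreover have "integral (cbox 0 1) (\<lambda>x. integral (cbox 0 1) (\<lambda>y. D (x, y)))
        = integral (cbox 0 1) (\<lambda>y. integral (cbox 0 1) (\<lambda>x. D (x, y)))"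
      by (rule integral_swap_continuous) (auto intro: continuous_on_subset[OF D])
    ultimately have "integral (cbox (0, 0) (1, 1)) D = 0"
      by (subst integral_prod_continuous) (auto intro: continuous_on_subset[OF D])
    moreover have "delta c \<mu> lieY \<Phi> m 0 = D m" for m
      by (cases m) (simp add: delta_def lieY_def vector_derivative_at[OF vd])
    ultimately show ?thesis using 2 by (simp add: tau_D_def)
  next
    case 3
    have "delta c \<mu> lieZ \<Phi> m 0 = 0" for m by (cases m) (simp add: delta_def lieZ_def)
    then show ?thesis using 3 by (simp add: tau_D_def)
  qed
qed

section \<open>Polarization and the inner product of square-integrable functions\<close>

lemma nsq_lincomb:
  assumes u: "l2 u" and v: "l2 v"
  shows "complex_of_real (nsq (\<lambda>k. 1 * u k + b * v k)) = of_real (nsq u) + cnj b * dot u (\<lambda>k. cnj (v k))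
    + b * cnj (dot u (\<lambda>k. cnj (v k))) + b * cnj b * of_real (nsq v)"
proof -
  have l: "l2 (\<lambda>k. b * v k)" "l2 (\<lambda>k. cnj (u k))" "l2 (\<lambda>k. cnj b * cnj (v k))"
    using u v by (auto intro: l2_scale)
  have "complex_of_real (nsq (\<lambda>k. 1 * u k + b * v k)) = dot (\<lambda>k. u k + b * v k) (\<lambda>k. cnj (u k) + cnj b * cnj (v k))"
    using dot_cnj_self[OF l2_add(1)[OF u l(1)]] by simp
  also have "\<dots> = dot u (\<lambda>k. cnj (u k)) + cnj b * dot u (\<lambda>k. cnj (v k))
      + b * (dot v (\<lambda>k. cnj (u k)) + cnj b * dot v (\<lambda>k. cnj (v k)))"
    using u v l l2_add(1)[OF l(2,3)] by (simp add: dot_add_left dot_add_right dot_scale_left dot_scale_right)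
  also have "dot v (\<lambda>k. cnj (u k)) = cnj (dot u (\<lambda>k. cnj (v k)))"
    by (simp add: cnj_dot dot_commute)
  finally show ?thesis
    by (simp add: dot_cnj_self[OF u] dot_cnj_self[OF v] distrib_left)
qed

lemma polarization:
  assumes u: "l2 u" and v: "l2 v"
  shows "dot u (\<lambda>k. cnj (v k)) =
    (of_real (nsq (\<lambda>k. 1 * u k + 1 * v k)) - of_real (nsq (\<lambda>k. 1 * u k + (- 1) * v k))
     + \<i> * of_real (nsq (\<lambda>k. 1 * u k + \<i> * v k)) - \<i> * of_real (nsq (\<lambda>k. 1 * u k + (- \<i>) * v k))) / 4"
  unfolding nsq_lincomb[OF u v] by (simp add: algebra_simps)

lemma fmat_nsq_bounded:
  assumes f: "admissible c \<mu> \<nu> f"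
  obtains C where "\<And>m. nsq (fmat c \<mu> \<nu> f m 0) \<le> C" and "\<And>m. nsq (\<lambda>n. fmat c \<mu> \<nu> f m n 0) \<le> C"
proof -
  obtain C where C: "\<And>m. opbound C (fmat c \<mu> \<nu> f m)" using admissible_opbound[OF f] by metis
  have "nsq (fmat c \<mu> \<nu> f m 0) \<le> C\<^sup>2" "nsq (\<lambda>n. fmat c \<mu> \<nu> f m n 0) \<le> C\<^sup>2" for m
    using opbound_row(2)[OF C] opbound_row(2)[OF opbound_tr[OF C]] by (auto simp: tr_def)
  then show thesis using that by blast
qed

text \<open>Row 0 consists of the values \<open>f (x + k, y)\<close>, so this is the integral of the
  squared modulus of \<open>f\<close> over the line times the circle, folded along the
  integers.\<close>

definition sqnorm :: "int \<Rightarrow> real \<Rightarrow> real \<Rightarrow> mfun \<Rightarrow> real" where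
  "sqnorm c \<mu> \<nu> f = enn2real (SI 1 (\<lambda>m. ennreal (nsq (fmat c \<mu> \<nu> f m 0))))"

lemma sqnorm_has_integral:
  assumes \<mu>: "\<mu> > 0" and f: "admissible c \<mu> \<nu> f"
  shows "ennreal (sqnorm c \<mu> \<nu> f) = SI 1 (\<lambda>m. ennreal (nsq (fmat c \<mu> \<nu> f m 0)))"
    and "((\<lambda>m. nsq (fmat c \<mu> \<nu> f m 0)) has_integral sqnorm c \<mu> \<nu> f) (cbox (0, 0) (1, 1))"
    and "((\<lambda>m. nsq (\<lambda>n. fmat c \<mu> \<nu> f m n 0)) has_integral sqnorm c \<mu> \<nu> f) (cbox (0, 0) (2 * \<mu>, 1))"
proof -
  obtain C where C: "\<And>m. nsq (fmat c \<mu> \<nu> f m 0) \<le> C" "\<And>m. nsq (\<lambda>n. fmat c \<mu> \<nu> f m n 0) \<le> C"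
    using fmat_nsq_bounded[OF f] by metis
  have meas: "(\<lambda>m. nsq (fmat c \<mu> \<nu> f m 0)) \<in> borel_measurable borel"
    "(\<lambda>m. nsq (\<lambda>n. fmat c \<mu> \<nu> f m n 0)) \<in> borel_measurable borel"
    by (intro nsq_measurable fmat_measurable admissibleD[OF f])+
  note I1 = integral_SI[OF meas(1) nsq_nonneg C(1), where a = 1]
  note I2 = integral_SI[OF meas(2) nsq_nonneg C(2), where a = "2 * \<mu>"]
  have nn: "0 \<le> integral (cbox (0, 0) (a, 1)) (\<lambda>m. nsq (T m))" for a and T :: "pt \<Rightarrow> int \<Rightarrow> complex"
    by (cases "(\<lambda>m. nsq (T m)) integrable_on cbox (0, 0) (a, 1)") (auto intro: integral_nonneg simp: not_integrable_integral)
  have e1: "integral (cbox (0, 0) (1, 1)) (\<lambda>m. nsq (fmat c \<mu> \<nu> f m 0)) = sqnorm c \<mu> \<nu> f"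
    unfolding sqnorm_def I1(2)[symmetric] by (simp add: nn)
  have e2: "integral (cbox (0, 0) (2 * \<mu>, 1)) (\<lambda>m. nsq (\<lambda>n. fmat c \<mu> \<nu> f m n 0)) = sqnorm c \<mu> \<nu> f"
    unfolding sqnorm_def SI_fmat[OF \<mu> f, symmetric] I2(2)[symmetric] by (simp add: nn)
  show "ennreal (sqnorm c \<mu> \<nu> f) = SI 1 (\<lambda>m. ennreal (nsq (fmat c \<mu> \<nu> f m 0)))"
    using I1(2) e1 by simp
  show "((\<lambda>m. nsq (fmat c \<mu> \<nu> f m 0)) has_integral sqnorm c \<mu> \<nu> f) (cbox (0, 0) (1, 1))"
    using integrable_integral[OF I1(1)] e1 by simp
  show "((\<lambda>m. nsq (\<lambda>n. fmat c \<mu> \<nu> f m n 0)) has_integral sqnorm c \<mu> \<nu> f) (cbox (0, 0) (2 * \<mu>, 1))"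
    using integrable_integral[OF I2(1)] e2 by simp
qed

text \<open>
  The inner product of \<open>L\<^sup>2(\<real> \<times> \<real>/\<int>)\<close>, defined by polarization so that only nonnegative functions have to be
  integrated.
\<close>

definition pairing :: "int \<Rightarrow> real \<Rightarrow> real \<Rightarrow> mfun \<Rightarrow> mfun \<Rightarrow> complex" where
  "pairing c \<mu> \<nu> f g = (let N = \<lambda>b. complex_of_real (sqnorm c \<mu> \<nu> (\<lambda>m. 1 * f m + b * g m)) in
     (N 1 - N (- 1) + \<i> * N \<i> - \<i> * N (- \<i>)) / 4)"

lemma Im_pairing:
  "4 * Im (pairing c \<mu> \<nu> f g) = sqnorm c \<mu> \<nu> (\<lambda>m. 1 * f m + \<i> * g m) - sqnorm c \<mu> \<nu> (\<lambda>m. 1 * f m + (- \<i>) * g m)"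
  by (simp add: pairing_def Let_def)

text \<open>Both integrands are polarized into squares for the same four functions, and for each of
  these the two domains give the same \<open>sqnorm\<close>. This yields the trace identity between
  \<open>tau_D\<close> and \<open>tau_E\<close>, with the arguments of \<open>ip_E\<close>
  reversed.\<close>

lemma pairing_has_integral:
  assumes \<mu>: "\<mu> > 0" and f: "admissible c \<mu> \<nu> f" and g: "admissible c \<mu> \<nu> g"
  shows "((\<lambda>m. ip_D c \<mu> \<nu> f g m 0) has_integral pairing c \<mu> \<nu> f g) (cbox (0, 0) (1, 1))"
    and "((\<lambda>m. ip_E c \<mu> \<nu> g f m 0) has_integral pairing c \<mu> \<nu> f g) (cbox (0, 0) (2 * \<mu>, 1))"
proof -
  have h: "admissible c \<mu> \<nu> (\<lambda>m. 1 * f m + b * g m)" for b by (rule admissible_lincomb[OF f g])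
  note I = has_integral_of_real[OF sqnorm_has_integral(2)[OF \<mu> h], where 'b = complex]
    and J = has_integral_of_real[OF sqnorm_has_integral(3)[OF \<mu> h], where 'b = complex]
  show "((\<lambda>m. ip_D c \<mu> \<nu> f g m 0) has_integral pairing c \<mu> \<nu> f g) (cbox (0, 0) (1, 1))"
    unfolding ip_D_fmat_0 polarization[OF admissibleD(3)[OF f] admissibleD(3)[OF g]] pairing_def Let_def
      fmat_lincomb[symmetric]
    by (intro has_integral_divide has_integral_add has_integral_diff has_integral_mult_right I)
  have "ip_E c \<mu> \<nu> g f m 0 = dot (\<lambda>n. fmat c \<mu> \<nu> f m n 0) (\<lambda>n. cnj (fmat c \<mu> \<nu> g m n 0))" for m
    by (simp add: ip_E_amat amat_def dot_commute)
  then show "((\<lambda>m. ip_E c \<mu> \<nu> g f m 0) has_integral pairing c \<mu> \<nu> f g) (cbox (0, 0) (2 * \<mu>, 1))"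
    unfolding pairing_def Let_def
    by (simp only: polarization[OF admissibleD(4)[OF f] admissibleD(4)[OF g]] fmat_lincomb[symmetric])
       (intro has_integral_divide has_integral_add has_integral_diff has_integral_mult_right J)
qed

lemma tau_D_ip: "\<mu> > 0 \<Longrightarrow> admissible c \<mu> \<nu> f \<Longrightarrow> admissible c \<mu> \<nu> g \<Longrightarrow> tau_D (ip_D c \<mu> \<nu> f g) = pairing c \<mu> \<nu> f g"
  unfolding tau_D_def by (intro integral_unique pairing_has_integral(1))

lemma tau_E_ip: "\<mu> > 0 \<Longrightarrow> admissible c \<mu> \<nu> f \<Longrightarrow> admissible c \<mu> \<nu> g \<Longrightarrow> tau_E \<mu> (ip_E c \<mu> \<nu> g f) = pairing c \<mu> \<nu> f g"
  unfolding tau_E_def by (intro integral_unique pairing_has_integral(2))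

lemma pairing_cnj:
  assumes \<mu>: "\<mu> > 0" and f: "admissible c \<mu> \<nu> f" and g: "admissible c \<mu> \<nu> g"
  shows "pairing c \<mu> \<nu> g f = cnj (pairing c \<mu> \<nu> f g)"
proof -
  have "ip_D c \<mu> \<nu> g f m 0 = cnj (ip_D c \<mu> \<nu> f g m 0)" for m
    by (simp add: ip_D_fmat_0 cnj_dot dot_commute)
  then show ?thesis
    unfolding tau_D_ip[OF \<mu> f g, symmetric] tau_D_ip[OF \<mu> g f, symmetric] tau_D_def
    by (simp add: integral_cnj)
qed

text \<open>Linearity is hidden by the polarized definition; it is read off from the integral of
  \<open>ip_D\<close>.\<close>

lemma pairing_lincomb:
  assumes \<mu>: "\<mu> > 0" and f: "admissible c \<mu> \<nu> f" and g: "admissible c \<mu> \<nu> g" and h: "admissible c \<mu> \<nu> h"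
  shows "pairing c \<mu> \<nu> (\<lambda>m. a * f m + b * g m) h = a * pairing c \<mu> \<nu> f h + b * pairing c \<mu> \<nu> g h"
proof -
  have "ip_D c \<mu> \<nu> (\<lambda>m. a * f m + b * g m) h m 0 = a * ip_D c \<mu> \<nu> f h m 0 + b * ip_D c \<mu> \<nu> g h m 0" for m
    unfolding ip_D_fmat_0 fmat_lincomb
    by (subst dot_add_left) (simp_all add: dot_scale_left l2_scale admissibleD[OF f] admissibleD[OF g] admissibleD[OF h])
  then have "((\<lambda>m. ip_D c \<mu> \<nu> (\<lambda>m. a * f m + b * g m) h m 0) has_integral
      a * pairing c \<mu> \<nu> f h + b * pairing c \<mu> \<nu> g h) (cbox (0, 0) (1, 1))"
    by (simp only:) (intro has_integral_add has_integral_mult_right pairing_has_integral \<mu> f g h)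
  then show ?thesis
    using pairing_has_integral(1)[OF \<mu> admissible_lincomb[OF f g] h] has_integral_unique by blast
qed

subsection \<open>The lower bound\<close>

context frame
begin

lemma residual_le_integral:
  assumes f: "skew f"
  defines "u \<equiv> \<lambda>m. nsq (\<lambda>n. ip_D c \<mu> \<nu> f R m (- n) + ip_D c \<mu> \<nu> R f m (- n))"
  shows "u integrable_on cbox (0, 0) (1, 1)"
    and "nW f \<le> ennreal (integral (cbox (0, 0) (1, 1)) u)"
    and "0 \<le> integral (cbox (0, 0) (1, 1)) u"
proof -
  have gf: "admissible c \<mu> \<nu> f" using f by (simp add: skew_def)
  have meas: "(\<lambda>m. ip_D c \<mu> \<nu> f g m (- n)) \<in> borel_measurable borel"
    if f: "admissible c \<mu> \<nu> f" and g: "admissible c \<mu> \<nu> g" for f g n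
  proof -
    have "(\<lambda>m. cnj (F g m n k)) \<in> borel_measurable borel" for k
      by (rule measurable_compose[OF fmat_measurable[OF admissibleD(1)[OF g]]])
         (intro borel_measurable_continuous_onI continuous_intros)
    then show ?thesis
      unfolding ip_D_fmat_row dot_def
      by (intro borel_measurable_infsum borel_measurable_times fmat_measurable admissibleD[OF f] dot_summable)
         (simp_all add: admissibleD[OF g])
  qed
  obtain C where C: "\<And>m. u m \<le> C"
    using skew_row(3)[OF f] unfolding u_def by metis
  have u: "u \<in> borel_measurable borel"
    unfolding u_def by (intro nsq_measurable skew_row(1)[OF f] borel_measurable_add meas R gf)
  have nn: "0 \<le> u m" for m by (simp add: u_def)
  show "u integrable_on cbox (0, 0) (1, 1)" by (rule integral_SI(1)[OF u nn C])
  then show "0 \<le> integral (cbox (0, 0) (1, 1)) u" by (rule integral_nonneg) (rule nn)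
  show "nW f \<le> ennreal (integral (cbox (0, 0) (1, 1)) u)"
    unfolding integral_SI(2)[OF u nn C] unfolding u_def by (rule nW_le_row[OF f])
qed

lemma Im_pairing_le:
  assumes f: "skew f" and g: "skew g"
  defines "r \<equiv> \<lambda>f. integral (cbox (0, 0) (1, 1)) (\<lambda>m. nsq (\<lambda>n. ip_D c \<mu> \<nu> f R m (- n) + ip_D c \<mu> \<nu> R f m (- n)))"
  shows "\<bar>Im (pairing c \<mu> \<nu> f g)\<bar> \<le> (r f + r g) / 2"
proof -
  have gf: "admissible c \<mu> \<nu> f" and gg: "admissible c \<mu> \<nu> g" using f g by (simp_all add: skew_def)
  let ?p = "\<lambda>m. 1 * f m + \<i> * g m" and ?q = "\<lambda>m. 1 * f m + (- \<i>) * g m"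
  have gp: "admissible c \<mu> \<nu> ?p" and gq: "admissible c \<mu> \<nu> ?q" by (rule admissible_lincomb[OF gf gg])+
  have eq: "ennreal (sqnorm c \<mu> \<nu> h) = nW h + nA h" if "admissible c \<mu> \<nu> h" for h
    unfolding sqnorm_has_integral(1)[OF mu_pos that] SI_fmat[OF mu_pos that, symmetric]
    using nF_eq[OF that] by (simp add: nF_def)
  have rf: "nW f \<le> ennreal (r f)" "0 \<le> r f" and rg: "nW g \<le> ennreal (r g)" "0 \<le> r g"
    unfolding r_def by (rule residual_le_integral[OF f] residual_le_integral[OF g])+
  have bound: "nW (\<lambda>m. 1 * f m + b * g m) \<le> ennreal (2 * r f + 2 * r g)" if "cmod b = 1" for b
  proof -
    have "nW (\<lambda>m. 1 * f m + b * g m) \<le> 2 * nW f + 2 * nW g" by (rule nW_le[OF gf gg that])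
    also have "\<dots> \<le> 2 * ennreal (r f) + 2 * ennreal (r g)" by (intro add_mono mult_left_mono rf rg) auto
    also have "\<dots> = ennreal (2 * r f + 2 * r g)" using rf rg by (simp add: ennreal_plus ennreal_mult)
    finally show ?thesis .
  qed
  have bp: "nW ?p \<le> ennreal (2 * r f + 2 * r g)" and bq: "nW ?q \<le> ennreal (2 * r f + 2 * r g)"
    by (rule bound; simp)+
  obtain p where p: "nW ?p = ennreal p" "0 \<le> p"
    using bp by (cases "nW ?p") (auto simp: top_unique)
  obtain q where q: "nW ?q = ennreal q" "0 \<le> q"
    using bq by (cases "nW ?q") (auto simp: top_unique)
  \<comment> \<open>The common part must be finite before it can cancel; it is dominated by a finite
    \<open>sqnorm\<close>.\<close>
  have "nA ?p \<le> ennreal (sqnorm c \<mu> \<nu> ?p)" unfolding eq[OF gp] by simp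
  then obtain a where a: "nA ?p = ennreal a" "0 \<le> a"
    by (cases "nA ?p") (auto simp: top_unique)
  have aq: "nA ?q = ennreal a" using a(1) by (simp only: nA_skew[OF f g])
  have nn: "0 \<le> sqnorm c \<mu> \<nu> h" for h by (simp add: sqnorm_def)
  have sp: "sqnorm c \<mu> \<nu> ?p = p + a"
    using eq[OF gp] p a nn[of ?p] by (simp add: ennreal_plus[symmetric] del: ennreal_plus)
  have sq: "sqnorm c \<mu> \<nu> ?q = q + a"
    using eq[OF gq] q a(2) aq nn[of ?q] by (simp add: ennreal_plus[symmetric] del: ennreal_plus)
  have "p \<le> 2 * r f + 2 * r g" "q \<le> 2 * r f + 2 * r g"
    using bp bq rf(2) rg(2) unfolding p(1) q(1) by (simp_all add: ennreal_le_iff del: ennreal_plus)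
  moreover have "4 * Im (pairing c \<mu> \<nu> f g) = p - q"
    unfolding Im_pairing sp sq by simp
  moreover have "\<bar>z\<bar> \<le> (s + t) / 2"
    if "p \<le> 2 * s + 2 * t" "q \<le> 2 * s + 2 * t" "4 * z = p - q" "0 \<le> p" "0 \<le> q" for s t z p q :: real
    using that by (simp add: abs_le_iff field_simps)
  ultimately show ?thesis
    using p(2) q(2) by blast
qed

text \<open>\<open>T\<close> is self-adjoint in the crossed product, so coefficient 0 of its square
  is a sum of squared moduli. For \<open>f = \<nabla>\<^sub>V R\<close> this identifies a summand of
  \<open>S_action\<close> with the integrand that bounds the residual.\<close>

lemma cp_mult_square_coeff0:
  assumes f: "skew f"
  defines "T \<equiv> \<lambda>m p. ip_D c \<mu> \<nu> f R m p + ip_D c \<mu> \<nu> R f m p"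
  shows "cp_mult (lam \<mu> \<nu>) T T m 0 = of_real (nsq (\<lambda>n. T m (- n)))"
proof -
  have herm: "T (lam \<mu> \<nu> (- q) m) (0 - q) = cnj (T m q)" for q
    unfolding T_def diff_0 ip_D_hermitian by simp
  have "cp_mult (lam \<mu> \<nu>) T T m 0 = (\<Sum>\<^sub>\<infinity>q. T m q * cnj (T m q))"
    unfolding cp_mult_def herm ..
  also have "\<dots> = (\<Sum>\<^sub>\<infinity>n. T m (- n) * cnj (T m (- n)))"
    by (rule infsum_reindex_bij_betw[OF bij_uminus, symmetric])
  also have "\<dots> = of_real (nsq (\<lambda>n. T m (- n)))"
    unfolding dot_def[symmetric] by (rule dot_cnj_self) (use skew_row(1)[OF f] in \<open>simp add: T_def\<close>)
  finally show ?thesis .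
qed

end

section \<open>Curvature, the two imaginary parts and the final estimate\<close>

lemma act_E_scalar: "act_E (\<lambda>m p. a * Id_E m p) f = (\<lambda>m. cnj a * f m)"
proof
  fix m :: pt
  obtain x y where m: "m = (x, y)" by (cases m)
  have "act_E (\<lambda>m p. a * Id_E m p) f m = (\<Sum>\<^sub>\<infinity>q\<in>{0 :: int}. cnj a * f (x, y))"
    unfolding m act_E_def case_prod_conv by (rule infsum_cong_neutral) (auto simp: Id_E_def)
  then show "act_E (\<lambda>m p. a * Id_E m p) f m = cnj a * f m" by (simp add: m)
qed

lemma tau_E_Id: "\<mu> > 0 \<Longrightarrow> tau_E \<mu> Id_E = of_real (2 * \<mu>)"
  by (simp add: tau_E_def Id_E_def content_Pair scaleR_conv_of_real)

theorem theorem4p4: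
  fixes c :: int and \<mu> \<nu> :: real
    and Einf :: "coeffs set" and Xiinf :: "mfun set"
    and R :: mfun and P :: coeffs and nab :: conn
  assumes "c > 0" and "\<mu> > 0"
    and "smooth_bimodule c \<mu> \<nu> Einf Xiinf"
    and "R \<in> Xiinf"
    and "P = ip_D c \<mu> \<nu> R R" and "projection_D c \<mu> \<nu> P"
    and "ip_E c \<mu> \<nu> R R = Id_E"
    and "yang_mills_connection c \<mu> \<nu> Xiinf nab"
    and "curvature_is c \<mu> \<nu> Xiinf nab lieX lieY (\<lambda>m p. 0)"
    and "curvature_is c \<mu> \<nu> Xiinf nab lieX lieZ (\<lambda>m p. 0)"
    and "curvature_is c \<mu> \<nu> Xiinf nab lieY lieZ
           (\<lambda>m p. of_real pi * \<i> / of_real \<mu> * Id_E m p)"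
  shows "S_action c \<mu> \<nu> P \<in> \<real> \<and>
         Re (S_action c \<mu> \<nu> P) \<ge>
           cmod (of_int c / (2 * of_real pi * \<i>) * tau_E \<mu> (ip_E c \<mu> \<nu> R (nab lieZ R)) - 1)"
proof -
  note \<mu> = \<open>\<mu> > 0\<close>
  have "Xiinf \<subseteq> Xi c \<mu> \<nu>"
    and ip_smooth: "\<And>f g. f \<in> Xiinf \<Longrightarrow> g \<in> Xiinf \<Longrightarrow> ip_D c \<mu> \<nu> f g \<in> D_smooth c \<mu> \<nu>"
    using assms(3) unfolding smooth_bimodule_def by blast+
  then have admissible: "admissible c \<mu> \<nu> f" if "f \<in> Xiinf" for f
    using that Xi_admissible[OF \<mu>] by blast
  have comp: "compatible c \<mu> \<nu> Xiinf nab"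
    using assms(8) by (simp add: yang_mills_connection_def)
  then have "connection c \<mu> \<nu> Xiinf nab"
    and delta_ip: "\<And>V f g. f \<in> Xiinf \<Longrightarrow> g \<in> Xiinf \<Longrightarrow> delta c \<mu> V (ip_D c \<mu> \<nu> f g) =
          (\<lambda>m p. ip_D c \<mu> \<nu> (nab V f) g m p + ip_D c \<mu> \<nu> f (nab V g) m p)"
    and comm_E: "\<And>V f g h. f \<in> Xiinf \<Longrightarrow> g \<in> Xiinf \<Longrightarrow> h \<in> Xiinf \<Longrightarrow>
        (\<lambda>m. nab V (act_E (ip_E c \<mu> \<nu> f g) h) m - act_E (ip_E c \<mu> \<nu> f g) (nab V h) m) =
          act_E (\<lambda>m p. ip_E c \<mu> \<nu> (nab V f) g m p + ip_E c \<mu> \<nu> f (nab V g) m p) h"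
    unfolding compatible_def by blast+
  then have nab: "\<And>V f. f \<in> Xiinf \<Longrightarrow> nab V f \<in> Xiinf"
    and nab_lin: "\<And>V W a b f. f \<in> Xiinf \<Longrightarrow>
        nab (a *\<^sub>R V + b *\<^sub>R W) f = (\<lambda>m. of_real a * nab V f m + of_real b * nab W f m)"
    unfolding connection_def by blast+
  interpret frame c \<mu> \<nu> R
    by unfold_locales (use \<mu> admissible[OF \<open>R \<in> Xiinf\<close>] assms(7) in auto)
  note R = \<open>R \<in> Xiinf\<close>
  have sk: "skew (nab V R)" for V
  proof (rule skewI[OF admissible[OF nab[OF R]]])
    have Id: "act_E Id_E f = f" for f
      using act_E_scalar[of 1 f] by simp
    \<comment> \<open>\<open>ip_E\<close> of \<open>R\<close> with itself acts as the identity, so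
      its commutator with the connection is 0.\<close>
    have "(\<lambda>m. 0) = act_E (\<lambda>m p. ip_E c \<mu> \<nu> (nab V R) R m p + ip_E c \<mu> \<nu> R (nab V R) m p) R"
      using comm_E[OF R R R, of V] by (simp add: assms(7) Id)
    then show "act_E (\<lambda>m p. ip_E c \<mu> \<nu> (nab V R) R m p + ip_E c \<mu> \<nu> R (nab V R) m p) R m = 0" for m
      by metis
  qed
  define L where "L = pairing c \<mu> \<nu>"
  define r where "r V = integral (cbox (0, 0) (1, 1))
    (\<lambda>m. nsq (\<lambda>n. ip_D c \<mu> \<nu> (nab V R) R m (- n) + ip_D c \<mu> \<nu> R (nab V R) m (- n)))" for V
  have r_nonneg: "0 \<le> r V" for V unfolding r_def by (rule residual_le_integral(3)[OF sk])
  have Im_le: "\<bar>Im (L (nab V R) (nab W R))\<bar> \<le> (r V + r W) / 2" for V W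
    unfolding L_def r_def by (rule Im_pairing_le[OF sk sk])

  have S: "S_action c \<mu> \<nu> P = of_real (2 * (r lieX + r lieY + r lieZ))"
  proof -
    have sq: "((\<lambda>m. cp_mult (lam \<mu> \<nu>) (delta c \<mu> V P) (delta c \<mu> V P) m 0) has_integral complex_of_real (r V))
        (cbox (0, 0) (1, 1))" for V
      unfolding \<open>P = _\<close> delta_ip[OF R R] cp_mult_square_coeff0[OF sk] r_def
      by (intro has_integral_of_real integrable_integral residual_le_integral(1)[OF sk])
    show ?thesis
      unfolding S_action_def Let_def tau_D_def
      using integral_unique[OF has_integral_add[OF has_integral_add[OF sq[of lieX] sq[of lieY]] sq[of lieZ]]] by simp
  qed

  \<comment> \<open>Compatibility on the right together with \<open>tau_D_delta\<close>: the
    covariant derivative is skew for \<open>L\<close>, tested against \<open>R\<close>.\<close>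
  have Leibniz: "L (nab V f) R + L f (nab V R) = 0" if "f \<in> Xiinf" "V \<in> {lieX, lieY, lieZ}" for f V
  proof -
    have "((\<lambda>m. delta c \<mu> V (ip_D c \<mu> \<nu> f R) m 0) has_integral (L (nab V f) R + L f (nab V R))) (cbox (0, 0) (1, 1))"
      unfolding delta_ip[OF that(1) R] L_def
      by (intro has_integral_add pairing_has_integral \<mu> admissible nab that R)
    then have "tau_D (delta c \<mu> V (ip_D c \<mu> \<nu> f R)) = L (nab V f) R + L f (nab V R)"
      unfolding tau_D_def by (rule integral_unique)
    then show ?thesis using tau_D_delta[OF ip_smooth[OF that(1) R] that(2)] by simp
  qed
  \<comment> \<open>Skewness turns each of the two second derivatives paired with \<open>R\<close>
    into a pairing of first derivatives; their difference is a number minus its conjugate.\<close>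
  have commutator: "2 * \<i> * of_real (Im (L (nab V R) (nab W R))) = L (\<lambda>m. nab V (nab W R) m - nab W (nab V R) m) R"
    if "V \<in> {lieX, lieY, lieZ}" "W \<in> {lieX, lieY, lieZ}" for V W
  proof -
    have "L (\<lambda>m. 1 * nab V (nab W R) m + (- 1) * nab W (nab V R) m) R = L (nab V (nab W R)) R - L (nab W (nab V R)) R"
      unfolding L_def by (subst pairing_lincomb) (auto intro: \<mu> admissible nab R)
    also have "\<dots> = L (nab V R) (nab W R) - L (nab W R) (nab V R)"
      using Leibniz[OF nab[OF R] that(1), of W] Leibniz[OF nab[OF R] that(2), of V]
      by (simp add: add_eq_0_iff2)
    also have "L (nab W R) (nab V R) = cnj (L (nab V R) (nab W R))"
      unfolding L_def by (rule pairing_cnj[OF \<mu> admissible admissible]) (intro nab R)+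
    finally show ?thesis by (simp add: complex_eq_iff)
  qed
  have curv: "(\<lambda>m. nab V (nab W R) m - nab W (nab V R) m) = (\<lambda>m. cnj a * R m + nab (lie_bracket c V W) R m)"
    if "curvature_is c \<mu> \<nu> Xiinf nab V W (\<lambda>m p. a * Id_E m p)" for V W a
  proof -
    have "curvature c nab V W R = (\<lambda>m. cnj a * R m)"
      using that R unfolding curvature_is_def by (simp add: act_E_scalar)
    then show ?thesis unfolding curvature_def by (metis (no_types, lifting) diff_eq_eq)
  qed

  have LRR: "L R R = of_real (2 * \<mu>)"
    unfolding L_def tau_E_ip[OF \<mu> admissible[OF R] admissible[OF R], symmetric] assms(7) by (rule tau_E_Id[OF \<mu>])
  have YZ: "Im (L (nab lieY R) (nab lieZ R)) = - pi"
  proof -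
    have "nab (lie_bracket c lieY lieZ) R = (\<lambda>m. 0)"
      using nab_lin[OF R, of 0 lieX 0 lieX] by (simp add: lie_bracket_def lieY_def lieZ_def zero_prod_def)
    then have "2 * \<i> * of_real (Im (L (nab lieY R) (nab lieZ R)))
        = L (\<lambda>m. cnj (of_real pi * \<i> / of_real \<mu>) * R m + 0 * R m) R"
      using commutator[of lieY lieZ] curv[OF assms(11)] by simp
    also have "\<dots> = cnj (of_real pi * \<i> / of_real \<mu>) * of_real (2 * \<mu>)"
      unfolding L_def pairing_lincomb[OF \<mu> admissible[OF R] admissible[OF R] admissible[OF R]] unfolding L_def[symmetric] LRR by simp
    \<comment> \<open>The left action conjugates the scalar, which explains the sign, and the value
      \<open>2 * \<mu>\<close> of \<open>L R R\<close> cancels the denominator.\<close>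
    also have "\<dots> = 2 * \<i> * of_real (- pi)" using \<mu> by simp
    finally show ?thesis by (simp del: of_real_minus)
  qed
  define \<tau> where "\<tau> = tau_E \<mu> (ip_E c \<mu> \<nu> R (nab lieZ R))"
  have XY: "of_int c * \<tau> = 2 * \<i> * of_real (Im (L (nab lieX R) (nab lieY R)))"
  proof -
    \<comment> \<open>Zero curvature leaves only the derivative along [X, Y] = cZ, the source of
      \<open>c * \<tau>\<close> in the claim.\<close>
    have "nab (lie_bracket c lieX lieY) R = (\<lambda>m. of_int c * nab lieZ R m)"
      using nab_lin[OF R, of "of_int c" lieZ 0 lieX] by (simp add: lie_bracket_def lieX_def lieY_def lieZ_def)
    then have "2 * \<i> * of_real (Im (L (nab lieX R) (nab lieY R))) = L (\<lambda>m. 0 * R m + of_int c * nab lieZ R m) R"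
      using commutator[of lieX lieY] curv[of lieX lieY 0] assms(9) by simp
    also have "\<dots> = of_int c * \<tau>"
      unfolding L_def pairing_lincomb[OF \<mu> admissible[OF R] admissible[OF nab[OF R]] admissible[OF R]]
        \<tau>_def tau_E_ip[OF \<mu> admissible[OF nab[OF R]] admissible[OF R]] by simp
    finally show ?thesis by simp
  qed

  define x where "x = Im (L (nab lieX R) (nab lieY R))"
  have "of_int c / (2 * of_real pi * \<i>) * \<tau> - 1 = of_int c * \<tau> / (2 * of_real pi * \<i>) - 1" by simp
  also have "\<dots> = of_real (x / pi - 1)" unfolding XY x_def[symmetric] by simp
  finally have "cmod (of_int c / (2 * of_real pi * \<i>) * \<tau> - 1) = \<bar>x / pi - 1\<bar>" by (simp only: norm_of_real real_norm_def)
  \<comment> \<open>The sign of \<open>x\<close> is unknown, so the triangle inequality separates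
    the 1. It is then enlarged to \<pi>, the modulus found in \<open>YZ\<close>.\<close>
  also have "\<dots> \<le> \<bar>x\<bar> / pi + 1" using abs_triangle_ineq4[of "x / pi" 1] by simp
  also have "\<dots> \<le> \<bar>x\<bar> + pi"
  proof (rule add_mono)
    show "\<bar>x\<bar> / pi \<le> \<bar>x\<bar>" using pi_gt3 by (simp add: divide_le_eq mult_le_cancel_left1)
    show "1 \<le> pi" using pi_gt3 by simp
  qed
  also have "\<dots> \<le> (r lieX + r lieY) / 2 + (r lieY + r lieZ) / 2"
    using Im_le[of lieX lieY] Im_le[of lieY lieZ] unfolding YZ x_def by (intro add_mono) simp_all
  \<comment> \<open>\<open>r lieY\<close> enters both halves; even so the left side is at most half
    of the right.\<close>
  also have "\<dots> \<le> 2 * (r lieX + r lieY + r lieZ)"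
    using r_nonneg[of lieX] r_nonneg[of lieY] r_nonneg[of lieZ] by (simp add: field_simps)
  finally show ?thesis unfolding S \<tau>_def by simp
qed

end
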